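(* Let $\{M_n\}_{n\ge1} \subset GL(2,\mathbb{Z})$ be a sequence of expanding matrices, and let $\{D_n\}_{n\ge1}$ be a sequence of digit sets in $\mathbb{Z}^2$ of the form $$D_n=\left\{\begin{pmatrix}0\\0\end{pmatrix},\begin{pmatrix}\alpha_{n_1}\\\alpha_{n_2}\end{pmatrix},\begin{pmatrix}\beta_{n_1}\\\beta_{n_2}\end{pmatrix},\begin{pmatrix}-\alpha_{n_1}-\beta_{n_1}\\-\alpha_{n_2}-\beta_{n_2}\end{pmatrix}\right\},\qquad \alpha_{n_1}\beta_{n_2}-\alpha_{n_2}\beta_{n_1}\not\equiv 0 \pmod 2 .$$ Suppose that (i) $|\det(M_n)|>4$ for all $n\ge1$; (ii) $\sup_{n\ge1}\|M_n^{-1}\|<1$; (iii) the collection $\{D_n:n\ge1\}$ is finite. Then the Moran measure $$\mu_{\{M_n\},\{D_n\}}=\delta_{M_1^{-1}D_1}*\delta_{M_1^{-1}M_2^{-1}D_2}*\cdots*\delta_{M_1^{-1}M_2^{-1}\cdots M_n^{-1}D_n}*\cdots$$ is a spectral measure if and only if $M_n\in GL(2,2\mathbb{Z})$ for all $n\ge2$.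
   Context: $GL(2,\mathbb{Z})$ denotes the set of $2\times2$ matrices with integer entries and nonzero determinant (not necessarily $\pm1$); $GL(2,2\mathbb{Z})$ denotes the set of those with all entries in $2\mathbb{Z}$. A real square matrix is expanding if all its eigenvalues have modulus greater than one. $\|A\|=\sup_{x\ne\mathbf 0}\|Ax\|_2/\|x\|_2$ is the operator norm induced by the Euclidean norm $\|\cdot\|_2$. For a finite set $E\subset\mathbb{R}^2$, $\delta_E=\frac1{\#E}\sum_{e\in E}\delta_e$, where $\delta_e$ is the point mass at $e$; $*$ is convolution of measures. The infinite convolution denotes the weak limit (a Borel probability measure) of the finite convolutions $\delta_{M_1^{-1}D_1}*\cdots*\delta_{M_1^{-1}\cdots M_n^{-1}D_n}$ as $n\to\infty$, when it exists; it is called a Moran measure. A Borel measure $\mu$ on $\mathbb{R}^2$ is a spectral measure if there is a countable discrete set $\Lambda\subset\mathbb{R}^2$ (a spectrum of $\mu$) such that $\{e^{2\pi i\langle\lambda,x\rangle}\}_{\lambda\in\Lambda}$ is an orthonormal basis of $L^2(\mu)$. *)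

theory Defs
  imports "HOL-Probability.Probability" "HOL-Number_Theory.Cong"
begin

text \<open>Here \<open>GL\<^sub>2(R)\<close> only asks for a nonzero determinant, not for invertibility over \<open>R\<close>.\<close>

definition GL2 :: "real set \<Rightarrow> (real^2^2) set" where
  "GL2 R = {A. (\<forall>i j. A $ i $ j \<in> R) \<and> det A \<noteq> 0}"

definition even_Ints :: "real set" where
  "even_Ints = range (\<lambda>k::int. 2 * real_of_int k)"

text \<open>Eigenvalues of a real matrix are the complex ones.\<close>

definition complex_eigenvalue :: "real^'n^'n \<Rightarrow> complex \<Rightarrow> bool" where
  "complex_eigenvalue A c \<longleftrightarrow>
     (\<exists>v::complex^'n. v \<noteq> 0 \<and> map_matrix complex_of_real A *v v = c *s v)"

definition expanding :: "real^'n^'n \<Rightarrow> bool" where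
  "expanding A \<longleftrightarrow> (\<forall>c. complex_eigenvalue A c \<longrightarrow> cmod c > 1)"

definition delta :: "(real^2) set \<Rightarrow> (real^2) measure" where
  "delta E = distr (uniform_count_measure E) borel (\<lambda>x. x)"

lemma emeasure_delta:
  assumes "finite E" "E \<noteq> {}" "A \<in> sets borel"
  shows "emeasure (delta E) A =
    ennreal (1 / card E) * (\<Sum>e\<in>E. emeasure (return borel e) A)"
proof -
  have "emeasure (delta E) A = emeasure (uniform_count_measure E) (A \<inter> E)"
    unfolding delta_def using assms
    by (subst emeasure_distr)
      (auto simp: space_uniform_count_measure sets_uniform_count_measure measurable_def)
  also have "\<dots> = ennreal (card (A \<inter> E) / card E)"
    using assms by (subst emeasure_uniform_count_measure) auto
  also have "\<dots> = ennreal (1 / card E) * of_nat (card (A \<inter> E))"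
    by (simp add: ennreal_of_nat_eq_real_of_nat ennreal_mult[symmetric])
  also have "of_nat (card (A \<inter> E)) = (\<Sum>e\<in>E. emeasure (return borel e) A)"
    using assms by (simp add: indicator_def sum.If_cases Int_commute)
  finally show ?thesis .
qed

text \<open>\<open>inv_prod M n = M\<^sub>1\<inverse> M\<^sub>2\<inverse> \<cdots> M\<^sub>n\<inverse>\<close>; sequences are indexed from \<open>1\<close> and the value at
  \<open>0\<close> is never used.\<close>

primrec inv_prod :: "(nat \<Rightarrow> real^2^2) \<Rightarrow> nat \<Rightarrow> real^2^2" where
  "inv_prod M 0 = mat 1"
| "inv_prod M (Suc n) = inv_prod M n ** matrix_inv (M (Suc n))"

text \<open>The recursion starts from the point mass at the origin, the neutral element of
  convolution.\<close>

primrec finite_moran :: "(nat \<Rightarrow> real^2^2) \<Rightarrow> (nat \<Rightarrow> (real^2) set) \<Rightarrow> nat \<Rightarrow> (real^2) measure"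
  where
  "finite_moran M D 0 = return borel 0"
| "finite_moran M D (Suc n) =
     (finite_moran M D n \<star> delta ((*v) (inv_prod M (Suc n)) ` D (Suc n)))"

text \<open>The library has weak convergence (\<open>weak_conv_m\<close>) only for measures on the real line.\<close>

definition weakly_converges ::
  "(nat \<Rightarrow> 'a::topological_space measure) \<Rightarrow> 'a measure \<Rightarrow> bool" where
  "weakly_converges \<nu> \<mu> \<longleftrightarrow>
     (\<forall>f::'a \<Rightarrow> real. continuous_on UNIV f \<longrightarrow> bounded (range f) \<longrightarrow>
        (\<lambda>n. integral\<^sup>L (\<nu> n) f) \<longlonglongrightarrow> integral\<^sup>L \<mu> f)"

text \<open>Weak limits among Borel probability measures are unique; \<open>moran_measure M D\<close> is unspecified
  if the limit does not exist.\<close>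

definition moran_measure :: "(nat \<Rightarrow> real^2^2) \<Rightarrow> (nat \<Rightarrow> (real^2) set) \<Rightarrow> (real^2) measure"
  where
  "moran_measure M D =
     (THE \<mu>. sets \<mu> = sets borel \<and> prob_space \<mu> \<and> weakly_converges (finite_moran M D) \<mu>)"

definition square_integrable :: "'a measure \<Rightarrow> ('a \<Rightarrow> complex) \<Rightarrow> bool" where
  "square_integrable \<mu> f \<longleftrightarrow>
     f \<in> borel_measurable \<mu> \<and> integrable \<mu> (\<lambda>x. (cmod (f x))\<^sup>2)"

text \<open>An orthonormal basis of \<open>L\<^sup>2(\<mu>)\<close>, as an indexed family of representatives: an orthonormal
  family whose finite linear combinations are dense.\<close>

definition L2_orthonormal_basis :: "'a measure \<Rightarrow> 'i set \<Rightarrow> ('i \<Rightarrow> 'a \<Rightarrow> complex) \<Rightarrow> bool" where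
  "L2_orthonormal_basis \<mu> I e \<longleftrightarrow>
     (\<forall>i\<in>I. square_integrable \<mu> (e i)) \<and>
     (\<forall>i\<in>I. \<forall>j\<in>I. (\<integral>x. e i x * cnj (e j x) \<partial>\<mu>) = (if i = j then 1 else 0)) \<and>
     (\<forall>f. square_integrable \<mu> f \<longrightarrow> (\<forall>\<epsilon>>0. \<exists>F c. finite F \<and> F \<subseteq> I \<and>
        sqrt (\<integral>x. (cmod (f x - (\<Sum>i\<in>F. c i * e i x)))\<^sup>2 \<partial>\<mu>) < \<epsilon>))"

definition spectrum_of :: "(real^2) measure \<Rightarrow> (real^2) set \<Rightarrow> bool" where
  "spectrum_of \<mu> \<Lambda> \<longleftrightarrow> countable \<Lambda> \<and> topological_space_class.discrete \<Lambda> \<and>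
     L2_orthonormal_basis \<mu> \<Lambda> (\<lambda>l x. exp (2 * of_real pi * \<i> * of_real (l \<bullet> x)))"

definition spectral_measure :: "(real^2) measure \<Rightarrow> bool" where
  "spectral_measure \<mu> \<longleftrightarrow> sets \<mu> = sets borel \<and> (\<exists>\<Lambda>. spectrum_of \<mu> \<Lambda>)"

end

theory Submission
  imports Defs
begin

text \<open>
  Write \<open>e(t) = exp (2 \<pi> i t)\<close>.  The digit set \<open>D\<^sub>n\<close> is a full set of residues modulo \<open>2\<close>, because the
  matrix \<open>C\<^sub>n\<close> whose rows are its two generators has odd determinant.  Its mask \<open>m\<^sub>n\<close>, the Fourier transform of the uniform
  measure on \<open>D\<^sub>n\<close>, therefore vanishes exactly on \<open>(1/2) C\<^sub>n\<^sup>-\<^sup>1 (\<int>\<^sup>2 - 2 \<int>\<^sup>2)\<close>, and the four numbers \<open>\<bar>m\<^sub>n(y + h)\<bar>\<^sup>2\<close>, with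
  \<open>h\<close> in \<open>{0, 1/2}\<^sup>2\<close>, add up to \<open>1\<close>.  The Fourier transform of the Moran measure is the convergent product of the
  factors \<open>m\<^sub>n(\<xi> M\<^sub>1\<^sup>-\<^sup>1 \<dots> M\<^sub>n\<^sup>-\<^sup>1)\<close>, with \<open>\<xi>\<close> a row vector, and it is zero only where a factor is zero.  Everything
  after that uses only this function: a countable discrete set \<open>\<Lambda>\<close> is a spectrum iff differences of distinct points
  are zeros of the transform and the squared moduli of the transform over every translate \<open>\<xi> + \<Lambda>\<close> add up to
  \<open>1\<close> (\<open>spectrum_of_iff_parseval\<close>).

  \<^bold>\<open>Necessity.\<close>  Let \<open>c\<close> be an odd common multiple of the determinants \<open>det C\<^sub>n\<close>.  A spectrum \<open>\<Lambda>\<close> containing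
  \<open>0\<close> satisfies \<open>Y = \<Lambda> M\<^sub>1\<^sup>-\<^sup>1 \<subseteq> (1/2c) \<int>\<^sup>2\<close>.  Split \<open>Y\<close> into cosets of \<open>(1/2) C\<^sub>1\<^sup>-\<^sup>1 \<int>\<^sup>2\<close>, and each coset into its four
  classes modulo \<open>C\<^sub>1\<^sup>-\<^sup>1 \<int>\<^sup>2\<close>.  However one class is chosen from each coset, the union of the choices is orthogonal for
  the tail measure, so it has Parseval sum at most \<open>1\<close>; but \<open>1\<close> is a convex combination of such sums with positive
  weights, for all \<open>\<xi>\<close> outside a countable set.  Hence every choice satisfies Parseval's identity for the tail at
  these \<open>\<xi>\<close> (\<open>parseval_ae_step\<close>).  In particular \<open>Y\<close> has points in
  every parity class of \<open>(1/2c) \<int>\<^sup>2\<close>, while the points of even class form the set \<open>\<Lambda>' \<subseteq> (1/c) \<int>\<^sup>2\<close> with which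
  the argument is repeated.  At the next step the points \<open>y\<close> in all parity classes have \<open>y M\<^sub>2 \<in> (1/c) \<int>\<^sup>2\<close>, which forces
  \<open>M\<^sub>2\<close> to be even, and so on.

  \<^bold>\<open>Sufficiency.\<close>  If \<open>M\<^sub>n = 2 N\<^sub>n\<close> for \<open>n \<ge> 2\<close>, every set of sums \<open>\<Sum>\<^sub>n \<kappa>\<^sub>n M\<^sub>n \<dots> M\<^sub>1\<close>, with one
  \<open>\<kappa>\<^sub>n \<in> h + \<int>\<^sup>2\<close> for each \<open>h\<close> in \<open>{0, 1/2}\<^sup>2\<close>, possibly depending on
  \<open>\<kappa>\<^sub>1, \<dots>, \<kappa>\<^sub>n\<^sub>-\<^sub>1\<close>, is orthogonal, and at each finite stage it is complete for the partial product.  Completeness in the limit follows if the integer translates can be chosen so that the transforms of the tails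
  stay away from zero at all points that occur.  This is \<open>equi_positivity\<close>: the transform of a tail is bounded below, by a
  constant independent of the tail, at some point of each coset \<open>x + \<int>\<^sup>2\<close>.

  For its proof, average the squared modulus of the product of the first \<open>J\<close> masks, multiplied by a periodic bump around
  \<open>\<int>\<^sup>2\<close>, over all points \<open>x + k\<close>.  In terms of Fourier coefficients one factor acts as a random walk on
  frequencies \<open>q \<in> \<int>\<^sup>2\<close>: a digit \<open>d\<close> is drawn uniformly, \<open>d'\<close> is the digit with \<open>q + d - d'\<close> even, and \<open>q\<close> moves
  to \<open>M\<^sup>-\<^sup>1 (q + d - d')\<close> if this is an integer vector and is killed otherwise.  The walk contracts, hence stays in a finite set.
  An even nonzero \<open>q\<close> can only move to the shorter vector \<open>M\<^sup>-\<^sup>1 q\<close>.  If an odd \<open>q\<close> could not be killed in \<open>i\<close> steps, the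
  generators of its digit set would lie in \<open>N N' \<dots> N\<^sup>(\<^sup>i\<^sup>) \<int>\<^sup>2\<close>, whose index is at least \<open>2\<^sup>i\<close> because
  \<open>\<bar>det N\<bar> = \<bar>det M\<bar> / 4 > 1\<close>; this is impossible for large \<open>i\<close> because there are finitely many digit sets
  (\<open>odd_not_survives_surely\<close>).  So the probability of being alive away from \<open>0\<close> decays uniformly
  (\<open>survival_decay\<close>), and the average, suitably normalised, is at least the constant Fourier coefficient of the bump minus a small error.
\<close>

section \<open>Characters and masks\<close>

definition ee :: "real \<Rightarrow> complex" where
  "ee t = exp (2 * of_real pi * \<i> * of_real t)"

lemma ee_cis: "ee t = cis (2 * pi * t)"
  by (simp add: ee_def cis_conv_exp mult_ac)

lemma ee_0 [simp]: "ee 0 = 1"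
  by (simp add: ee_cis)

lemma ee_add: "ee (s + t) = ee s * ee t"
  by (simp add: ee_cis cis_mult algebra_simps)

lemma ee_minus: "ee (- t) = cnj (ee t)"
  by (simp add: ee_cis cis_cnj)

lemma ee_diff: "ee (s - t) = ee s * cnj (ee t)"
  using ee_add[of s "- t"] by (simp add: ee_minus)

lemma norm_ee [simp]: "cmod (ee t) = 1"
  by (simp add: ee_cis)

lemma ee_Ints: "t \<in> \<int> \<Longrightarrow> ee t = 1"
  by (auto simp: ee_cis elim!: Ints_cases intro: cis_multiple_2pi)

lemma ee_eq_1_iff: "ee t = 1 \<longleftrightarrow> t \<in> \<int>"
proof
  assume "ee t = 1"
  then have "cos (2 * pi * t) = 1"
    by (auto simp: ee_cis cis.ctr complex_eq_iff)
  then obtain x :: int where "2 * pi * t = of_int x * 2 * pi"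
    by (auto simp: cos_one_2pi_int)
  then have "t = of_int x" by simp
  then show "t \<in> \<int>" by simp
qed (rule ee_Ints)

lemma continuous_on_ee [continuous_intros]:
  "continuous_on A f \<Longrightarrow> continuous_on A (\<lambda>x. ee (f x))"
  unfolding ee_def by (intro continuous_intros)

lemma norm_ee_diff: "cmod (ee s - ee t) \<le> 2 * pi * \<bar>s - t\<bar>"
proof -
  have "cmod (ee s - ee t) = cmod (ee t * (ee (s - t) - 1))"
    by (simp add: ee_diff algebra_simps) (simp add: ee_cis cis_cnj cis_mult)
  also have "\<dots> = cmod (ee (s - t) - 1)" by (simp add: norm_mult)
  also have "\<dots> \<le> \<bar>2 * pi * (s - t)\<bar>"
    using iexp_approx1[of "2 * pi * (s-t)" 0] by (simp add: ee_def mult_ac)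
  finally show ?thesis by (simp add: abs_mult)
qed

lemma matrix_inv_mult:
  fixes A :: "real^2^2"
  assumes "invertible A"
  shows "A ** matrix_inv A = mat 1" "matrix_inv A ** A = mat 1"
proof -
  have "A ** matrix_inv A = mat 1 \<and> matrix_inv A ** A = mat 1"
    using assms unfolding invertible_def matrix_inv_def by (rule someI_ex)
  then show "A ** matrix_inv A = mat 1" "matrix_inv A ** A = mat 1" by auto
qed

lemma measurable_matrix_vector_mult [measurable (raw)]:
  fixes A :: "real^2^2"
  assumes "f \<in> borel_measurable N"
  shows "(\<lambda>x. A *v f x) \<in> borel_measurable N"
proof -
  have "(*v) A \<in> borel_measurable borel"
    by (intro borel_measurable_continuous_onI matrix_vector_mult_linear_continuous_on)
  with assms show ?thesis by measurable
qed

definition fourier :: "(real^2) measure \<Rightarrow> real^2 \<Rightarrow> complex" where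
  "fourier \<mu> \<xi> = (\<integral>x. ee (\<xi> \<bullet> x) \<partial>\<mu>)"

definition mask :: "(real^2) set \<Rightarrow> real^2 \<Rightarrow> complex" where
  "mask E \<xi> = (\<Sum>d\<in>E. ee (\<xi> \<bullet> d)) / of_nat (card E)"

lemma norm_mask_le: "cmod (mask E \<xi>) \<le> 1"
proof (cases "card E = 0")
  case False
  have "cmod (\<Sum>d\<in>E. ee (\<xi> \<bullet> d)) \<le> (\<Sum>d\<in>E. 1)"
    by (rule order_trans[OF norm_sum]) simp
  then show ?thesis using False by (simp add: mask_def norm_divide field_simps)
qed (simp add: mask_def)

lemma mask_0: "finite E \<Longrightarrow> E \<noteq> {} \<Longrightarrow> mask E 0 = 1"
  by (simp add: mask_def)

lemma mask_Lipschitz: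
  assumes "finite E" "E \<noteq> {}" "\<And>d. d \<in> E \<Longrightarrow> norm d \<le> R"
  shows "cmod (mask E \<xi> - mask E \<eta>) \<le> 2 * pi * R * norm (\<xi> - \<eta>)"
proof -
  have c: "card E > 0" using assms by (simp add: card_gt_0_iff)
  have "cmod ((\<Sum>d\<in>E. ee (\<xi> \<bullet> d)) - (\<Sum>d\<in>E. ee (\<eta> \<bullet> d)))
      \<le> (\<Sum>d\<in>E. 2 * pi * R * norm (\<xi> - \<eta>))"
    unfolding sum_subtractf[symmetric]
  proof (rule sum_norm_le)
    fix d assume d: "d \<in> E"
    have "cmod (ee (\<xi> \<bullet> d) - ee (\<eta> \<bullet> d)) \<le> 2 * pi * \<bar>(\<xi> - \<eta>) \<bullet> d\<bar>"
      using norm_ee_diff by (simp add: inner_diff_left)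
    also have "\<bar>(\<xi> - \<eta>) \<bullet> d\<bar> \<le> norm (\<xi> - \<eta>) * norm d"
      by (rule Cauchy_Schwarz_ineq2)
    also have "\<dots> \<le> norm (\<xi> - \<eta>) * R"
      using assms(3)[OF d] by (intro mult_left_mono) auto
    finally show "cmod (ee (\<xi> \<bullet> d) - ee (\<eta> \<bullet> d)) \<le> 2 * pi * R * norm (\<xi> - \<eta>)"
      by (simp add: mult_ac)
  qed
  then have "cmod ((\<Sum>d\<in>E. ee (\<xi> \<bullet> d)) - (\<Sum>d\<in>E. ee (\<eta> \<bullet> d)))
      \<le> card E * (2 * pi * R * norm (\<xi> - \<eta>))" by simp
  then show ?thesis using c
    by (simp add: mask_def diff_divide_distrib[symmetric] norm_divide field_simps)
qed

lemma norm_vector_matrix_le: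
  fixes A :: "real^2^2"
  assumes "\<And>v. norm (A *v v) \<le> r * norm v"
  shows "norm (\<xi> v* A) \<le> r * norm \<xi>"
proof (cases "\<xi> v* A = 0")
  case True
  have "0 \<le> r * norm \<xi>" using assms[of \<xi>] norm_ge_zero order_trans by blast
  then show ?thesis using True by simp
next
  case False
  have "(norm (\<xi> v* A))\<^sup>2 = \<xi> \<bullet> (A *v (\<xi> v* A))"
    by (simp add: power2_norm_eq_inner dot_lmul_matrix)
  also have "\<dots> \<le> norm \<xi> * norm (A *v (\<xi> v* A))" by (rule norm_cauchy_schwarz)
  also have "\<dots> \<le> norm \<xi> * (r * norm (\<xi> v* A))"
    by (intro mult_left_mono assms) auto
  finally have "norm (\<xi> v* A) * norm (\<xi> v* A) \<le> r * norm \<xi> * norm (\<xi> v* A)"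
    by (simp add: power2_eq_square mult_ac)
  then show ?thesis using False by (meson mult_le_cancel_right_pos zero_less_norm_iff)
qed

section \<open>The Moran measure as the law of a random series\<close>

text \<open>Continuous functions decreasing to the indicator of a closed set \<open>C\<close>: they carry statements about
  bounded continuous functions over to closed sets.\<close>

definition plateau :: "(real^2) set \<Rightarrow> nat \<Rightarrow> real^2 \<Rightarrow> real" where
  "plateau C n x = max 0 (1 - real n * infdist x C)"

lemma continuous_on_plateau: "continuous_on UNIV (plateau C n)"
  unfolding plateau_def by (intro continuous_intros)

lemma plateau_bounds: "0 \<le> plateau C n x" "plateau C n x \<le> 1"
  by (auto simp: plateau_def infdist_nonneg)

lemma plateau_tendsto_indicator:
  assumes C: "closed C" "C \<noteq> {}"
  shows "(\<lambda>n. plateau C n x) \<longlonglongrightarrow> indicator C x"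
proof (cases "x \<in> C")
  case True
  then show ?thesis by (simp add: plateau_def)
next
  case False
  then have d: "infdist x C > 0"
    using C infdist_pos_not_in_closed by blast
  obtain N :: nat where N: "real N * infdist x C > 1"
    using reals_Archimedean3[OF d] by blast
  have "plateau C n x = 0" if "n \<ge> N" for n
  proof -
    have "real n * infdist x C \<ge> real N * infdist x C"
      using that d by (intro mult_right_mono) auto
    then show ?thesis using N by (simp add: plateau_def)
  qed
  then have "\<forall>\<^sub>F n in sequentially. plateau C n x = 0"
    by (auto simp: eventually_sequentially)
  then show ?thesis using False by (simp add: tendsto_eventually)
qed

text \<open>Plateaus determine the measure of closed sets, and these form an intersection-stable generator.
  This makes weak limits unique, hence the definite description in \<open>moran_measure\<close> meaningful.\<close>

lemma borel_prob_eqI_bounded_continuous: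
  fixes \<mu> \<nu> :: "(real^2) measure"
  assumes \<mu>: "sets \<mu> = sets borel" "prob_space \<mu>"
    and \<nu>: "sets \<nu> = sets borel" "prob_space \<nu>"
    and eq: "\<And>f :: real^2 \<Rightarrow> real. continuous_on UNIV f \<Longrightarrow> bounded (range f)
      \<Longrightarrow> integral\<^sup>L \<mu> f = integral\<^sup>L \<nu> f"
  shows "\<mu> = \<nu>"
proof -
  interpret \<mu>: prob_space \<mu> by fact
  interpret \<nu>: prob_space \<nu> by fact
  note [measurable_cong] = \<mu>(1) \<nu>(1)
  have cl: "measure \<mu> C = measure \<nu> C" if C: "closed C" "C \<noteq> {}" for C :: "(real^2) set"
  proof -
    have [measurable]: "plateau C n \<in> borel_measurable borel" for n
      by (rule borel_measurable_continuous_onI[OF continuous_on_plateau])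
    have bd: "bounded (range (plateau C n))" for n
      by (rule boundedI[of _ 1]) (auto simp: abs_of_nonneg plateau_bounds)
    have C': "C \<in> sets borel" using C by auto
    have "(\<lambda>n. integral\<^sup>L \<mu> (plateau C n)) \<longlonglongrightarrow> integral\<^sup>L \<mu> (indicator C)"
      using C' plateau_tendsto_indicator[OF C]
      by (intro integral_dominated_convergence[where w="\<lambda>_. 1"])
        (auto simp: abs_of_nonneg plateau_bounds)
    moreover have "(\<lambda>n. integral\<^sup>L \<nu> (plateau C n)) \<longlonglongrightarrow> integral\<^sup>L \<nu> (indicator C)"
      using C' plateau_tendsto_indicator[OF C]
      by (intro integral_dominated_convergence[where w="\<lambda>_. 1"])
        (auto simp: abs_of_nonneg plateau_bounds)
    ultimately have "integral\<^sup>L \<mu> (indicator C) = integral\<^sup>L \<nu> (indicator C :: _ \<Rightarrow> real)"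
      unfolding eq[OF continuous_on_plateau bd] by (rule LIMSEQ_unique)
    then show ?thesis using C' \<mu>(1) \<nu>(1) by simp
  qed
  show ?thesis
  proof (rule measure_eqI_generator_eq[where E="{C. closed C}" and A="\<lambda>_. UNIV" and \<Omega>=UNIV])
    show "sets \<mu> = sigma_sets UNIV {C. closed C}" "sets \<nu> = sigma_sets UNIV {C. closed C}"
      using \<mu>(1) \<nu>(1) by (simp_all add: borel_eq_closed)
    show "Int_stable {C :: (real^2) set. closed C}"
      by (auto simp: Int_stable_def)
    fix X :: "(real^2) set" assume "X \<in> {C. closed C}"
    then show "emeasure \<mu> X = emeasure \<nu> X"
      using cl[of X] by (cases "X = {}") (auto simp: \<mu>.emeasure_eq_measure \<nu>.emeasure_eq_measure)
  qed auto
qed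

text \<open>The uniform contraction and the bound on the digits are what the existence of the measure and the
  regularity of its Fourier transform rest on; arithmetic enters later.\<close>

locale moran =
  fixes M :: "nat \<Rightarrow> real^2^2" and D :: "nat \<Rightarrow> (real^2) set" and r R :: real
  assumes r_nonneg: "0 \<le> r" and r_less_1: "r < 1"
    and contraction: "\<And>n v. n \<ge> 1 \<Longrightarrow> norm (matrix_inv (M n) *v v) \<le> r * norm v"
    and inv_M: "\<And>n. n \<ge> 1 \<Longrightarrow> invertible (M n)"
    and finite_D: "\<And>n. n \<ge> 1 \<Longrightarrow> finite (D n)"
    and D_nonempty: "\<And>n. n \<ge> 1 \<Longrightarrow> D n \<noteq> {}"
    and norm_D: "\<And>n d. n \<ge> 1 \<Longrightarrow> d \<in> D n \<Longrightarrow> norm d \<le> R"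
begin

lemma R_nonneg: "0 \<le> R"
  using norm_D[of 1] D_nonempty[of 1] norm_ge_zero order_trans by (metis ex_in_conv order_refl)

lemma inv_prod_contraction: "norm (inv_prod M n *v v) \<le> r ^ n * norm v"
proof (induction n arbitrary: v)
  case (Suc n)
  have "norm (inv_prod M (Suc n) *v v) = norm (inv_prod M n *v (matrix_inv (M (Suc n)) *v v))"
    by (simp add: matrix_vector_mul_assoc)
  also have "\<dots> \<le> r ^ n * norm (matrix_inv (M (Suc n)) *v v)" by (rule Suc)
  also have "\<dots> \<le> r ^ n * (r * norm v)"
    using r_nonneg by (intro mult_left_mono contraction) auto
  finally show ?case by (simp add: mult_ac)
qed simp

lemma inv_prod_contraction': "norm (\<xi> v* inv_prod M n) \<le> r ^ n * norm \<xi>"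
  by (rule norm_vector_matrix_le) (rule inv_prod_contraction)

lemma invertible_inv_prod: "invertible (inv_prod M n)"
proof (induction n)
  case 0
  show ?case by (simp add: invertible_def)
next
  case (Suc n)
  have "invertible (matrix_inv (M (Suc n)))"
    using inv_M[of "Suc n"] matrix_inv_mult[of "M (Suc n)"] unfolding invertible_def by auto
  with Suc show ?case by (simp add: invertible_mult)
qed

text \<open>Independent uniform digits \<open>\<omega>\<^sub>0, \<omega>\<^sub>1, \<dots>\<close>; the digit with index \<open>j\<close> belongs to \<open>D\<^sub>j\<^sub>+\<^sub>1\<close>.\<close>

definition coin :: "(nat \<Rightarrow> real^2) measure" where
  "coin = PiM UNIV (\<lambda>n. measure_pmf (pmf_of_set (D (Suc n))))"

definition partial :: "nat \<Rightarrow> (nat \<Rightarrow> real^2) \<Rightarrow> real^2" where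
  "partial n \<omega> = (\<Sum>j<n. inv_prod M (Suc j) *v \<omega> j)"

text \<open>Digits outside \<open>D (Suc j)\<close> occur on a null set only; there they are replaced by \<open>0\<close>.\<close>

definition total :: "(nat \<Rightarrow> real^2) \<Rightarrow> real^2" where
  "total \<omega> = (\<Sum>j. inv_prod M (Suc j) *v (if \<omega> j \<in> D (Suc j) then \<omega> j else 0))"

lemma prob_coin: "prob_space coin"
  unfolding coin_def by (intro prob_space_PiM prob_space_measure_pmf)

lemma sets_coin [measurable_cong]: "sets coin = sets (PiM UNIV (\<lambda>n. count_space UNIV))"
  unfolding coin_def by (intro sets_PiM_cong) auto

lemma AE_coin: "AE \<omega> in coin. \<forall>j. \<omega> j \<in> D (Suc j)"
proof (subst AE_all_countable, intro allI)
  fix j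
  interpret P: product_prob_space "\<lambda>n. measure_pmf (pmf_of_set (D (Suc n)))" UNIV
    by standard
  show "AE \<omega> in coin. \<omega> j \<in> D (Suc j)"
    unfolding coin_def
    by (rule P.AE_component) (auto simp: AE_measure_pmf_iff finite_D D_nonempty)
qed

lemma coin_component_measurable [measurable]: "(\<lambda>\<omega>. \<omega> j) \<in> coin \<rightarrow>\<^sub>M borel"
proof -
  have "(\<lambda>\<omega>. \<omega> j) \<in> coin \<rightarrow>\<^sub>M count_space UNIV" by measurable
  then show ?thesis by (rule measurable_compose) simp
qed

lemma partial_measurable [measurable]: "partial n \<in> borel_measurable coin"
  unfolding partial_def by measurable

lemma distr_coin_component:
  "distr coin borel (\<lambda>\<omega>. inv_prod M (Suc n) *v \<omega> n) = delta ((*v) (inv_prod M (Suc n)) ` D (Suc n))"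
proof (rule measure_eqI)
  let ?T = "inv_prod M (Suc n)"
  fix A assume "A \<in> sets (distr coin borel (\<lambda>\<omega>. ?T *v \<omega> n))"
  then have A: "A \<in> sets borel" by simp
  have inj: "inj ((*v) ?T)"
    using invertible_inv_prod[of "Suc n"] by (simp add: inj_matrix_vector_mult)
  interpret P: product_prob_space "\<lambda>n. measure_pmf (pmf_of_set (D (Suc n)))" UNIV
    by standard
  have "emeasure (distr coin borel (\<lambda>\<omega>. ?T *v \<omega> n)) A
      = emeasure coin ((\<lambda>\<omega>. ?T *v \<omega> n) -` A \<inter> space coin)"
    using A by (subst emeasure_distr) auto
  also have "\<dots> = emeasure coin ((\<lambda>\<omega>. \<omega> n) -` ((*v) ?T -` A) \<inter> space coin)"
    by (simp add: vimage_def)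
  also have "\<dots> = emeasure (distr coin (measure_pmf (pmf_of_set (D (Suc n)))) (\<lambda>\<omega>. \<omega> n)) ((*v) ?T -` A)"
    unfolding coin_def by (subst emeasure_distr) auto
  also have "\<dots> = emeasure (measure_pmf (pmf_of_set (D (Suc n)))) ((*v) ?T -` A)"
    unfolding coin_def by (subst P.PiM_component[symmetric]) auto
  also have "\<dots> = ennreal (card (D (Suc n) \<inter> (*v) ?T -` A) / card (D (Suc n)))"
    using finite_D[of "Suc n"] D_nonempty[of "Suc n"] by (subst emeasure_pmf_of_set) auto
  also have "card (D (Suc n) \<inter> (*v) ?T -` A) = card ((*v) ?T ` (D (Suc n) \<inter> (*v) ?T -` A))"
    using inj by (intro card_image[symmetric] inj_on_subset[OF inj]) auto
  also have "(*v) ?T ` (D (Suc n) \<inter> (*v) ?T -` A) = A \<inter> (*v) ?T ` D (Suc n)" by auto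
  also have "card (D (Suc n)) = card ((*v) ?T ` D (Suc n))"
    using inj by (intro card_image[symmetric] inj_on_subset[OF inj]) auto
  also have "ennreal (card (A \<inter> (*v) ?T ` D (Suc n)) / card ((*v) ?T ` D (Suc n)))
      = emeasure (delta ((*v) ?T ` D (Suc n))) A"
    unfolding delta_def using A finite_D[of "Suc n"] D_nonempty[of "Suc n"]
    by (subst emeasure_distr)
      (auto simp: space_uniform_count_measure sets_uniform_count_measure measurable_def
         emeasure_uniform_count_measure)
  finally show "emeasure (distr coin borel (\<lambda>\<omega>. ?T *v \<omega> n)) A =
     emeasure (delta ((*v) ?T ` D (Suc n))) A" .
qed (simp add: delta_def)

text \<open>Convolution is the law of a sum of independent variables, so the finite convolutions are the laws of
  the partial sums of one random series on a single probability space.\<close>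

lemma distr_partial: "distr coin borel (partial n) = finite_moran M D n"
proof (induction n)
  case 0
  interpret prob_space coin by (rule prob_coin)
  show ?case
  proof (rule measure_eqI)
    fix A assume "A \<in> sets (distr coin borel (partial 0))"
    then have A: "A \<in> sets borel" by simp
    have "partial 0 -` A \<inter> space coin = (if 0 \<in> A then space coin else {})"
      by (auto simp: partial_def)
    then show "emeasure (distr coin borel (partial 0)) A = emeasure (finite_moran M D 0) A"
      using A by (simp add: emeasure_distr emeasure_space_1 indicator_def)
  qed simp
next
  case (Suc n)
  let ?T = "inv_prod M (Suc n)"
  interpret prob_space coin by (rule prob_coin)
  have ind0: "indep_vars (\<lambda>j. measure_pmf (pmf_of_set (D (Suc j)))) (\<lambda>j \<omega>. \<omega> j) (UNIV :: nat set)"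
  proof (subst indep_vars_iff_distr_eq_PiM)
    interpret P: product_prob_space "\<lambda>n. measure_pmf (pmf_of_set (D (Suc n)))" UNIV
      by standard
    have "distr coin (PiM UNIV (\<lambda>j. measure_pmf (pmf_of_set (D (Suc j))))) (\<lambda>x. \<lambda>i\<in>UNIV. x i) = coin"
      unfolding coin_def by (simp add: restrict_UNIV distr_id)
    also have "\<dots> = PiM UNIV (\<lambda>i. distr coin (measure_pmf (pmf_of_set (D (Suc i)))) (\<lambda>\<omega>. \<omega> i))"
      unfolding coin_def by (intro PiM_cong P.PiM_component[symmetric]) auto
    finally show "distr coin (PiM UNIV (\<lambda>j. measure_pmf (pmf_of_set (D (Suc j))))) (\<lambda>x. \<lambda>i\<in>UNIV. x i)
      = PiM UNIV (\<lambda>i. distr coin (measure_pmf (pmf_of_set (D (Suc i)))) (\<lambda>\<omega>. \<omega> i))" .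
    show "random_variable (measure_pmf (pmf_of_set (D (Suc i)))) (\<lambda>\<omega>. \<omega> i)" for i
      unfolding coin_def by measurable
  qed auto
  have ind: "indep_vars (\<lambda>_. borel) (\<lambda>j \<omega>. \<omega> j) (UNIV :: nat set)"
    by (rule indep_vars_compose2[OF ind0, where Y="\<lambda>_ x. x"]) auto
  have "indep_var borel (partial n) borel (\<lambda>\<omega>. ?T *v \<omega> n)"
  proof -
    have "indep_var (PiM {..<n} (\<lambda>_. borel)) (\<lambda>\<omega>. restrict \<omega> {..<n})
        (PiM {n} (\<lambda>_. borel)) (\<lambda>\<omega>. restrict \<omega> {n})"
      using indep_var_restrict[OF ind, of "{..<n}" "{n}"] by simp
    then have "indep_var borel ((\<lambda>x. \<Sum>j<n. inv_prod M (Suc j) *v x j) \<circ> (\<lambda>\<omega>. restrict \<omega> {..<n}))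
        borel ((\<lambda>x. ?T *v x n) \<circ> (\<lambda>\<omega>. restrict \<omega> {n}))"
      by (rule indep_var_compose) measurable
    moreover have "(\<lambda>x. \<Sum>j<n. inv_prod M (Suc j) *v x j) \<circ> (\<lambda>\<omega>. restrict \<omega> {..<n}) = partial n"
      by (auto simp: partial_def fun_eq_iff)
    moreover have "(\<lambda>x. ?T *v x n) \<circ> (\<lambda>\<omega>. restrict \<omega> {n}) = (\<lambda>\<omega>. ?T *v \<omega> n)"
      by auto
    ultimately show ?thesis by simp
  qed
  then have *: "distr coin borel (partial n) \<Otimes>\<^sub>M distr coin borel (\<lambda>\<omega>. ?T *v \<omega> n)
      = distr coin (borel \<Otimes>\<^sub>M borel) (\<lambda>\<omega>. (partial n \<omega>, ?T *v \<omega> n))"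
    by (simp add: indep_var_distribution_eq)
  have "finite_moran M D (Suc n)
      = (distr coin borel (partial n) \<star> distr coin borel (\<lambda>\<omega>. ?T *v \<omega> n))"
    by (simp only: finite_moran.simps Suc[symmetric] distr_coin_component)
  also have "\<dots> = distr coin borel (\<lambda>\<omega>. partial n \<omega> + ?T *v \<omega> n)"
    unfolding convolution_def * by (subst distr_distr) (auto simp: comp_def)
  also have "(\<lambda>\<omega>. partial n \<omega> + ?T *v \<omega> n) = partial (Suc n)"
    by (simp add: partial_def fun_eq_iff)
  finally show ?case by simp
qed

lemma summand_bound:
  assumes "\<omega> j \<in> D (Suc j)"
  shows "norm (inv_prod M (Suc j) *v \<omega> j) \<le> R * r ^ j"
proof -
  have "norm (inv_prod M (Suc j) *v \<omega> j) \<le> r ^ Suc j * norm (\<omega> j)"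
    by (rule inv_prod_contraction)
  also have "\<dots> \<le> r ^ Suc j * R"
    using r_nonneg assms by (intro mult_left_mono norm_D[of "Suc j"]) auto
  also have "\<dots> \<le> R * r ^ j"
    using r_nonneg r_less_1 R_nonneg by (auto simp: mult_ac intro!: mult_left_mono mult_left_le_one_le)
  finally show ?thesis .
qed

lemma total_summable:
  assumes "\<forall>j. \<omega> j \<in> D (Suc j)"
  shows "partial n \<omega> \<in> cball 0 (R / (1 - r))" "(\<lambda>n. partial n \<omega>) \<longlonglongrightarrow> total \<omega>"
    "total \<omega> \<in> cball 0 (R / (1 - r))"
proof -
  have geo: "(\<lambda>j. R * r ^ j) sums (R * (1 / (1 - r)))"
    using r_nonneg r_less_1 by (intro sums_mult geometric_sums) auto
  have sm: "summable (\<lambda>j. norm (inv_prod M (Suc j) *v \<omega> j))"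
    using summand_bound assms sums_summable[OF geo]
    by (intro summable_comparison_test[of "\<lambda>j. norm (inv_prod M (Suc j) *v \<omega> j)" "\<lambda>j. R * r ^ j"]) auto
  show pb: "partial n \<omega> \<in> cball 0 (R / (1 - r))" for n
  proof -
    have "norm (partial n \<omega>) \<le> (\<Sum>j<n. R * r ^ j)"
      unfolding partial_def using assms by (intro sum_norm_le summand_bound) auto
    also have "\<dots> \<le> R * (1 / (1 - r))"
      using geo R_nonneg r_nonneg by (metis sum_le_suminf sums_iff finite_lessThan mult_nonneg_nonneg zero_le_power)
    finally show ?thesis by simp
  qed
  have "total \<omega> = (\<Sum>j. inv_prod M (Suc j) *v \<omega> j)"
    unfolding total_def using assms by simp
  then show lim: "(\<lambda>n. partial n \<omega>) \<longlonglongrightarrow> total \<omega>"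
    unfolding partial_def using summable_LIMSEQ[OF summable_norm_cancel[OF sm]] by simp
  show "total \<omega> \<in> cball 0 (R / (1 - r))"
    by (rule closed_sequentially[OF closed_cball _ lim]) (use pb in auto)
qed

lemma total_measurable [measurable]: "total \<in> borel_measurable coin"
proof -
  have "(\<lambda>x. if x \<in> D (Suc j) then x else 0) \<in> count_space UNIV \<rightarrow>\<^sub>M borel" for j
    by simp
  then have [measurable]: "(\<lambda>\<omega>. if \<omega> j \<in> D (Suc j) then \<omega> j else 0) \<in> borel_measurable coin" for j
    by measurable
  show ?thesis
    unfolding total_def by measurable
qed

text \<open>The random series converges almost surely, so dominated convergence gives weak convergence of the laws.\<close>

lemma weakly_converges_total: "weakly_converges (finite_moran M D) (distr coin borel total)"
  unfolding weakly_converges_def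
proof (intro allI impI)
  fix f :: "real^2 \<Rightarrow> real"
  assume f: "continuous_on UNIV f" "bounded (range f)"
  interpret prob_space coin by (rule prob_coin)
  have [measurable]: "f \<in> borel_measurable borel"
    using f by (intro borel_measurable_continuous_onI)
  obtain B where B: "\<And>x. \<bar>f x\<bar> \<le> B" using f(2) by (auto simp: bounded_iff)
  have "(\<lambda>n. \<integral>\<omega>. f (partial n \<omega>) \<partial>coin) \<longlonglongrightarrow> (\<integral>\<omega>. f (total \<omega>) \<partial>coin)"
  proof (rule integral_dominated_convergence[where w="\<lambda>_. B"])
    show "AE \<omega> in coin. (\<lambda>n. f (partial n \<omega>)) \<longlonglongrightarrow> f (total \<omega>)"
      using AE_coin
    proof eventually_elim
      case (elim \<omega>)
      have "isCont f (total \<omega>)" using f(1) by (simp add: continuous_on_eq_continuous_at)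
      then show ?case by (rule isCont_tendsto_compose[OF _ total_summable(2)[OF elim]])
    qed
  qed (use B in auto)
  then show "(\<lambda>n. integral\<^sup>L (finite_moran M D n) f) \<longlonglongrightarrow> integral\<^sup>L (distr coin borel total) f"
    by (simp add: distr_partial[symmetric] integral_distr)
qed

abbreviation \<mu> where "\<mu> \<equiv> moran_measure M D"

lemma moran_measure_eq: "\<mu> = distr coin borel total"
  unfolding moran_measure_def
proof (rule the_equality)
  interpret prob_space coin by (rule prob_coin)
  show *: "sets (distr coin borel total) = sets borel \<and> prob_space (distr coin borel total) \<and>
    weakly_converges (finite_moran M D) (distr coin borel total)"
    by (auto intro!: prob_space_distr weakly_converges_total)
  fix \<nu> assume \<nu>: "sets \<nu> = sets borel \<and> prob_space \<nu> \<and> weakly_converges (finite_moran M D) \<nu>"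
  show "\<nu> = distr coin borel total"
  proof (rule borel_prob_eqI_bounded_continuous)
    fix f :: "real^2 \<Rightarrow> real" assume f: "continuous_on UNIV f" "bounded (range f)"
    show "integral\<^sup>L \<nu> f = integral\<^sup>L (distr coin borel total) f"
      using * \<nu> f unfolding weakly_converges_def by (blast intro: LIMSEQ_unique)
  qed (use * \<nu> in auto)
qed

lemma sets_\<mu> [measurable_cong, simp]: "sets \<mu> = sets borel"
  by (simp add: moran_measure_eq)

lemma space_\<mu> [simp]: "space \<mu> = UNIV"
  by (simp add: moran_measure_eq)

lemma prob_\<mu>: "prob_space \<mu>"
proof -
  interpret prob_space coin by (rule prob_coin)
  show ?thesis by (simp add: moran_measure_eq prob_space_distr)
qed

lemma AE_\<mu>: "AE x in \<mu>. x \<in> cball 0 (R / (1 - r))"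
  unfolding moran_measure_eq using AE_coin
  by (subst AE_distr_iff) (auto elim!: eventually_mono dest: total_summable(3) simp del: mem_cball)

end

section \<open>The Fourier transform of a Moran measure\<close>

lemma ee_inner_measurable [measurable]: "(\<lambda>x. ee (\<xi> \<bullet> x)) \<in> borel_measurable borel"
  by (intro borel_measurable_continuous_onI continuous_intros)

lemma fourier_0: "prob_space \<mu> \<Longrightarrow> fourier \<mu> 0 = 1"
  by (simp add: fourier_def prob_space.prob_space)

lemma fourier_minus: "fourier \<mu> (- \<xi>) = cnj (fourier \<mu> \<xi>)"
  by (simp add: fourier_def ee_minus)

lemma integrable_ee:
  assumes "prob_space \<mu>" "sets \<mu> = sets borel"
  shows "integrable \<mu> (\<lambda>x. ee (\<xi> \<bullet> x))"
proof -
  interpret prob_space \<mu> by fact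
  note [measurable_cong] = assms(2)
  have "(\<lambda>x. ee (\<xi> \<bullet> x)) \<in> borel_measurable \<mu>" by measurable
  then show ?thesis by (intro integrable_const_bound[where B=1]) auto
qed

lemma fourier_convolution:
  assumes \<mu>: "prob_space \<mu>" "sets \<mu> = sets borel" and \<nu>: "prob_space \<nu>" "sets \<nu> = sets borel"
  shows "fourier (\<mu> \<star> \<nu>) \<xi> = fourier \<mu> \<xi> * fourier \<nu> \<xi>"
proof -
  interpret \<mu>: prob_space \<mu> by fact
  interpret \<nu>: prob_space \<nu> by fact
  interpret P: pair_prob_space \<mu> \<nu> ..
  note [measurable_cong] = \<mu>(2) \<nu>(2)
  have "fourier (\<mu> \<star> \<nu>) \<xi> = (\<integral>z. ee (\<xi> \<bullet> (fst z + snd z)) \<partial>(\<mu> \<Otimes>\<^sub>M \<nu>))"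
    unfolding fourier_def convolution_def
    by (subst integral_distr) (auto simp: case_prod_beta)
  also have "\<dots> = (\<integral>z. ee (\<xi> \<bullet> fst z) * ee (\<xi> \<bullet> snd z) \<partial>(\<mu> \<Otimes>\<^sub>M \<nu>))"
    by (simp add: inner_add_right ee_add)
  also have "\<dots> = (\<integral>x. \<integral>y. ee (\<xi> \<bullet> x) * ee (\<xi> \<bullet> y) \<partial>\<nu> \<partial>\<mu>)"
    by (subst P.integral_fst'[symmetric])
      (auto intro!: P.integrable_const_bound[where B=1] simp: norm_mult)
  also have "\<dots> = fourier \<mu> \<xi> * fourier \<nu> \<xi>"
    by (simp add: fourier_def)
  finally show ?thesis .
qed

lemma fourier_delta:
  assumes "finite E" "E \<noteq> {}"
  shows "fourier (delta E) \<xi> = mask E \<xi>"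
proof -
  have "fourier (delta E) \<xi> = (\<integral>x. ee (\<xi> \<bullet> x) \<partial>uniform_count_measure E)"
    unfolding fourier_def delta_def
  proof (rule integral_distr)
    show "(\<lambda>x. x) \<in> uniform_count_measure E \<rightarrow>\<^sub>M borel"
      by (auto simp: measurable_def sets_uniform_count_measure space_uniform_count_measure)
  qed measurable
  also have "\<dots> = mask E \<xi>"
    unfolding uniform_count_measure_def using assms
    by (subst lebesgue_integral_point_measure_finite)
      (auto simp: mask_def scaleR_conv_of_real sum_divide_distrib divide_simps)
  finally show ?thesis .
qed

lemma mask_image:
  assumes "invertible T"
  shows "mask ((*v) T ` E) \<xi> = mask E (\<xi> v* T)"
proof -
  have inj: "inj_on ((*v) T) E"
    using assms by (meson inj_matrix_vector_mult inj_on_subset subset_UNIV)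
  show ?thesis
    by (simp add: mask_def sum.reindex[OF inj] card_image[OF inj] dot_lmul_matrix comp_def)
qed

definition fourier_partial :: "(nat \<Rightarrow> real^2^2) \<Rightarrow> (nat \<Rightarrow> (real^2) set) \<Rightarrow> nat \<Rightarrow> real^2 \<Rightarrow> complex" where
  "fourier_partial M D n \<xi> = (\<Prod>j\<in>{1..n}. mask (D j) (\<xi> v* inv_prod M j))"

lemma fourier_partial_0 [simp]: "fourier_partial M D 0 \<xi> = 1"
  by (simp add: fourier_partial_def)

lemma fourier_partial_Suc: "fourier_partial M D (Suc n) \<xi> =
    fourier_partial M D n \<xi> * mask (D (Suc n)) (\<xi> v* inv_prod M (Suc n))"
  by (simp add: fourier_partial_def)

lemma inv_prod_add: "inv_prod M (k + n) = inv_prod M k ** inv_prod (\<lambda>n. M (n + k)) n"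
  by (induction n) (simp_all add: matrix_mul_assoc add.commute)

text \<open>The factors after the first \<open>k\<close> are those of the sequence shifted by \<open>k\<close>, at the contracted point.\<close>

lemma fourier_partial_add: "fourier_partial M D (k + n) \<xi> =
    fourier_partial M D k \<xi> * fourier_partial (\<lambda>n. M (n + k)) (\<lambda>n. D (n + k)) n (\<xi> v* inv_prod M k)"
proof (induction n)
  case (Suc n)
  have "inv_prod M (Suc (k + n)) = inv_prod M k ** inv_prod (\<lambda>n. M (n + k)) (Suc n)"
    using inv_prod_add[of M k "Suc n"] by simp
  then show ?case using Suc
    by (simp add: fourier_partial_Suc vector_matrix_mul_assoc mult.assoc add.commute
        del: inv_prod.simps)
qed simp

context moran
begin

lemma shift: "moran (\<lambda>n. M (n + k)) (\<lambda>n. D (n + k)) r R"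
  by unfold_locales (auto intro: r_nonneg r_less_1 contraction inv_M finite_D simp: D_nonempty,
    metis norm_D trans_le_add1 One_nat_def)

lemma fourier_finite_moran: "fourier (finite_moran M D n) \<xi> = fourier_partial M D n \<xi>"
proof (induction n)
  case 0
  show ?case by (simp add: fourier_def integral_return)
next
  case (Suc n)
  interpret prob_space coin by (rule prob_coin)
  have 1: "prob_space (finite_moran M D n)" "sets (finite_moran M D n) = sets borel"
    unfolding distr_partial[symmetric] by (auto intro: prob_space_distr)
  have 2: "prob_space (delta ((*v) (inv_prod M (Suc n)) ` D (Suc n)))"
    unfolding distr_coin_component[symmetric] by (intro prob_space_distr) auto
  have "fourier (finite_moran M D (Suc n)) \<xi> = fourier_partial M D n \<xi> *
      fourier (delta ((*v) (inv_prod M (Suc n)) ` D (Suc n))) \<xi>"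
    unfolding finite_moran.simps by (subst fourier_convolution) (use 1 2 Suc in \<open>auto simp: delta_def\<close>)
  also have "fourier (delta ((*v) (inv_prod M (Suc n)) ` D (Suc n))) \<xi>
      = mask (D (Suc n)) (\<xi> v* inv_prod M (Suc n))"
    using finite_D[of "Suc n"] D_nonempty[of "Suc n"] invertible_inv_prod[of "Suc n"]
    by (subst fourier_delta) (auto simp: mask_image)
  finally show ?case by (simp only: fourier_partial_Suc)
qed

lemma fourier_partial_tendsto: "(\<lambda>n. fourier_partial M D n \<xi>) \<longlonglongrightarrow> fourier \<mu> \<xi>"
proof -
  interpret prob_space coin by (rule prob_coin)
  have "(\<lambda>n. \<integral>\<omega>. ee (\<xi> \<bullet> partial n \<omega>) \<partial>coin) \<longlonglongrightarrow> (\<integral>\<omega>. ee (\<xi> \<bullet> total \<omega>) \<partial>coin)"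
  proof (rule integral_dominated_convergence[where w="\<lambda>_. 1"])
    show "AE \<omega> in coin. (\<lambda>n. ee (\<xi> \<bullet> partial n \<omega>)) \<longlonglongrightarrow> ee (\<xi> \<bullet> total \<omega>)"
      using AE_coin
    proof eventually_elim
      case (elim \<omega>)
      have "isCont (\<lambda>x. ee (\<xi> \<bullet> x)) (total \<omega>)"
        using continuous_on_ee[OF continuous_on_inner[OF continuous_on_const continuous_on_id]]
        by (metis (no_types) continuous_on_eq_continuous_at open_UNIV UNIV_I)
      then show ?case by (rule isCont_tendsto_compose[OF _ total_summable(2)[OF elim]])
    qed
  qed auto
  then show ?thesis
    by (simp add: fourier_finite_moran[symmetric] distr_partial[symmetric] moran_measure_eq
        fourier_def integral_distr)
qed

text \<open>All factors have modulus at most \<open>1\<close> and the \<open>j\<close>-th one has a Lipschitz constant of order \<open>r\<^sup>j\<close>, so the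
  constants add up to a geometric series, uniformly in \<open>n\<close> and in the sequence.\<close>

lemma fourier_partial_Lipschitz:
  "cmod (fourier_partial M D n \<xi> - fourier_partial M D n \<eta>) \<le> 2 * pi * R / (1 - r) * norm (\<xi> - \<eta>)"
proof -
  have "cmod (fourier_partial M D n \<xi> - fourier_partial M D n \<eta>)
      \<le> (\<Sum>j\<in>{1..n}. cmod (mask (D j) (\<xi> v* inv_prod M j) - mask (D j) (\<eta> v* inv_prod M j)))"
    unfolding fourier_partial_def by (rule norm_prod_diff) (auto simp: norm_mask_le)
  also have "\<dots> \<le> (\<Sum>j\<in>{1..n}. r ^ j * (2 * pi * R * norm (\<xi> - \<eta>)))"
  proof (rule sum_mono)
    fix j assume j: "j \<in> {1..n}"
    have "cmod (mask (D j) (\<xi> v* inv_prod M j) - mask (D j) (\<eta> v* inv_prod M j))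
        \<le> 2 * pi * R * norm ((\<xi> - \<eta>) v* inv_prod M j)"
      using j by (subst vector_matrix_mult_diff_distrib) (intro mask_Lipschitz finite_D D_nonempty norm_D, auto)
    also have "\<dots> \<le> 2 * pi * R * (r ^ j * norm (\<xi> - \<eta>))"
      using R_nonneg by (intro mult_left_mono inv_prod_contraction') auto
    finally show "cmod (mask (D j) (\<xi> v* inv_prod M j) - mask (D j) (\<eta> v* inv_prod M j))
        \<le> r ^ j * (2 * pi * R * norm (\<xi> - \<eta>))" by (simp add: mult_ac)
  qed
  also have "\<dots> = (\<Sum>j\<in>{1..n}. r ^ j) * (2 * pi * R * norm (\<xi> - \<eta>))"
    by (simp add: sum_distrib_right)
  also have "\<dots> \<le> (1 / (1 - r)) * (2 * pi * R * norm (\<xi> - \<eta>))"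
  proof (rule mult_right_mono)
    have "(\<Sum>j\<in>{1..n}. r ^ j) \<le> (\<Sum>j. r ^ j)"
      using r_nonneg r_less_1 by (intro sum_le_suminf summable_geometric) auto
    also have "\<dots> = 1 / (1 - r)" using r_nonneg r_less_1 by (intro suminf_geometric) auto
    finally show "(\<Sum>j\<in>{1..n}. r ^ j) \<le> 1 / (1 - r)" .
  qed (use R_nonneg in auto)
  finally show ?thesis by (simp add: field_simps)
qed

lemma fourier_Lipschitz:
  "cmod (fourier \<mu> \<xi> - fourier \<mu> \<eta>) \<le> 2 * pi * R / (1 - r) * norm (\<xi> - \<eta>)"
  by (rule LIMSEQ_le_const2[OF tendsto_norm[OF tendsto_diff[OF fourier_partial_tendsto fourier_partial_tendsto]]])
    (intro exI allI impI fourier_partial_Lipschitz)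

lemma fourier_near_0: "cmod (fourier \<mu> \<xi>) \<ge> 1 - 2 * pi * R / (1 - r) * norm \<xi>"
proof -
  have "cmod (fourier \<mu> \<xi> - 1) \<le> 2 * pi * R / (1 - r) * norm \<xi>"
    using fourier_Lipschitz[of \<xi> 0] by (simp add: fourier_0 prob_\<mu>)
  moreover have "1 \<le> cmod (fourier \<mu> \<xi>) + cmod (fourier \<mu> \<xi> - 1)"
    using norm_triangle_ineq4[of "fourier \<mu> \<xi>" "fourier \<mu> \<xi> - 1"] by simp
  ultimately show ?thesis by linarith
qed

lemma fourier_split: "fourier \<mu> \<xi> = fourier_partial M D k \<xi> *
    fourier (moran_measure (\<lambda>n. M (n + k)) (\<lambda>n. D (n + k))) (\<xi> v* inv_prod M k)"
proof (rule LIMSEQ_unique)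
  interpret s: moran "\<lambda>n. M (n + k)" "\<lambda>n. D (n + k)" r R by (rule shift)
  show "(\<lambda>n. fourier_partial M D (k + n) \<xi>) \<longlonglongrightarrow> fourier \<mu> \<xi>"
    using LIMSEQ_ignore_initial_segment[OF fourier_partial_tendsto[of \<xi>], of k] by (simp add: add.commute)
  show "(\<lambda>n. fourier_partial M D (k + n) \<xi>) \<longlonglongrightarrow> fourier_partial M D k \<xi> *
    fourier (moran_measure (\<lambda>n. M (n + k)) (\<lambda>n. D (n + k))) (\<xi> v* inv_prod M k)"
    unfolding fourier_partial_add by (intro tendsto_intros s.fourier_partial_tendsto)
qed

lemma fourier_split_1: "fourier \<mu> \<xi> = mask (D 1) (\<xi> v* matrix_inv (M 1)) *
    fourier (moran_measure (\<lambda>n. M (Suc n)) (\<lambda>n. D (Suc n))) (\<xi> v* matrix_inv (M 1))"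
  using fourier_split[of \<xi> 1] by (simp add: fourier_partial_def)

text \<open>Far out in the product the argument is so close to \<open>0\<close> that the transform of the tail is close to \<open>1\<close>;
  hence a zero comes from one of finitely many factors.\<close>

lemma fourier_eq_0D:
  assumes "fourier \<mu> \<xi> = 0"
  shows "\<exists>j\<ge>1. mask (D j) (\<xi> v* inv_prod M j) = 0"
proof -
  have "(\<lambda>k. 2 * pi * R / (1 - r) * (r ^ k * norm \<xi>)) \<longlonglongrightarrow> 2 * pi * R / (1 - r) * (0 * norm \<xi>)"
    using r_nonneg r_less_1 by (intro tendsto_intros LIMSEQ_realpow_zero) auto
  then have "\<forall>\<^sub>F k in sequentially. 2 * pi * R / (1 - r) * (r ^ k * norm \<xi>) < 1"
    by (rule order_tendstoD) auto
  then obtain k where k: "2 * pi * R / (1 - r) * (r ^ k * norm \<xi>) < 1"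
    by (auto simp: eventually_sequentially)
  interpret s: moran "\<lambda>n. M (n + k)" "\<lambda>n. D (n + k)" r R by (rule shift)
  have "2 * pi * R / (1 - r) * norm (\<xi> v* inv_prod M k) \<le> 2 * pi * R / (1 - r) * (r ^ k * norm \<xi>)"
    using R_nonneg r_less_1 by (intro mult_left_mono inv_prod_contraction') auto
  then have "fourier s.\<mu> (\<xi> v* inv_prod M k) \<noteq> 0"
    using s.fourier_near_0[of "\<xi> v* inv_prod M k"] k by auto
  then have "fourier_partial M D k \<xi> = 0"
    using assms fourier_split[of \<xi> k] by simp
  then show ?thesis by (auto simp: fourier_partial_def)
qed

end

section \<open>Spectra and Parseval identities\<close>

definition trig :: "(real^2) set \<Rightarrow> (real^2 \<Rightarrow> complex) \<Rightarrow> real^2 \<Rightarrow> complex" where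
  "trig F c x = (\<Sum>l\<in>F. c l * ee (l \<bullet> x))"

definition orthogonal_exponentials :: "(real^2) measure \<Rightarrow> (real^2) set \<Rightarrow> bool" where
  "orthogonal_exponentials \<mu> \<Lambda> \<longleftrightarrow> (\<forall>l\<in>\<Lambda>. \<forall>m\<in>\<Lambda>. l \<noteq> m \<longrightarrow> fourier \<mu> (l - m) = 0)"

lemma orthogonal_exponentials_subset:
  "orthogonal_exponentials \<mu> \<Lambda> \<Longrightarrow> \<Lambda>' \<subseteq> \<Lambda> \<Longrightarrow> orthogonal_exponentials \<mu> \<Lambda>'"
  unfolding orthogonal_exponentials_def by blast

text \<open>Membership in the closed span of the exponentials with frequencies in \<open>\<Lambda>\<close>, expressed by squared distances.\<close>

definition L2_approx :: "(real^2) measure \<Rightarrow> (real^2) set \<Rightarrow> (real^2 \<Rightarrow> complex) \<Rightarrow> bool" where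
  "L2_approx \<mu> \<Lambda> f \<longleftrightarrow> square_integrable \<mu> f \<and>
     (\<forall>\<epsilon>>0. \<exists>F c. finite F \<and> F \<subseteq> \<Lambda> \<and> (\<integral>x. (cmod (f x - trig F c x))\<^sup>2 \<partial>\<mu>) < \<epsilon>)"

lemma L2_approxE:
  assumes "L2_approx \<mu> \<Lambda> f" "\<epsilon> > 0"
  obtains F c where "finite F" "F \<subseteq> \<Lambda>" "(\<integral>x. (cmod (f x - trig F c x))\<^sup>2 \<partial>\<mu>) < \<epsilon>"
  using assms unfolding L2_approx_def by blast

lemma cmod_add_sq: "(cmod (a + b))\<^sup>2 \<le> 2 * (cmod a)\<^sup>2 + 2 * (cmod b)\<^sup>2"
proof -
  have "(cmod (a + b))\<^sup>2 \<le> (cmod a + cmod b)\<^sup>2"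
    by (intro power_mono norm_triangle_ineq) auto
  also have "\<dots> \<le> 2 * (cmod a)\<^sup>2 + 2 * (cmod b)\<^sup>2"
    using sum_squares_bound[of "cmod a" "cmod b"] by (simp add: power2_sum)
  finally show ?thesis .
qed

lemma square_integrable_add:
  assumes "square_integrable \<mu> f" "square_integrable \<mu> g"
  shows "square_integrable \<mu> (\<lambda>x. f x + g x)"
proof -
  have [measurable]: "f \<in> borel_measurable \<mu>" "g \<in> borel_measurable \<mu>"
    using assms by (auto simp: square_integrable_def)
  have "integrable \<mu> (\<lambda>x. 2 * (cmod (f x))\<^sup>2 + 2 * (cmod (g x))\<^sup>2)"
    using assms by (auto simp: square_integrable_def)
  then have "integrable \<mu> (\<lambda>x. (cmod (f x + g x))\<^sup>2)"
    by (rule Bochner_Integration.integrable_bound) (auto simp: cmod_add_sq)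
  then show ?thesis by (simp add: square_integrable_def)
qed

lemma square_integrable_cmult:
  assumes "square_integrable \<mu> f"
  shows "square_integrable \<mu> (\<lambda>x. c * f x)"
proof -
  have "integrable \<mu> (\<lambda>x. (cmod c)\<^sup>2 * (cmod (f x))\<^sup>2)"
    using assms by (auto simp: square_integrable_def)
  then show ?thesis using assms by (auto simp: square_integrable_def norm_mult power_mult_distrib)
qed

lemma square_integrable_diff:
  assumes "square_integrable \<mu> f" "square_integrable \<mu> g"
  shows "square_integrable \<mu> (\<lambda>x. f x - g x)"
  using square_integrable_add[OF assms(1) square_integrable_cmult[OF assms(2), of "-1"]] by simp

lemma square_integrable_bounded:
  assumes "prob_space \<mu>" "f \<in> borel_measurable \<mu>" "\<And>x. cmod (f x) \<le> b"
  shows "square_integrable \<mu> f"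
proof -
  interpret prob_space \<mu> by fact
  note [measurable] = assms(2)
  have "integrable \<mu> (\<lambda>x. (cmod (f x))\<^sup>2)"
    by (rule integrable_const_bound[where B="b\<^sup>2"]) (auto intro!: power_mono assms(3))
  then show ?thesis by (simp add: square_integrable_def)
qed

lemma trig_measurable [measurable]: "trig F c \<in> borel_measurable borel"
  unfolding trig_def by measurable

lemma cmod_trig_le: "cmod (trig F c x) \<le> (\<Sum>l\<in>F. cmod (c l))"
  unfolding trig_def by (rule order_trans[OF norm_sum]) (simp add: norm_mult)

lemma trig_add:
  assumes "finite F" "finite G"
  shows "trig F c x + trig G d x =
    trig (F \<union> G) (\<lambda>l. (if l \<in> F then c l else 0) + (if l \<in> G then d l else 0)) x"
proof -
  have 1: "trig F c x = (\<Sum>l\<in>F \<union> G. (if l \<in> F then c l else 0) * ee (l \<bullet> x))"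
    unfolding trig_def using assms by (intro sum.mono_neutral_cong_left) auto
  have 2: "trig G d x = (\<Sum>l\<in>F \<union> G. (if l \<in> G then d l else 0) * ee (l \<bullet> x))"
    unfolding trig_def using assms by (intro sum.mono_neutral_cong_left) auto
  show ?thesis unfolding 1 2 by (simp add: trig_def sum.distrib[symmetric] distrib_right)
qed

lemma trig_cmult: "a * trig F c x = trig F (\<lambda>l. a * c l) x"
  by (simp add: trig_def sum_distrib_left mult.assoc)

locale borel_prob = prob_space \<mu> for \<mu> :: "(real^2) measure" +
  assumes sets_eq [measurable_cong, simp]: "sets \<mu> = sets borel"
begin

lemma square_integrable_trig: "square_integrable \<mu> (trig F c)"
  by (rule square_integrable_bounded[OF prob_space_axioms _ cmod_trig_le]) measurable

lemma approx_square_integrable: "L2_approx \<mu> \<Lambda> f \<Longrightarrow> square_integrable \<mu> f"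
  by (simp add: L2_approx_def)

lemma integral_add_sq_le:
  assumes "square_integrable \<mu> f" "square_integrable \<mu> g"
  shows "(\<integral>x. (cmod (f x + g x))\<^sup>2 \<partial>\<mu>) \<le> 2 * (\<integral>x. (cmod (f x))\<^sup>2 \<partial>\<mu>) + 2 * (\<integral>x. (cmod (g x))\<^sup>2 \<partial>\<mu>)"
proof -
  have "(\<integral>x. (cmod (f x + g x))\<^sup>2 \<partial>\<mu>) \<le> (\<integral>x. 2 * (cmod (f x))\<^sup>2 + 2 * (cmod (g x))\<^sup>2 \<partial>\<mu>)"
    using assms square_integrable_add[OF assms]
    by (intro integral_mono) (auto simp: square_integrable_def cmod_add_sq)
  also have "\<dots> = 2 * (\<integral>x. (cmod (f x))\<^sup>2 \<partial>\<mu>) + 2 * (\<integral>x. (cmod (g x))\<^sup>2 \<partial>\<mu>)"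
    using assms by (simp add: square_integrable_def)
  finally show ?thesis .
qed

lemma approx_closure:
  assumes f: "square_integrable \<mu> f"
    and ap: "\<And>\<epsilon>. \<epsilon> > 0 \<Longrightarrow> \<exists>g. L2_approx \<mu> \<Lambda> g \<and> (\<integral>x. (cmod (f x - g x))\<^sup>2 \<partial>\<mu>) < \<epsilon>"
  shows "L2_approx \<mu> \<Lambda> f"
  unfolding L2_approx_def
proof (intro conjI allI impI f)
  fix \<epsilon> :: real assume \<epsilon>: "\<epsilon> > 0"
  then obtain g where g: "L2_approx \<mu> \<Lambda> g" "(\<integral>x. (cmod (f x - g x))\<^sup>2 \<partial>\<mu>) < \<epsilon> / 4"
    using ap[of "\<epsilon>/4"] by auto
  obtain F c where F: "finite F" "F \<subseteq> \<Lambda>" "(\<integral>x. (cmod (g x - trig F c x))\<^sup>2 \<partial>\<mu>) < \<epsilon> / 4"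
    by (rule L2_approxE[OF g(1), of "\<epsilon> / 4"]) (use \<epsilon> in auto)
  have "(\<integral>x. (cmod (f x - trig F c x))\<^sup>2 \<partial>\<mu>)
      = (\<integral>x. (cmod ((f x - g x) + (g x - trig F c x)))\<^sup>2 \<partial>\<mu>)" by simp
  also have "\<dots> \<le> 2 * (\<integral>x. (cmod (f x - g x))\<^sup>2 \<partial>\<mu>) + 2 * (\<integral>x. (cmod (g x - trig F c x))\<^sup>2 \<partial>\<mu>)"
    by (intro integral_add_sq_le square_integrable_diff square_integrable_trig f approx_square_integrable[OF g(1)])
  also have "\<dots> < \<epsilon>" using g(2) F(3) by simp
  finally show "\<exists>F c. finite F \<and> F \<subseteq> \<Lambda> \<and> (\<integral>x. (cmod (f x - trig F c x))\<^sup>2 \<partial>\<mu>) < \<epsilon>"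
    using F(1,2) by (intro exI conjI)
qed

lemma approx_add:
  assumes f: "L2_approx \<mu> \<Lambda> f" and g: "L2_approx \<mu> \<Lambda> g"
  shows "L2_approx \<mu> \<Lambda> (\<lambda>x. f x + g x)"
  unfolding L2_approx_def
proof (intro conjI allI impI)
  show "square_integrable \<mu> (\<lambda>x. f x + g x)"
    by (intro square_integrable_add approx_square_integrable[OF f] approx_square_integrable[OF g])
  fix \<epsilon> :: real assume \<epsilon>: "\<epsilon> > 0"
  obtain F c where F: "finite F" "F \<subseteq> \<Lambda>" "(\<integral>x. (cmod (f x - trig F c x))\<^sup>2 \<partial>\<mu>) < \<epsilon> / 4"
    by (rule L2_approxE[OF f, of "\<epsilon> / 4"]) (use \<epsilon> in auto)
  obtain G d where G: "finite G" "G \<subseteq> \<Lambda>" "(\<integral>x. (cmod (g x - trig G d x))\<^sup>2 \<partial>\<mu>) < \<epsilon> / 4"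
    by (rule L2_approxE[OF g, of "\<epsilon> / 4"]) (use \<epsilon> in auto)
  obtain e where e: "\<And>x. trig F c x + trig G d x = trig (F \<union> G) e x"
    using trig_add[OF F(1) G(1)] by blast
  have "(\<integral>x. (cmod (f x + g x - trig (F \<union> G) e x))\<^sup>2 \<partial>\<mu>)
      = (\<integral>x. (cmod ((f x - trig F c x) + (g x - trig G d x)))\<^sup>2 \<partial>\<mu>)"
    unfolding e[symmetric] by (simp add: algebra_simps)
  also have "\<dots> \<le> 2 * (\<integral>x. (cmod (f x - trig F c x))\<^sup>2 \<partial>\<mu>) + 2 * (\<integral>x. (cmod (g x - trig G d x))\<^sup>2 \<partial>\<mu>)"
    by (intro integral_add_sq_le square_integrable_diff square_integrable_trig
        approx_square_integrable[OF f] approx_square_integrable[OF g])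
  also have "\<dots> < \<epsilon>" using F(3) G(3) by simp
  finally show "\<exists>F c. finite F \<and> F \<subseteq> \<Lambda> \<and> (\<integral>x. (cmod (f x + g x - trig F c x))\<^sup>2 \<partial>\<mu>) < \<epsilon>"
    using F(1,2) G(1,2) by (intro exI[of _ "F \<union> G"] exI[of _ e]) auto
qed

lemma approx_zero: "L2_approx \<mu> \<Lambda> (\<lambda>_. 0)"
proof -
  have "square_integrable \<mu> (\<lambda>_. 0)" by (auto simp: square_integrable_def)
  moreover have "\<exists>F c. finite F \<and> F \<subseteq> \<Lambda> \<and> (\<integral>x. (cmod (0 - trig F c x))\<^sup>2 \<partial>\<mu>) < \<epsilon>" if "\<epsilon> > 0" for \<epsilon>
    using that by (intro exI[of _ "{}"]) (auto simp: trig_def)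
  ultimately show ?thesis unfolding L2_approx_def by blast
qed

lemma approx_cmult:
  assumes f: "L2_approx \<mu> \<Lambda> f"
  shows "L2_approx \<mu> \<Lambda> (\<lambda>x. a * f x)"
proof (cases "a = 0")
  case False
  show ?thesis
    unfolding L2_approx_def
  proof (intro conjI allI impI)
    show "square_integrable \<mu> (\<lambda>x. a * f x)"
      by (intro square_integrable_cmult approx_square_integrable[OF f])
    fix \<epsilon> :: real assume "\<epsilon> > 0"
    then have "\<epsilon> / (cmod a)\<^sup>2 > 0" using False by simp
    then obtain F c where F: "finite F" "F \<subseteq> \<Lambda>" "(\<integral>x. (cmod (f x - trig F c x))\<^sup>2 \<partial>\<mu>) < \<epsilon> / (cmod a)\<^sup>2"
      by (rule L2_approxE[OF f])
    have "(\<integral>x. (cmod (a * f x - trig F (\<lambda>l. a * c l) x))\<^sup>2 \<partial>\<mu>) = (\<integral>x. (cmod a)\<^sup>2 * (cmod (f x - trig F c x))\<^sup>2 \<partial>\<mu>)"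
      unfolding trig_cmult[symmetric] by (simp add: right_diff_distrib[symmetric] norm_mult power_mult_distrib)
    also have "\<dots> < \<epsilon>" using F(3) False by (simp add: field_simps)
    finally show "\<exists>F c. finite F \<and> F \<subseteq> \<Lambda> \<and> (\<integral>x. (cmod (a * f x - trig F c x))\<^sup>2 \<partial>\<mu>) < \<epsilon>"
      using F(1,2) by (intro exI conjI)
  qed
qed (simp add: approx_zero)

lemma approx_diff:
  assumes f: "L2_approx \<mu> \<Lambda> f" and g: "L2_approx \<mu> \<Lambda> g"
  shows "L2_approx \<mu> \<Lambda> (\<lambda>x. f x - g x)"
  using approx_add[OF f approx_cmult[OF g, of "-1"]] by simp

lemma approx_sum:
  assumes "\<And>i. i \<in> I \<Longrightarrow> L2_approx \<mu> \<Lambda> (f i)"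
  shows "L2_approx \<mu> \<Lambda> (\<lambda>x. \<Sum>i\<in>I. f i x)"
  using assms by (induction I rule: infinite_finite_induct) (auto intro: approx_zero approx_add)

text \<open>The closed span is closed under dominated pointwise limits.  This is the only limit theorem needed to climb
  from continuous functions to indicators and to all square-integrable functions.\<close>

lemma approx_dominated:
  assumes f: "f \<in> borel_measurable borel"
    and g: "\<And>n. L2_approx \<mu> \<Lambda> (g n)"
    and lim: "\<And>x. (\<lambda>n. g n x) \<longlonglongrightarrow> f x"
    and bd: "\<And>n x. cmod (g n x) \<le> h x" and h: "integrable \<mu> (\<lambda>x. (h x)\<^sup>2)"
  shows "L2_approx \<mu> \<Lambda> f"
proof (rule approx_closure)
  note [measurable] = f
  have [measurable]: "g n \<in> borel_measurable borel" for n
    using approx_square_integrable[OF g[of n]] by (auto simp: square_integrable_def)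
  have fh: "cmod (f x) \<le> h x" for x
    by (rule LIMSEQ_le_const2[OF tendsto_norm[OF lim]]) (use bd in auto)
  have h0: "h x \<ge> 0" for x using bd[of 0 x] norm_ge_zero order_trans by blast
  show "square_integrable \<mu> f"
    unfolding square_integrable_def
  proof (intro conjI)
    show "integrable \<mu> (\<lambda>x. (cmod (f x))\<^sup>2)"
      by (rule Bochner_Integration.integrable_bound[OF h]) (auto intro!: power_mono fh simp: h0)
  qed measurable
  have "(\<lambda>n. \<integral>x. (cmod (f x - g n x))\<^sup>2 \<partial>\<mu>) \<longlonglongrightarrow> (\<integral>x. 0 \<partial>\<mu>)"
  proof (rule integral_dominated_convergence[where w="\<lambda>x. 4 * (h x)\<^sup>2"])
    show "AE x in \<mu>. (\<lambda>n. (cmod (f x - g n x))\<^sup>2) \<longlonglongrightarrow> 0"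
    proof (rule AE_I2)
      fix x
      have "(\<lambda>n. (cmod (f x - g n x))\<^sup>2) \<longlonglongrightarrow> (cmod (f x - f x))\<^sup>2"
        by (intro tendsto_intros lim)
      then show "(\<lambda>n. (cmod (f x - g n x))\<^sup>2) \<longlonglongrightarrow> 0" by simp
    qed
    show "AE x in \<mu>. norm ((cmod (f x - g n x))\<^sup>2) \<le> 4 * (h x)\<^sup>2" for n
    proof (rule AE_I2)
      fix x
      have "cmod (f x - g n x) \<le> 2 * h x"
        using norm_triangle_ineq4[of "f x" "g n x"] fh[of x] bd[of n x] by linarith
      then have "(cmod (f x - g n x))\<^sup>2 \<le> (2 * h x)\<^sup>2" by (intro power_mono) auto
      then show "norm ((cmod (f x - g n x))\<^sup>2) \<le> 4 * (h x)\<^sup>2" by (simp add: power_mult_distrib)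
    qed
  qed (use h in auto)
  then have l: "(\<lambda>n. \<integral>x. (cmod (f x - g n x))\<^sup>2 \<partial>\<mu>) \<longlonglongrightarrow> 0" by simp
  show "\<exists>g. L2_approx \<mu> \<Lambda> g \<and> (\<integral>x. (cmod (f x - g x))\<^sup>2 \<partial>\<mu>) < \<epsilon>" if "\<epsilon> > 0" for \<epsilon>
  proof -
    have "\<forall>\<^sub>F n in sequentially. (\<integral>x. (cmod (f x - g n x))\<^sup>2 \<partial>\<mu>) < \<epsilon>"
      using order_tendstoD(2)[OF l that] .
    then show ?thesis using g by (auto simp: eventually_sequentially)
  qed
qed

end

context borel_prob
begin

text \<open>Pythagoras: the distance splits into the distance to the orthogonal projection, with coefficients
  \<open>cnj (fourier \<mu> (l - \<eta>))\<close>, and the distance of the coefficient vectors.\<close>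

lemma integral_exponential_minus_trig:
  assumes F: "finite F" and orth: "orthogonal_exponentials \<mu> F"
  shows "(\<integral>x. (cmod (ee (\<eta> \<bullet> x) - trig F c x))\<^sup>2 \<partial>\<mu>) =
    1 - (\<Sum>l\<in>F. (cmod (fourier \<mu> (l - \<eta>)))\<^sup>2) + (\<Sum>l\<in>F. (cmod (c l - cnj (fourier \<mu> (l - \<eta>))))\<^sup>2)"
proof -
  have hb: "has_bochner_integral \<mu> (\<lambda>x. ee (k \<bullet> x)) (fourier \<mu> k)" for k
    unfolding fourier_def
    by (rule has_bochner_integral_integrable, rule integrable_ee) (auto intro: prob_space_axioms)
  have one: "has_bochner_integral \<mu> (\<lambda>x. 1 :: complex) 1"
    by (simp add: has_bochner_integral_iff prob_space)
  have pw: "complex_of_real ((cmod (ee (\<eta> \<bullet> x) - trig F c x))\<^sup>2)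
    = 1 - (\<Sum>l\<in>F. cnj (c l) * ee ((\<eta> - l) \<bullet> x)) - (\<Sum>l\<in>F. c l * ee ((l - \<eta>) \<bullet> x))
      + (\<Sum>l\<in>F. \<Sum>m\<in>F. c l * cnj (c m) * ee ((l - m) \<bullet> x))" for x
  proof -
    have 1: "ee (\<eta> \<bullet> x) * cnj (ee (\<eta> \<bullet> x)) = 1"
      using ee_diff[of "\<eta> \<bullet> x" "\<eta> \<bullet> x"] by simp
    have "complex_of_real ((cmod (ee (\<eta> \<bullet> x) - trig F c x))\<^sup>2)
      = (ee (\<eta> \<bullet> x) - trig F c x) * cnj (ee (\<eta> \<bullet> x) - trig F c x)"
      by (rule complex_norm_square)
    also have "\<dots> = ee (\<eta> \<bullet> x) * cnj (ee (\<eta> \<bullet> x)) - ee (\<eta> \<bullet> x) * cnj (trig F c x)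
      - trig F c x * cnj (ee (\<eta> \<bullet> x)) + trig F c x * cnj (trig F c x)"
      by (simp add: algebra_simps)
    also have "ee (\<eta> \<bullet> x) * cnj (trig F c x) = (\<Sum>l\<in>F. cnj (c l) * ee ((\<eta> - l) \<bullet> x))"
      unfolding trig_def cnj_sum sum_distrib_left by (intro sum.cong) (simp_all add: inner_diff_left ee_diff mult_ac)
    also have "trig F c x * cnj (ee (\<eta> \<bullet> x)) = (\<Sum>l\<in>F. c l * ee ((l - \<eta>) \<bullet> x))"
      unfolding trig_def sum_distrib_right by (intro sum.cong) (simp_all add: inner_diff_left ee_diff mult_ac)
    also have "trig F c x * cnj (trig F c x) = (\<Sum>l\<in>F. \<Sum>m\<in>F. c l * cnj (c m) * ee ((l - m) \<bullet> x))"
      unfolding trig_def cnj_sum sum_product by (intro sum.cong) (simp_all add: inner_diff_left ee_diff mult_ac)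
    finally show ?thesis using 1 by simp
  qed
  have "complex_of_real (\<integral>x. (cmod (ee (\<eta> \<bullet> x) - trig F c x))\<^sup>2 \<partial>\<mu>)
    = (\<integral>x. complex_of_real ((cmod (ee (\<eta> \<bullet> x) - trig F c x))\<^sup>2) \<partial>\<mu>)"
    by (rule integral_complex_of_real[symmetric])
  also have "\<dots> = 1 - (\<Sum>l\<in>F. cnj (c l) * fourier \<mu> (\<eta> - l)) - (\<Sum>l\<in>F. c l * fourier \<mu> (l - \<eta>))
      + (\<Sum>l\<in>F. \<Sum>m\<in>F. c l * cnj (c m) * fourier \<mu> (l - m))"
    unfolding pw
    by (intro has_bochner_integral_integral_eq has_bochner_integral_add has_bochner_integral_diff
        has_bochner_integral_sum has_bochner_integral_mult_right hb one)
  also have "(\<Sum>l\<in>F. \<Sum>m\<in>F. c l * cnj (c m) * fourier \<mu> (l - m)) = (\<Sum>l\<in>F. c l * cnj (c l))"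
  proof (rule sum.cong[OF refl])
    fix l assume l: "l \<in> F"
    have "(\<Sum>m\<in>F. c l * cnj (c m) * fourier \<mu> (l - m)) = (\<Sum>m\<in>F. if m = l then c l * cnj (c l) else 0)"
      using orth l by (intro sum.cong) (auto simp: orthogonal_exponentials_def fourier_0 prob_space_axioms)
    then show "(\<Sum>m\<in>F. c l * cnj (c m) * fourier \<mu> (l - m)) = c l * cnj (c l)"
      using F l by simp
  qed
  also have "1 - (\<Sum>l\<in>F. cnj (c l) * fourier \<mu> (\<eta> - l)) - (\<Sum>l\<in>F. c l * fourier \<mu> (l - \<eta>))
      + (\<Sum>l\<in>F. c l * cnj (c l))
    = 1 - (\<Sum>l\<in>F. fourier \<mu> (l - \<eta>) * cnj (fourier \<mu> (l - \<eta>)))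
      + (\<Sum>l\<in>F. (c l - cnj (fourier \<mu> (l - \<eta>))) * cnj (c l - cnj (fourier \<mu> (l - \<eta>))))"
  proof -
    have "(\<Sum>l\<in>F. c l * cnj (c l) - cnj (c l) * fourier \<mu> (\<eta> - l) - c l * fourier \<mu> (l - \<eta>))
      = (\<Sum>l\<in>F. (c l - cnj (fourier \<mu> (l - \<eta>))) * cnj (c l - cnj (fourier \<mu> (l - \<eta>)))
          - fourier \<mu> (l - \<eta>) * cnj (fourier \<mu> (l - \<eta>)))"
    proof (rule sum.cong[OF refl])
      fix l
      have "fourier \<mu> (\<eta> - l) = cnj (fourier \<mu> (l - \<eta>))"
        using fourier_minus[of \<mu> "l - \<eta>"] by simp
      then show "c l * cnj (c l) - cnj (c l) * fourier \<mu> (\<eta> - l) - c l * fourier \<mu> (l - \<eta>)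
        = (c l - cnj (fourier \<mu> (l - \<eta>))) * cnj (c l - cnj (fourier \<mu> (l - \<eta>)))
          - fourier \<mu> (l - \<eta>) * cnj (fourier \<mu> (l - \<eta>))"
        by (simp add: algebra_simps)
    qed
    then show ?thesis by (simp only: sum_subtractf) (simp add: algebra_simps)
  qed
  also have "\<dots> = complex_of_real (1 - (\<Sum>l\<in>F. (cmod (fourier \<mu> (l - \<eta>)))\<^sup>2)
      + (\<Sum>l\<in>F. (cmod (c l - cnj (fourier \<mu> (l - \<eta>))))\<^sup>2))"
    by (simp only: complex_norm_square of_real_sum of_real_add of_real_diff of_real_1)
  finally show ?thesis by (simp only: of_real_eq_iff)
qed

lemma Bessel:
  assumes F: "finite F" and orth: "orthogonal_exponentials \<mu> F"
  shows "(\<Sum>l\<in>F. (cmod (fourier \<mu> (\<xi> + l)))\<^sup>2) \<le> 1"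
proof -
  have "0 \<le> (\<integral>x. (cmod (ee ((- \<xi>) \<bullet> x) - trig F (\<lambda>l. cnj (fourier \<mu> (l - (- \<xi>)))) x))\<^sup>2 \<partial>\<mu>)"
    by simp
  also have "\<dots> = 1 - (\<Sum>l\<in>F. (cmod (fourier \<mu> (l - (- \<xi>))))\<^sup>2)"
    by (subst integral_exponential_minus_trig[OF assms]) simp
  finally show ?thesis by (simp add: add.commute)
qed

text \<open>By the exact distance formula the best approximation from a finite set \<open>F\<close> misses by one minus the partial
  Parseval sum over \<open>F\<close>; so the sum reaches \<open>1\<close> iff the error can be made arbitrarily small.\<close>

lemma parseval_iff_approx_exponential:
  assumes orth: "orthogonal_exponentials \<mu> \<Lambda>"
  shows "((\<lambda>l. (cmod (fourier \<mu> (\<xi> + l)))\<^sup>2) has_sum 1) \<Lambda> \<longleftrightarrow> L2_approx \<mu> \<Lambda> (\<lambda>x. ee ((- \<xi>) \<bullet> x))"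
proof -
  let ?f = "\<lambda>l. (cmod (fourier \<mu> (\<xi> + l)))\<^sup>2"
  let ?a = "\<lambda>l. cnj (fourier \<mu> (\<xi> + l))"
  have orthF: "orthogonal_exponentials \<mu> F" if "F \<subseteq> \<Lambda>" for F
    using orthogonal_exponentials_subset[OF orth that] .
  have dist: "(\<integral>x. (cmod (ee ((- \<xi>) \<bullet> x) - trig F c x))\<^sup>2 \<partial>\<mu>) = 1 - sum ?f F + (\<Sum>l\<in>F. (cmod (c l - ?a l))\<^sup>2)"
    if "finite F" "F \<subseteq> \<Lambda>" for F c
    using integral_exponential_minus_trig[OF that(1) orthF[OF that(2)], of "- \<xi>" c] by (simp add: add.commute)
  have le1: "sum ?f F \<le> 1" if "finite F" "F \<subseteq> \<Lambda>" for F
    using Bessel[OF that(1) orthF[OF that(2)]] .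
  have sqi: "square_integrable \<mu> (\<lambda>x. ee ((- \<xi>) \<bullet> x))"
  proof (rule square_integrable_bounded[OF prob_space_axioms, where b=1])
    show "(\<lambda>x. ee (- \<xi> \<bullet> x)) \<in> borel_measurable \<mu>" by measurable
  qed simp
  show ?thesis
  proof
    assume hs: "(?f has_sum 1) \<Lambda>"
    show "L2_approx \<mu> \<Lambda> (\<lambda>x. ee ((- \<xi>) \<bullet> x))"
      unfolding L2_approx_def
    proof (intro conjI allI impI sqi)
      fix \<epsilon> :: real assume \<epsilon>: "\<epsilon> > 0"
      obtain F where F: "finite F" "F \<subseteq> \<Lambda>" "dist (sum ?f F) 1 \<le> \<epsilon> / 2"
        using has_sum_finite_approximation[OF hs, of "\<epsilon> / 2"] \<epsilon> by auto
      have "(\<integral>x. (cmod (ee ((- \<xi>) \<bullet> x) - trig F ?a x))\<^sup>2 \<partial>\<mu>) < \<epsilon>"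
      proof -
        have "1 - sum ?f F \<le> \<epsilon> / 2"
          using F(3) unfolding dist_real_def by (rule abs_le_D2[THEN order_trans[rotated]]) simp
        then show ?thesis using \<epsilon> unfolding dist[OF F(1,2)] by simp
      qed
      then show "\<exists>F c. finite F \<and> F \<subseteq> \<Lambda> \<and> (\<integral>x. (cmod (ee ((- \<xi>) \<bullet> x) - trig F c x))\<^sup>2 \<partial>\<mu>) < \<epsilon>"
        using F(1,2) by (intro exI conjI)
    qed
  next
    assume ap: "L2_approx \<mu> \<Lambda> (\<lambda>x. ee ((- \<xi>) \<bullet> x))"
    have sm: "?f summable_on \<Lambda>"
      by (rule nonneg_bdd_above_summable_on) (use le1 in \<open>auto intro!: bdd_aboveI[of _ 1]\<close>)
    have "infsum ?f \<Lambda> \<le> 1" by (rule infsum_le_finite_sums[OF sm]) (use le1 in auto)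
    moreover have "1 \<le> infsum ?f \<Lambda>"
    proof (rule field_le_epsilon)
      fix \<epsilon> :: real assume "\<epsilon> > 0"
      then obtain F c where F: "finite F" "F \<subseteq> \<Lambda>"
        "(\<integral>x. (cmod (ee ((- \<xi>) \<bullet> x) - trig F c x))\<^sup>2 \<partial>\<mu>) < \<epsilon>"
        using ap by (auto elim: L2_approxE)
      have "0 \<le> (\<Sum>l\<in>F. (cmod (c l - ?a l))\<^sup>2)" by (intro sum_nonneg) auto
      then have "1 < sum ?f F + \<epsilon>" using F(3) unfolding dist[OF F(1,2)] by linarith
      also have "sum ?f F \<le> infsum ?f \<Lambda>"
        using F by (intro finite_sum_le_infsum[OF sm]) auto
      finally show "1 \<le> infsum ?f \<Lambda> + \<epsilon>" by simp
    qed
    ultimately have "infsum ?f \<Lambda> = 1" by simp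
    then show "(?f has_sum 1) \<Lambda>" using has_sum_infsum[OF sm] by simp
  qed
qed

lemma L2_orthonormal_basis_iff:
  "L2_orthonormal_basis \<mu> \<Lambda> (\<lambda>l x. exp (2 * of_real pi * \<i> * of_real (l \<bullet> x))) \<longleftrightarrow>
    orthogonal_exponentials \<mu> \<Lambda> \<and> (\<forall>f. square_integrable \<mu> f \<longrightarrow> L2_approx \<mu> \<Lambda> f)"
proof -
  have sqi: "square_integrable \<mu> (\<lambda>x. ee (l \<bullet> x))" for l
  proof (rule square_integrable_bounded[OF prob_space_axioms, where b=1])
    show "(\<lambda>x. ee (l \<bullet> x)) \<in> borel_measurable \<mu>" by measurable
  qed simp
  have o: "(\<forall>i\<in>\<Lambda>. \<forall>j\<in>\<Lambda>. (\<integral>x. ee (i \<bullet> x) * cnj (ee (j \<bullet> x)) \<partial>\<mu>) = (if i = j then 1 else 0))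
      \<longleftrightarrow> orthogonal_exponentials \<mu> \<Lambda>"
  proof -
    have "(\<integral>x. ee (i \<bullet> x) * cnj (ee (j \<bullet> x)) \<partial>\<mu>) = fourier \<mu> (i - j)" for i j
      by (simp add: fourier_def inner_diff_left ee_diff)
    then show ?thesis
      unfolding orthogonal_exponentials_def by (auto simp: fourier_0 prob_space_axioms)
  qed
  have d: "(\<forall>\<epsilon>>0. \<exists>F c. finite F \<and> F \<subseteq> \<Lambda> \<and>
        sqrt (\<integral>x. (cmod (f x - (\<Sum>i\<in>F. c i * ee (i \<bullet> x))))\<^sup>2 \<partial>\<mu>) < \<epsilon>)
     \<longleftrightarrow> L2_approx \<mu> \<Lambda> f" if f: "square_integrable \<mu> f" for f
  proof
    assume L: "\<forall>\<epsilon>>0. \<exists>F c. finite F \<and> F \<subseteq> \<Lambda> \<and>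
        sqrt (\<integral>x. (cmod (f x - (\<Sum>i\<in>F. c i * ee (i \<bullet> x))))\<^sup>2 \<partial>\<mu>) < \<epsilon>"
    show "L2_approx \<mu> \<Lambda> f"
      unfolding L2_approx_def
    proof (intro conjI f allI impI)
      fix \<epsilon> :: real assume "\<epsilon> > 0"
      then have "sqrt \<epsilon> > 0" by simp
      then obtain F c where "finite F" "F \<subseteq> \<Lambda>" "sqrt (\<integral>x. (cmod (f x - trig F c x))\<^sup>2 \<partial>\<mu>) < sqrt \<epsilon>"
        using L[rule_format, of "sqrt \<epsilon>"] unfolding trig_def by blast
      then show "\<exists>F c. finite F \<and> F \<subseteq> \<Lambda> \<and> (\<integral>x. (cmod (f x - trig F c x))\<^sup>2 \<partial>\<mu>) < \<epsilon>"
        by (intro exI[of _ F] exI[of _ c]) simp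
    qed
  next
    assume R: "L2_approx \<mu> \<Lambda> f"
    show "\<forall>\<epsilon>>0. \<exists>F c. finite F \<and> F \<subseteq> \<Lambda> \<and>
        sqrt (\<integral>x. (cmod (f x - (\<Sum>i\<in>F. c i * ee (i \<bullet> x))))\<^sup>2 \<partial>\<mu>) < \<epsilon>"
    proof (intro allI impI)
      fix \<epsilon> :: real assume \<epsilon>: "\<epsilon> > 0"
      obtain F c where F: "finite F" "F \<subseteq> \<Lambda>" "(\<integral>x. (cmod (f x - trig F c x))\<^sup>2 \<partial>\<mu>) < \<epsilon>\<^sup>2"
        by (rule L2_approxE[OF R, of "\<epsilon>\<^sup>2"]) (use \<epsilon> in auto)
      then have "sqrt (\<integral>x. (cmod (f x - trig F c x))\<^sup>2 \<partial>\<mu>) < \<epsilon>"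
        using \<epsilon> by (intro real_less_lsqrt) auto
      then show "\<exists>F c. finite F \<and> F \<subseteq> \<Lambda> \<and>
        sqrt (\<integral>x. (cmod (f x - (\<Sum>i\<in>F. c i * ee (i \<bullet> x))))\<^sup>2 \<partial>\<mu>) < \<epsilon>"
        using F(1,2) unfolding trig_def by (intro exI[of _ F] exI[of _ c]) simp
    qed
  qed
  show ?thesis
    unfolding L2_orthonormal_basis_def ee_def[symmetric] o using d sqi by blast
qed

text \<open>The real functions that are finite combinations of exponentials, with arbitrary real frequencies, form a
  ring, and \<open>cos\<close> and \<open>sin\<close> of a frequency parallel to \<open>x - y\<close> separate \<open>x\<close> from \<open>y\<close>.\<close>

lemma Stone_Weierstrass_trig:
  fixes f :: "real^2 \<Rightarrow> real"
  assumes "continuous_on (cball 0 B) f" "\<epsilon> > 0"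
  shows "\<exists>F c. finite F \<and> (\<forall>x\<in>cball 0 B. cmod (of_real (f x) - trig F c x) < \<epsilon>)"
proof -
  define R where "R = {g :: real^2 \<Rightarrow> real. \<exists>F c. finite F \<and> (\<forall>x. of_real (g x) = trig F c x)}"
  interpret function_ring_on R "cball 0 B"
  proof
    show "continuous_on (cball 0 B) g" if g: "g \<in> R" for g
    proof -
      obtain F c where "finite F" "\<And>x. of_real (g x) = trig F c x" using g unfolding R_def by blast
      then have "g x = Re (trig F c x)" for x by (metis Re_complex_of_real)
      then have "g = (\<lambda>x. Re (trig F c x))" by auto
      then show ?thesis unfolding trig_def by (auto intro!: continuous_intros)
    qed
    show "(\<lambda>x. g x + h x) \<in> R" if gh: "g \<in> R" "h \<in> R" for g h
    proof -
      obtain F c where F: "finite F" "\<And>x. of_real (g x) = trig F c x" using gh unfolding R_def by blast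
      obtain G d where G: "finite G" "\<And>x. of_real (h x) = trig G d x" using gh unfolding R_def by blast
      show ?thesis using F G trig_add[OF F(1) G(1)] unfolding R_def
        by (intro CollectI exI[of _ "F \<union> G"] exI) auto
    qed
    show "(\<lambda>x. g x * h x) \<in> R" if gh: "g \<in> R" "h \<in> R" for g h
    proof -
      obtain F c where F: "finite F" "\<And>x. of_real (g x) = trig F c x" using gh unfolding R_def by blast
      obtain G d where G: "finite G" "\<And>x. of_real (h x) = trig G d x" using gh unfolding R_def by blast
      define P where "P = F \<times> G"
      define s where "s = (\<lambda>(l :: real^2, m :: real^2). l + m)"
      define e where "e k = (\<Sum>p\<in>{p\<in>P. s p = k}. c (fst p) * d (snd p))" for k
      have fin: "finite P" using F G by (simp add: P_def)
      have "of_real (g x * h x) = trig (s ` P) e x" for x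
      proof -
        have "of_real (g x * h x) = trig F c x * trig G d x" using F G by simp
        also have "\<dots> = (\<Sum>p\<in>P. c (fst p) * d (snd p) * ee (s p \<bullet> x))"
          unfolding trig_def sum_product P_def sum.cartesian_product
          by (intro sum.cong) (auto simp: s_def inner_add_left ee_add)
        also have "\<dots> = (\<Sum>k\<in>s ` P. \<Sum>p\<in>{p\<in>P. s p = k}. c (fst p) * d (snd p) * ee (s p \<bullet> x))"
          by (rule sum.image_gen[OF fin])
        also have "\<dots> = trig (s ` P) e x"
          unfolding trig_def e_def sum_distrib_right by (intro sum.cong) auto
        finally show ?thesis .
      qed
      then show ?thesis using fin unfolding R_def by (intro CollectI exI[of _ "s ` P"] exI[of _ e]) auto
    qed
    show "(\<lambda>_. a) \<in> R" for a
      unfolding R_def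
      by (intro CollectI exI[of _ "{0}"] exI[of _ "\<lambda>_. of_real a"]) (auto simp: trig_def)
    show "\<exists>g\<in>R. g x \<noteq> g y" if "x \<noteq> y" for x y
    proof (rule ccontr)
      assume "\<not> ?thesis"
      then have eq: "g x = g y" if "g \<in> R" for g using that by auto
      have c1: "(\<lambda>x. cos (2 * pi * (l \<bullet> x))) \<in> R" for l
      proof (cases "l = 0")
        case True
        then show ?thesis unfolding R_def
          by (intro CollectI exI[of _ "{0}"] exI[of _ "\<lambda>_. 1"]) (auto simp: trig_def)
      next
        case False
        then have "l \<noteq> - l" by (simp add: vec_eq_iff)
        then show ?thesis unfolding R_def
          by (intro CollectI exI[of _ "{l, - l}"] exI[of _ "\<lambda>_. 1/2"])
            (auto simp: trig_def ee_minus complex_eq_iff, auto simp: ee_cis)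
      qed
      have s1: "(\<lambda>x. sin (2 * pi * (l \<bullet> x))) \<in> R" if "l \<noteq> 0" for l
      proof -
        have "l \<noteq> - l" using that by (simp add: vec_eq_iff)
        then show ?thesis unfolding R_def
          by (intro CollectI exI[of _ "{l, - l}"] exI[of _ "\<lambda>k. if k = l then - \<i> / 2 else \<i> / 2"])
            (auto simp: trig_def ee_minus complex_eq_iff, auto simp: ee_cis)
      qed
      \<comment> \<open>This frequency turns \<open>x - y\<close> into half a period.\<close>
      define l where "l = (1 / (2 * (norm (x - y))\<^sup>2)) *\<^sub>R (x - y)"
      have n: "norm (x - y) \<noteq> 0" using that by simp
      then have l0: "l \<noteq> 0" using that by (simp add: l_def)
      have "l \<bullet> (x - y) = 1 / 2" using n by (simp add: l_def power2_norm_eq_inner)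
      then have lxy: "l \<bullet> x = l \<bullet> y + 1 / 2" by (simp add: inner_diff_right)
      have "ee (l \<bullet> x) = ee (l \<bullet> y)"
        using eq[OF c1[of l]] eq[OF s1[OF l0]] by (simp add: ee_cis complex_eq_iff)
      moreover have "ee (l \<bullet> y) \<noteq> 0" using norm_ee[of "l \<bullet> y"] by (metis norm_zero zero_neq_one)
      ultimately have "ee (1 / 2) = 1" unfolding lxy ee_add by simp
      then show False by (simp add: ee_cis)
    qed
  qed simp
  obtain g where g: "g \<in> R" "\<forall>x\<in>cball 0 B. \<bar>f x - g x\<bar> < \<epsilon>"
    using Stone_Weierstrass_basic[OF assms] by blast
  then obtain F c where F: "finite F" "\<And>x. of_real (g x) = trig F c x" unfolding R_def by blast
  have "cmod (of_real (f x) - trig F c x) < \<epsilon>" if "x \<in> cball 0 B" for x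
    unfolding F(2)[symmetric] using g(2) that by (simp flip: of_real_diff)
  then show ?thesis using F(1) by blast
qed

end

context borel_prob
begin

lemma approx_continuous:
  assumes bdd: "AE x in \<mu>. x \<in> cball 0 B"
    and exps: "\<And>\<xi>. L2_approx \<mu> \<Lambda> (\<lambda>x. ee (\<xi> \<bullet> x))"
    and f: "continuous_on UNIV f" "\<And>x. \<bar>f x\<bar> \<le> b"
  shows "L2_approx \<mu> \<Lambda> (\<lambda>x. complex_of_real (f x))"
proof (rule approx_closure)
  have [measurable]: "f \<in> borel_measurable borel" by (rule borel_measurable_continuous_onI[OF f(1)])
  show "square_integrable \<mu> (\<lambda>x. complex_of_real (f x))"
    by (rule square_integrable_bounded[OF prob_space_axioms, where b=b]) (use f(2) in auto)
  fix \<epsilon> :: real assume \<epsilon>: "\<epsilon> > 0"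
  have cf: "continuous_on (cball 0 B) f" by (rule continuous_on_subset[OF f(1)]) simp
  have "sqrt (\<epsilon> / 2) > 0" using \<epsilon> by simp
  from Stone_Weierstrass_trig[OF cf this] obtain F c
    where Fc: "finite F \<and> (\<forall>x\<in>cball 0 B. cmod (of_real (f x) - trig F c x) < sqrt (\<epsilon> / 2))"
    by (elim exE)
  then have F: "finite F" "\<And>x. x \<in> cball 0 B \<Longrightarrow> cmod (of_real (f x) - trig F c x) < sqrt (\<epsilon> / 2)"
    by simp_all
  have "L2_approx \<mu> \<Lambda> (trig F c)"
    unfolding trig_def by (intro approx_sum approx_cmult exps)
  moreover have "(\<integral>x. (cmod (of_real (f x) - trig F c x))\<^sup>2 \<partial>\<mu>) \<le> (\<integral>x. \<epsilon> / 2 \<partial>\<mu>)"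
  proof (rule integral_mono_AE)
    show "integrable \<mu> (\<lambda>x. (cmod (of_real (f x) - trig F c x))\<^sup>2)"
      using square_integrable_diff[OF \<open>square_integrable \<mu> (\<lambda>x. complex_of_real (f x))\<close> square_integrable_trig]
      by (simp add: square_integrable_def)
    show "AE x in \<mu>. (cmod (of_real (f x) - trig F c x))\<^sup>2 \<le> \<epsilon> / 2"
      using bdd
    proof eventually_elim
      case (elim x)
      have "(cmod (of_real (f x) - trig F c x))\<^sup>2 \<le> (sqrt (\<epsilon> / 2))\<^sup>2"
        using F(2)[OF elim] by (intro power_mono) auto
      then show ?case using \<epsilon> by simp
    qed
  qed simp
  then have "(\<integral>x. (cmod (of_real (f x) - trig F c x))\<^sup>2 \<partial>\<mu>) < \<epsilon>"
    using \<epsilon> by (simp add: prob_space)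
  ultimately show "\<exists>g. L2_approx \<mu> \<Lambda> g \<and> (\<integral>x. (cmod (of_real (f x) - g x))\<^sup>2 \<partial>\<mu>) < \<epsilon>"
    by blast
qed

text \<open>A Dynkin argument starting from closed sets, whose indicators are limits of plateaus.\<close>

lemma approx_indicator:
  assumes cont: "\<And>f b. continuous_on UNIV f \<Longrightarrow> (\<And>x. \<bar>f x\<bar> \<le> b) \<Longrightarrow> L2_approx \<mu> \<Lambda> (\<lambda>x. complex_of_real (f x))"
    and A: "A \<in> sets borel"
  shows "L2_approx \<mu> \<Lambda> (indicator A)"
proof -
  have "Int_stable (Collect closed :: (real^2) set set)" by (auto simp: Int_stable_def)
  moreover have "Collect closed \<subseteq> Pow (UNIV :: (real^2) set)" by auto
  moreover have "A \<in> sigma_sets UNIV (Collect closed)" using A by (simp add: borel_eq_closed)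
  ultimately show ?thesis
  proof (induction rule: sigma_sets_induct_disjoint)
    case (basic C)
    then have C: "closed C" by simp
    show ?case
    proof (cases "C = {}")
      case True
      then show ?thesis using approx_zero by (simp add: indicator_def)
    next
      case False
      show ?thesis
      proof (rule approx_dominated[where g="\<lambda>n x. complex_of_real (plateau C n x)" and h="\<lambda>_. 1"])
        show "L2_approx \<mu> \<Lambda> (\<lambda>x. complex_of_real (plateau C n x))" for n
          by (rule cont[of "plateau C n" 1, OF continuous_on_plateau])
            (simp add: abs_of_nonneg plateau_bounds)
        show "(\<lambda>n. complex_of_real (plateau C n x)) \<longlonglongrightarrow> indicator C x" for x
          using tendsto_of_real[OF plateau_tendsto_indicator[OF C False], of x] by (simp add: indicator_def of_bool_def if_distrib cong: if_cong)
      qed (use C in \<open>auto simp: abs_of_nonneg plateau_bounds\<close>)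
    qed
  next
    case empty
    show ?case using approx_zero by (simp add: indicator_def)
  next
    case (compl A)
    have one: "L2_approx \<mu> \<Lambda> (\<lambda>x. 1)" using cont[of "\<lambda>_. 1" 1] by simp
    have "L2_approx \<mu> \<Lambda> (\<lambda>x. 1 - indicator A x)" by (rule approx_diff[OF one compl(2)])
    also have "(\<lambda>x. 1 - indicator A x) = (indicator (UNIV - A) :: _ \<Rightarrow> complex)"
      by (auto simp: indicator_def fun_eq_iff)
    finally show ?case .
  next
    case (union S)
    have S: "S i \<in> sets borel" for i using union by (auto simp: borel_eq_closed)
    show ?case
    proof (rule approx_dominated[where g="\<lambda>n x. \<Sum>i<n. indicator (S i) x" and h="\<lambda>_. 1"])
      show "L2_approx \<mu> \<Lambda> (\<lambda>x. \<Sum>i<n. indicator (S i) x)" for n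
        by (rule approx_sum) (use union in auto)
      have eq: "(\<Sum>i<n. indicator (S i) x) = (indicator (\<Union>i<n. S i) x :: complex)" for n x
        using union(1) by (intro indicator_UN_disjoint[symmetric]) (auto simp: disjoint_family_on_def)
      show "cmod (\<Sum>i<n. indicator (S i) x) \<le> 1" for n x
        unfolding eq by (simp add: indicator_def)
      show "(\<lambda>n. \<Sum>i<n. indicator (S i) x) \<longlonglongrightarrow> (indicator (\<Union>(range S)) x :: complex)" for x
        unfolding eq using LIMSEQ_indicator_UN[of S x] by simp
    qed (use S in auto)
  qed
qed

lemma approx_square_integrable_all:
  assumes ind: "\<And>A. A \<in> sets borel \<Longrightarrow> L2_approx \<mu> \<Lambda> (indicator A)"
    and f: "square_integrable \<mu> f"
  shows "L2_approx \<mu> \<Lambda> f"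
proof -
  have fm: "f \<in> borel_measurable \<mu>" and fi: "integrable \<mu> (\<lambda>x. (cmod (f x))\<^sup>2)"
    using f by (auto simp: square_integrable_def)
  have sp: "space \<mu> = UNIV" using sets_eq_imp_space_eq[OF sets_eq] by simp
  obtain s where s: "\<And>i. simple_function \<mu> (s i)" "\<And>x. (\<lambda>i. s i x) \<longlonglongrightarrow> f x"
    "\<And>i x. cmod (s i x) \<le> 2 * cmod (f x)"
  proof -
    obtain F where "(\<forall>i. simple_function \<mu> (F i)) \<and> (\<forall>x\<in>space \<mu>. (\<lambda>i. F i x) \<longlonglongrightarrow> f x) \<and>
      (\<forall>i. \<forall>x\<in>space \<mu>. dist (F i x) 0 \<le> 2 * dist (f x) 0)"
      using borel_measurable_implies_sequence_metric[OF fm, of 0] by (elim exE)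
    then show ?thesis by (intro that[of F]) (simp_all add: sp)
  qed
  show ?thesis
  proof (rule approx_dominated[where g=s and h="\<lambda>x. 2 * cmod (f x)"])
    show "f \<in> borel_measurable borel" using fm by simp
    show "integrable \<mu> (\<lambda>x. (2 * cmod (f x))\<^sup>2)" using fi by (simp add: power_mult_distrib)
    show "L2_approx \<mu> \<Lambda> (s i)" for i
    proof -
      have fin: "finite (range (s i))"
        using s(1)[of i] by (simp add: simple_function_def sp)
      have "s i -` {y} \<in> sets borel" for y
        using simple_functionD(2)[OF s(1)[of i], of "{y}"] by (simp add: sp)
      then have "L2_approx \<mu> \<Lambda> (\<lambda>x. \<Sum>y\<in>range (s i). y * indicator (s i -` {y}) x)"
        by (intro approx_sum approx_cmult ind)
      moreover have "(\<Sum>y\<in>range (s i). y * indicator (s i -` {y}) x) = s i x" for x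
      proof -
        have "(\<Sum>y\<in>range (s i). y * indicator (s i -` {y}) x) = (\<Sum>y\<in>range (s i). if y = s i x then s i x else 0)"
          by (intro sum.cong) (auto simp: indicator_def)
        then show ?thesis using fin by simp
      qed
      ultimately show ?thesis by simp
    qed
  qed (rule s(2), rule s(3))
qed

text \<open>Compact support makes trigonometric polynomials dense by Stone--Weierstrass, so it is enough that all
  exponentials lie in the closed span, and Parseval's identity says that they do.\<close>

theorem spectrum_of_iff_parseval:
  assumes bdd: "AE x in \<mu>. x \<in> cball 0 B"
  shows "spectrum_of \<mu> \<Lambda> \<longleftrightarrow> countable \<Lambda> \<and> topological_space_class.discrete \<Lambda> \<and>
    orthogonal_exponentials \<mu> \<Lambda> \<and> (\<forall>\<xi>. ((\<lambda>l. (cmod (fourier \<mu> (\<xi> + l)))\<^sup>2) has_sum 1) \<Lambda>)"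
proof -
  have key: "(\<forall>f. square_integrable \<mu> f \<longrightarrow> L2_approx \<mu> \<Lambda> f) \<longleftrightarrow>
     (\<forall>\<xi>. ((\<lambda>l. (cmod (fourier \<mu> (\<xi> + l)))\<^sup>2) has_sum 1) \<Lambda>)"
    if orth: "orthogonal_exponentials \<mu> \<Lambda>"
  proof
    assume L: "\<forall>f. square_integrable \<mu> f \<longrightarrow> L2_approx \<mu> \<Lambda> f"
    have sqi: "square_integrable \<mu> (\<lambda>x. ee (\<xi> \<bullet> x))" for \<xi>
    proof (rule square_integrable_bounded[OF prob_space_axioms, where b=1])
      show "(\<lambda>x. ee (\<xi> \<bullet> x)) \<in> borel_measurable \<mu>" by measurable
    qed simp
    show "\<forall>\<xi>. ((\<lambda>l. (cmod (fourier \<mu> (\<xi> + l)))\<^sup>2) has_sum 1) \<Lambda>"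
      unfolding parseval_iff_approx_exponential[OF orth] by (intro allI L[rule_format] sqi)
  next
    assume R: "\<forall>\<xi>. ((\<lambda>l. (cmod (fourier \<mu> (\<xi> + l)))\<^sup>2) has_sum 1) \<Lambda>"
    have exps: "L2_approx \<mu> \<Lambda> (\<lambda>x. ee (\<xi> \<bullet> x))" for \<xi>
      using R[rule_format, of "- \<xi>"] parseval_iff_approx_exponential[OF orth, of "- \<xi>"] by simp
    have ind: "L2_approx \<mu> \<Lambda> (indicator A)" if "A \<in> sets borel" for A
      by (rule approx_indicator[OF _ that]) (rule approx_continuous[OF bdd exps])
    show "\<forall>f. square_integrable \<mu> f \<longrightarrow> L2_approx \<mu> \<Lambda> f"
      by (intro allI impI) (rule approx_square_integrable_all[OF ind])
  qed
  show ?thesis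
    unfolding spectrum_of_def L2_orthonormal_basis_iff by (intro conj_cong refl key)
qed

end

lemma (in moran) borel_prob_\<mu>: "borel_prob \<mu>"
  using prob_\<mu> by (simp add: borel_prob_def borel_prob_axioms_def)

section \<open>Integer vectors and digit sets of order four\<close>

definition int_vec :: "real^2 \<Rightarrow> bool" where
  "int_vec v \<longleftrightarrow> (\<forall>i. v $ i \<in> \<int>)"

definition even_vec :: "real^2 \<Rightarrow> bool" where
  "even_vec v \<longleftrightarrow> int_vec ((1/2) *\<^sub>R v)"

definition int_mat :: "real^2^2 \<Rightarrow> bool" where
  "int_mat A \<longleftrightarrow> (\<forall>i j. A $ i $ j \<in> \<int>)"

lemma int_vec_0 [simp]: "int_vec 0"
  by (simp add: int_vec_def)

lemma int_vec_add: "int_vec v \<Longrightarrow> int_vec w \<Longrightarrow> int_vec (v + w)"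
  by (simp add: int_vec_def)

lemma int_vec_diff: "int_vec v \<Longrightarrow> int_vec w \<Longrightarrow> int_vec (v - w)"
  by (simp add: int_vec_def)

lemma int_vec_minus: "int_vec v \<Longrightarrow> int_vec (- v)"
  by (simp add: int_vec_def)

lemma int_vec_minus_iff [simp]: "int_vec (- v) \<longleftrightarrow> int_vec v"
  using int_vec_minus[of v] int_vec_minus[of "- v"] by auto

lemma int_vec_scale: "a \<in> \<int> \<Longrightarrow> int_vec v \<Longrightarrow> int_vec (a *\<^sub>R v)"
  by (simp add: int_vec_def)

lemma int_vec_inner: "int_vec v \<Longrightarrow> int_vec w \<Longrightarrow> v \<bullet> w \<in> \<int>"
  by (auto simp: int_vec_def inner_vec_def intro!: Ints_sum)

lemma int_mat_mult_vec: "int_mat A \<Longrightarrow> int_vec v \<Longrightarrow> int_vec (A *v v)"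
  by (auto simp: int_vec_def int_mat_def matrix_vector_mult_def intro!: Ints_sum)

lemma int_vec_mult_mat: "int_mat A \<Longrightarrow> int_vec v \<Longrightarrow> int_vec (v v* A)"
  by (auto simp: int_vec_def int_mat_def vector_matrix_mult_def intro!: Ints_sum)

lemma int_mat_det: "int_mat A \<Longrightarrow> det A \<in> \<int>"
  by (auto simp: int_mat_def det_2)

lemma scaleR_vector_matrix: "(a *\<^sub>R v) v* A = a *\<^sub>R (v v* (A :: real^2^2))"
  by (simp add: vec_eq_iff vector_matrix_mult_def sum_distrib_left mult_ac)

lemma even_vec_0 [simp]: "even_vec 0"
  by (simp add: even_vec_def)

lemma even_vec_2: "int_vec v \<Longrightarrow> even_vec (2 *\<^sub>R v)"
  by (simp add: even_vec_def)

lemma even_vec_add: "even_vec v \<Longrightarrow> even_vec w \<Longrightarrow> even_vec (v + w)"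
  by (simp add: even_vec_def scaleR_add_right int_vec_add)

lemma even_vec_diff: "even_vec v \<Longrightarrow> even_vec w \<Longrightarrow> even_vec (v - w)"
  by (simp add: even_vec_def scaleR_diff_right int_vec_diff)

lemma even_vec_minus_iff [simp]: "even_vec (- v) \<longleftrightarrow> even_vec v"
  by (simp add: even_vec_def)

lemma even_vec_mult_mat: "int_mat A \<Longrightarrow> even_vec v \<Longrightarrow> even_vec (v v* A)"
  unfolding even_vec_def by (metis int_vec_mult_mat scaleR_vector_matrix)

lemma half_of_int_Ints_iff: "real_of_int k / 2 \<in> \<int> \<longleftrightarrow> even k"
proof
  assume "real_of_int k / 2 \<in> \<int>"
  then obtain m where "real_of_int k / 2 = of_int m" by (auto elim: Ints_cases)
  then have "real_of_int k = of_int (2 * m)" by simp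
  then have "k = 2 * m" by (simp only: of_int_eq_iff)
  then show "even k" by simp
qed (auto elim!: evenE)

lemma half_of_int_mod: "real_of_int k / 2 = of_int (k mod 2) / 2 + of_int (k div 2)"
proof -
  have "k = 2 * (k div 2) + k mod 2" by simp
  then have "real_of_int k = of_int (2 * (k div 2) + k mod 2)" by (rule arg_cong)
  also have "\<dots> = 2 * of_int (k div 2) + of_int (k mod 2)" by (simp only: of_int_add of_int_mult of_int_numeral)
  finally show ?thesis by linarith
qed

lemma int_vecE:
  assumes "int_vec v"
  obtains a b where "v $ 1 = of_int a" "v $ 2 = of_int b"
  using assms unfolding int_vec_def by (metis Ints_cases)

lemma even_vec_iff:
  assumes "v $ 1 = of_int a" "v $ 2 = of_int b"
  shows "even_vec v \<longleftrightarrow> even a \<and> even b"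
  using half_of_int_Ints_iff[of a] half_of_int_Ints_iff[of b]
  by (simp add: even_vec_def int_vec_def forall_2 assms)

definition cross :: "real^2 \<Rightarrow> real^2 \<Rightarrow> real" where
  "cross a b = a $ 1 * b $ 2 - a $ 2 * b $ 1"

text \<open>Both vectors are integral and together they form a basis modulo \<open>2\<close>.\<close>

definition odd_pair :: "real^2 \<Rightarrow> real^2 \<Rightarrow> bool" where
  "odd_pair a b \<longleftrightarrow> int_vec a \<and> int_vec b \<and> (\<exists>k::int. odd k \<and> cross a b = of_int k)"

definition digits :: "real^2 \<Rightarrow> real^2 \<Rightarrow> (real^2) set" where
  "digits a b = {0, a, b, - a - b}"

text \<open>The mask of \<open>digits a b\<close> in the coordinates \<open>s = \<xi> \<bullet> a\<close> and \<open>t = \<xi> \<bullet> b\<close>.\<close>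

definition phi :: "real \<Rightarrow> real \<Rightarrow> complex" where
  "phi s t = (1 + ee s + ee t + ee (- s - t)) / 4"

lemma odd_pairE:
  assumes "odd_pair a b"
  obtains a1 a2 b1 b2 where "a $ 1 = of_int a1" "a $ 2 = of_int a2" "b $ 1 = of_int b1" "b $ 2 = of_int b2"
    "odd (a1 * b2 - a2 * b1)"
proof -
  obtain a1 a2 b1 b2 k where e: "a $ 1 = of_int a1" "a $ 2 = of_int a2" "b $ 1 = of_int b1" "b $ 2 = of_int b2"
    "odd k" "cross a b = of_int k"
    using assms unfolding odd_pair_def by (meson int_vecE)
  then have "real_of_int (a1 * b2 - a2 * b1) = of_int k" by (simp add: cross_def)
  then have "a1 * b2 - a2 * b1 = k" by (simp only: of_int_eq_iff)
  then show ?thesis using that[OF e(1-4)] e(5) by blast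
qed

lemma cross_neq_0: "odd_pair a b \<Longrightarrow> cross a b \<noteq> 0"
  by (auto simp: odd_pair_def)

text \<open>Cramer's rule, with the pairings \<open>x \<bullet> a\<close> and \<open>x \<bullet> b\<close> as data.\<close>

lemma Cramer_1: "cross a b * x $ 1 = b $ 2 * (x \<bullet> a) - a $ 2 * (x \<bullet> b)"
  by (simp add: cross_def inner_vec_def sum_2 algebra_simps)

lemma Cramer_2: "cross a b * x $ 2 = a $ 1 * (x \<bullet> b) - b $ 1 * (x \<bullet> a)"
  by (simp add: cross_def inner_vec_def sum_2 algebra_simps)

lemma int_vec_cross_scale:
  assumes "int_vec a" "int_vec b" "x \<bullet> a \<in> \<int>" "x \<bullet> b \<in> \<int>"
  shows "int_vec (cross a b *\<^sub>R x)"
  using assms by (auto simp: int_vec_def forall_2 Cramer_1 Cramer_2)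

text \<open>The four digits represent the four residue classes modulo \<open>2\<close>.\<close>

lemma digits_neq:
  assumes "odd_pair a b" "d \<in> digits a b" "d' \<in> digits a b" "even_vec (d - d')"
  shows "d = d'"
proof -
  obtain a1 a2 b1 b2 where e: "a $ 1 = of_int a1" "a $ 2 = of_int a2" "b $ 1 = of_int b1" "b $ 2 = of_int b2"
    "odd (a1 * b2 - a2 * b1)"
    using odd_pairE[OF assms(1)] .
  have N: "\<not> even_vec v \<and> \<not> even_vec (- v)"
    if "v $ 1 = of_int m" "v $ 2 = of_int n" "odd m \<or> odd n" for v m n
    using even_vec_iff[OF that(1,2)] that(3) by simp
  have n: "\<not> even_vec a \<and> \<not> even_vec (- a)" "\<not> even_vec b \<and> \<not> even_vec (- b)"
    "\<not> even_vec (a + b) \<and> \<not> even_vec (- (a + b))" "\<not> even_vec (a - b) \<and> \<not> even_vec (- (a - b))"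
    "\<not> even_vec (a + a + b) \<and> \<not> even_vec (- (a + a + b))" "\<not> even_vec (a + b + b) \<and> \<not> even_vec (- (a + b + b))"
  proof -
    show "\<not> even_vec a \<and> \<not> even_vec (- a)" by (rule N[of _ a1 a2]) (use e in auto)
    show "\<not> even_vec b \<and> \<not> even_vec (- b)" by (rule N[of _ b1 b2]) (use e in auto)
    show "\<not> even_vec (a + b) \<and> \<not> even_vec (- (a + b))" by (rule N[of _ "a1 + b1" "a2 + b2"]) (use e in auto)
    show "\<not> even_vec (a - b) \<and> \<not> even_vec (- (a - b))" by (rule N[of _ "a1 - b1" "a2 - b2"]) (use e in auto)
    show "\<not> even_vec (a + a + b) \<and> \<not> even_vec (- (a + a + b))"
      by (rule N[of _ "a1 + a1 + b1" "a2 + a2 + b2"]) (use e in auto)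
    show "\<not> even_vec (a + b + b) \<and> \<not> even_vec (- (a + b + b))"
      by (rule N[of _ "a1 + b1 + b1" "a2 + b2 + b2"]) (use e in auto)
  qed
  have s: "0 - a = - a" "0 - b = - b" "0 - (- a - b) = a + b" "a - 0 = a" "b - 0 = b" "- a - b - 0 = - (a + b)"
    "b - a = - (a - b)" "a - (- a - b) = a + a + b" "- a - b - a = - (a + a + b)"
    "b - (- a - b) = a + b + b" "- a - b - b = - (a + b + b)"
    by (simp_all add: vec_eq_iff)
  from assms(2) have "d = 0 \<or> d = a \<or> d = b \<or> d = - a - b" by (simp add: digits_def)
  moreover from assms(3) have "d' = 0 \<or> d' = a \<or> d' = b \<or> d' = - a - b" by (simp add: digits_def)
  ultimately show ?thesis using assms(4)
    by (elim disjE) (simp_all only: s n simp_thms)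
qed

lemma card_digits:
  assumes "odd_pair a b"
  shows "card (digits a b) = 4" "a \<noteq> 0" "b \<noteq> 0" "a \<noteq> b" "- a - b \<noteq> 0" "a \<noteq> - a - b" "b \<noteq> - a - b"
proof -
  have c: "cross a b \<noteq> 0" using cross_neq_0[OF assms] .
  show 1: "a \<noteq> 0" "b \<noteq> 0" "a \<noteq> b" using c by (auto simp: cross_def)
  show 2: "- a - b \<noteq> 0"
  proof
    assume "- a - b = 0"
    then have e: "(- a - b) $ i = 0" for i by simp
    have "b $ i = - a $ i" for i using e[of i] unfolding vector_minus_component vector_uminus_component by linarith
    then show False using c by (simp add: cross_def)
  qed
  show 3: "a \<noteq> - a - b"
  proof
    assume "a = - a - b"
    then have e: "a $ i = (- a - b) $ i" for i by (rule arg_cong)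
    have "b $ i = - 2 * a $ i" for i
      using e[of i] unfolding vector_minus_component vector_uminus_component by linarith
    then show False using c by (simp add: cross_def)
  qed
  show 4: "b \<noteq> - a - b"
  proof
    assume "b = - a - b"
    then have e: "b $ i = (- a - b) $ i" for i by (rule arg_cong)
    have "a $ i = - 2 * b $ i" for i
      using e[of i] unfolding vector_minus_component vector_uminus_component by linarith
    then show False using c by (simp add: cross_def)
  qed
  show "card (digits a b) = 4"
    using 1 2 3 4 by (simp add: digits_def eq_commute[of 0])
qed

text \<open>An odd pair is invertible modulo \<open>2\<close>, so parity can be tested by pairing with it.\<close>

lemma even_vec_iff_inner:
  assumes ab: "odd_pair a b" and v: "int_vec v"
  shows "even_vec v \<longleftrightarrow> (v \<bullet> a) / 2 \<in> \<int> \<and> (v \<bullet> b) / 2 \<in> \<int>"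
proof
  assume "even_vec v"
  then show "(v \<bullet> a) / 2 \<in> \<int> \<and> (v \<bullet> b) / 2 \<in> \<int>"
    using ab int_vec_inner[of "(1/2) *\<^sub>R v"] unfolding even_vec_def odd_pair_def by simp
next
  assume h: "(v \<bullet> a) / 2 \<in> \<int> \<and> (v \<bullet> b) / 2 \<in> \<int>"
  obtain k :: int where k: "odd k" "cross a b = of_int k" using ab by (auto simp: odd_pair_def)
  have "int_vec (cross a b *\<^sub>R ((1/2) *\<^sub>R v))"
    using ab h by (intro int_vec_cross_scale) (auto simp: odd_pair_def)
  then have kv: "int_vec (of_int k *\<^sub>R ((1/2) *\<^sub>R v))" by (simp add: k)
  obtain m n where mn: "v $ 1 = of_int m" "v $ 2 = of_int n" using int_vecE[OF v] .
  have "real_of_int (k * m) / 2 \<in> \<int>" "real_of_int (k * n) / 2 \<in> \<int>"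
    using kv mn by (simp_all add: int_vec_def forall_2)
  then have "even (k * m)" "even (k * n)" by (simp_all only: half_of_int_Ints_iff)
  then show "even_vec v" using k(1) by (simp add: even_vec_iff[OF mn])
qed

lemma sum_digits:
  assumes "odd_pair a b"
  shows "(\<Sum>d\<in>digits a b. f d) = f 0 + f a + f b + f (- a - b)"
  using card_digits[OF assms] by (simp add: digits_def eq_commute[of 0] add.assoc)

lemma finite_digits [simp]: "finite (digits a b)"
  by (simp add: digits_def)

lemma digits_nonempty [simp]: "digits a b \<noteq> {}"
  by (simp add: digits_def)

lemma int_vec_digits: "odd_pair a b \<Longrightarrow> d \<in> digits a b \<Longrightarrow> int_vec d"
  unfolding digits_def odd_pair_def by (auto intro!: int_vec_diff int_vec_minus)

lemma mask_digits:
  assumes "odd_pair a b"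
  shows "mask (digits a b) \<xi> = phi (\<xi> \<bullet> a) (\<xi> \<bullet> b)"
  by (simp add: mask_def card_digits[OF assms] sum_digits[OF assms] phi_def inner_diff_right)

lemma phi_periodic:
  assumes "m \<in> \<int>" "n \<in> \<int>"
  shows "phi (s + m) (t + n) = phi s t"
proof -
  have "- (s + m) - (t + n) = (- s - t) + (- m - n)" by simp
  moreover have "ee (- m - n) = 1" using assms by (intro ee_Ints) auto
  ultimately show ?thesis
    using assms by (simp only: phi_def ee_add ee_Ints mult_1_right)
qed

text \<open>Four unit numbers with sum zero form two antipodal pairs; if one of them is \<open>1\<close> and their product is \<open>1\<close>,
  they are \<open>1, 1, -1, -1\<close>.\<close>

lemma phi_eq_0D:
  assumes "phi s t = 0"
  shows "2 * s \<in> \<int> \<and> 2 * t \<in> \<int>"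
proof -
  define x y where "x = ee s" and "y = ee t"
  have x: "x * cnj x = 1" and y: "y * cnj y = 1"
    by (simp_all add: x_def y_def complex_norm_square[symmetric])
  have st: "ee (- s - t) = cnj x * cnj y"
    using ee_add[of "-s" "-t"] by (simp add: x_def y_def ee_minus)
  have 1: "1 + x + y + cnj x * cnj y = 0"
    using assms by (simp add: phi_def st x_def y_def)
  have 2: "1 + cnj x + cnj y + x * y = 0"
    using arg_cong[OF 1, of cnj] by simp
  \<comment> \<open>Multiplication by \<open>x y\<close> turns the equation and its conjugate into polynomial equations.\<close>
  have p1: "x * y + x * y * (x + y) + 1 = 0"
  proof -
    have "x * y * (1 + x + y + cnj x * cnj y) = x * y + x * y * (x + y) + (x * cnj x) * (y * cnj y)"
      by (simp add: algebra_simps)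
    then show ?thesis using 1 x y by simp
  qed
  have p2: "x * y + y + x + (x * y)\<^sup>2 = 0"
  proof -
    have "x * y * (1 + cnj x + cnj y + x * y) = x * y + (x * cnj x) * y + (y * cnj y) * x + (x * y)\<^sup>2"
      by (simp add: algebra_simps power2_eq_square)
    then show ?thesis using 2 x y by simp
  qed
  define p where "p = x * y"
  have s: "x + y = - p - p\<^sup>2"
  proof -
    have "x + y + p + p\<^sup>2 = 0" using p2 by (simp add: p_def add_ac)
    moreover have "x + y = (x + y + p + p\<^sup>2) - p - p\<^sup>2" by simp
    ultimately show ?thesis by simp
  qed
  have "p + p * (- p - p\<^sup>2) + 1 = 0" using p1 unfolding p_def[symmetric] s .
  moreover have "(1 + p) * ((1 + p) * (1 - p)) = p + p * (- p - p\<^sup>2) + 1"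
    by (simp add: algebra_simps power2_eq_square)
  ultimately have "(1 + p) * ((1 + p) * (1 - p)) = 0" by simp
  then consider "1 + p = 0" | "1 - p = 0" by auto
  then have "x\<^sup>2 = 1 \<and> y\<^sup>2 = 1"
  proof cases
    case 1
    moreover have "p = (1 + p) - 1" by simp
    ultimately have p: "p = - 1" by simp
    have "y = (x + y) - x" by simp
    then have "y = - x" unfolding s p by simp
    then show ?thesis using p by (simp add: p_def power2_eq_square)
  next
    case 2
    then have p: "p = 1" by simp
    have "y = (x + y) - x" by simp
    then have y: "y = - 2 - x" unfolding s p by simp
    have "(x + 1)\<^sup>2 = 1 - x * (- 2 - x)" by (simp add: power2_eq_square algebra_simps)
    also have "x * (- 2 - x) = 1" using p unfolding p_def y .
    finally have "x + 1 = 0" by simp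
    moreover have "x = (x + 1) - 1" by simp
    ultimately have "x = - 1" by simp
    then show ?thesis using y by simp
  qed
  then have "ee (2 * s) = 1" "ee (2 * t) = 1"
    unfolding x_def y_def by (metis ee_add mult_2 power2_eq_square)+
  then show ?thesis by (simp add: ee_eq_1_iff)
qed

lemma ee_half: "ee (1/2) = -1"
  by (simp add: ee_cis)

lemma phi_eq_0I:
  assumes "2 * s \<in> \<int>" "2 * t \<in> \<int>" "\<not> (s \<in> \<int> \<and> t \<in> \<int>)"
  shows "phi s t = 0"
proof -
  obtain k l :: int where kl: "s = of_int k / 2" "t = of_int l / 2"
    using assms(1,2) by (metis Ints_cases nonzero_mult_div_cancel_left zero_neq_numeral)
  have e: "ee (of_int m / 2) = (if even m then 1 else -1)" for m :: int
  proof (cases "even m")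
    case True
    then show ?thesis by (auto intro!: ee_Ints simp: half_of_int_Ints_iff)
  next
    case False
    then obtain n where "m = 2 * n + 1" by (auto elim: oddE)
    then have eq: "real_of_int m / 2 = of_int n + 1/2" by simp
    have "ee (of_int m / 2) = - 1"
      unfolding eq by (simp only: ee_add ee_Ints[OF Ints_of_int] ee_half mult_1)
    then show ?thesis using False by simp
  qed
  have eq: "- s - t = of_int (- k - l) / 2" by (simp add: kl)
  have "ee (- s - t) = (if even (k + l) then 1 else -1)" unfolding eq e by simp
  moreover have "odd k \<or> odd l" using assms(3) by (auto simp: kl half_of_int_Ints_iff)
  ultimately show ?thesis using e[of k] e[of l] by (auto simp: phi_def kl split: if_splits)
qed

lemma phi_Ints: "s \<in> \<int> \<Longrightarrow> t \<in> \<int> \<Longrightarrow> phi s t = 1"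
  by (simp add: phi_def ee_Ints)

lemma phi_eq_0_iff: "phi s t = 0 \<longleftrightarrow> 2 * s \<in> \<int> \<and> 2 * t \<in> \<int> \<and> \<not> (s \<in> \<int> \<and> t \<in> \<int>)"
  using phi_eq_0D[of s t] phi_eq_0I[of s t] phi_Ints[of s t] by auto

text \<open>Shifting \<open>s\<close> and \<open>t\<close> by halves multiplies the four terms by the characters of a group of order four, so this is
  Parseval's identity on that group.\<close>

lemma sum_phi_half:
  "(cmod (phi s t))\<^sup>2 + (cmod (phi (s + 1/2) t))\<^sup>2 + (cmod (phi s (t + 1/2)))\<^sup>2
    + (cmod (phi (s + 1/2) (t + 1/2)))\<^sup>2 = 1"
proof -
  define x y z where "x = ee s" and "y = ee t" and "z = ee (- s - t)"
  have n: "x * cnj x = 1" "y * cnj y = 1" "z * cnj z = 1"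
    by (simp_all add: x_def y_def z_def complex_norm_square[symmetric])
  have h: "ee (u + 1/2) = - ee u" for u by (simp add: ee_add ee_half)
  have h': "ee (u - 1/2) = - ee u" for u using h[of "u - 1/2"] by simp
  have a: "- (s + 1/2) - t = (- s - t) - 1/2" "- s - (t + 1/2) = (- s - t) - 1/2"
    "- (s + 1/2) - (t + 1/2) = ((- s - t) - 1/2) - 1/2" by simp_all
  have p: "phi s t = (1 + x + y + z) / 4" "phi (s + 1/2) t = (1 - x + y - z) / 4"
    "phi s (t + 1/2) = (1 + x - y - z) / 4" "phi (s + 1/2) (t + 1/2) = (1 - x - y + z) / 4"
    unfolding phi_def a h h' by (simp_all add: x_def y_def z_def)
  have "complex_of_real ((cmod (1 + x + y + z))\<^sup>2 + (cmod (1 - x + y - z))\<^sup>2 + (cmod (1 + x - y - z))\<^sup>2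
    + (cmod (1 - x - y + z))\<^sup>2) = 4 + 4 * (x * cnj x) + 4 * (y * cnj y) + 4 * (z * cnj z)"
    unfolding of_real_add complex_norm_square by (simp add: algebra_simps)
  also have "\<dots> = complex_of_real 16" using n by simp
  finally have "(cmod (1 + x + y + z))\<^sup>2 + (cmod (1 - x + y - z))\<^sup>2 + (cmod (1 + x - y - z))\<^sup>2
    + (cmod (1 - x - y + z))\<^sup>2 = 16" by (simp only: of_real_eq_iff)
  then show ?thesis unfolding p by (simp add: norm_divide power_divide)
qed

section \<open>Necessity of even expansions\<close>

text \<open>One weighted sum over all classes equals \<open>1\<close>, and no choice of one class per group exceeds \<open>1\<close>.  Compare
  with the choice \<open>\<tau>\<close> of a largest class in each group: the weighted mean in a group is below the maximum by at least
  \<open>w g (\<sigma> g)\<close> times the defect of \<open>\<sigma>\<close> in that group, and there is no room for a positive defect.\<close>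

lemma weighted_max_choice:
  fixes q w :: "'g \<Rightarrow> 'p \<Rightarrow> real"
  assumes fin: "finite G" "finite P"
    and q0: "\<And>g p. g \<in> G \<Longrightarrow> p \<in> P \<Longrightarrow> 0 \<le> q g p"
    and w0: "\<And>g p. g \<in> G \<Longrightarrow> p \<in> P \<Longrightarrow> 0 \<le> w g p"
    and w1: "\<And>g. g \<in> G \<Longrightarrow> (\<Sum>p\<in>P. w g p) = 1"
    and tot: "(\<Sum>g\<in>G. \<Sum>p\<in>P. w g p * q g p) = 1"
    and le: "\<And>\<tau>. (\<And>g. g \<in> G \<Longrightarrow> \<tau> g \<in> P) \<Longrightarrow> (\<Sum>g\<in>G. q g (\<tau> g)) \<le> 1"
    and \<sigma>: "\<And>g. g \<in> G \<Longrightarrow> \<sigma> g \<in> P" "\<And>g. g \<in> G \<Longrightarrow> w g (\<sigma> g) > 0"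
  shows "(\<Sum>g\<in>G. q g (\<sigma> g)) = 1"
proof -
  have "\<exists>p\<in>P. \<forall>p'\<in>P. q g p' \<le> q g p" if "g \<in> G" for g
  proof -
    have "Max (q g ` P) \<in> q g ` P" using fin \<sigma>(1)[OF that] by (intro Max_in) auto
    then obtain p where "p \<in> P" "q g p = Max (q g ` P)" by auto
    then show ?thesis using fin by (intro bexI[of _ p]) auto
  qed
  then obtain \<tau> where \<tau>: "\<And>g. g \<in> G \<Longrightarrow> \<tau> g \<in> P" "\<And>g p. g \<in> G \<Longrightarrow> p \<in> P \<Longrightarrow> q g p \<le> q g (\<tau> g)"
    by metis
  have loc: "(\<Sum>p\<in>P. w g p * q g p) + w g (\<sigma> g) * (q g (\<tau> g) - q g (\<sigma> g)) \<le> q g (\<tau> g)" if g: "g \<in> G" for g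
  proof -
    have "w g (\<sigma> g) * (q g (\<tau> g) - q g (\<sigma> g)) \<le> (\<Sum>p\<in>P. w g p * (q g (\<tau> g) - q g p))"
      using fin \<sigma>(1)[OF g] w0[OF g] \<tau>(2)[OF g]
      by (intro member_le_sum[of "\<sigma> g" P "\<lambda>p. w g p * (q g (\<tau> g) - q g p)"]) auto
    also have "\<dots> = q g (\<tau> g) - (\<Sum>p\<in>P. w g p * q g p)"
      using w1[OF g] by (simp add: right_diff_distrib sum_subtractf sum_distrib_right[symmetric])
    finally show ?thesis by simp
  qed
  have "1 + (\<Sum>g\<in>G. w g (\<sigma> g) * (q g (\<tau> g) - q g (\<sigma> g))) \<le> (\<Sum>g\<in>G. q g (\<tau> g))"
  proof -
    have "(\<Sum>g\<in>G. (\<Sum>p\<in>P. w g p * q g p) + w g (\<sigma> g) * (q g (\<tau> g) - q g (\<sigma> g))) \<le> (\<Sum>g\<in>G. q g (\<tau> g))"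
      by (rule sum_mono) (rule loc)
    then show ?thesis by (simp only: sum.distrib tot)
  qed
  moreover have le1: "(\<Sum>g\<in>G. q g (\<tau> g)) \<le> 1" by (rule le) (rule \<tau>(1))
  moreover have nn: "0 \<le> w g (\<sigma> g) * (q g (\<tau> g) - q g (\<sigma> g))" if "g \<in> G" for g
    using w0[OF that \<sigma>(1)[OF that]] \<tau>(2)[OF that \<sigma>(1)[OF that]] by simp
  moreover have "0 \<le> (\<Sum>g\<in>G. w g (\<sigma> g) * (q g (\<tau> g) - q g (\<sigma> g)))" by (rule sum_nonneg) (rule nn)
  ultimately have z: "(\<Sum>g\<in>G. w g (\<sigma> g) * (q g (\<tau> g) - q g (\<sigma> g))) = 0" "(\<Sum>g\<in>G. q g (\<tau> g)) = 1" by linarith+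
  have "q g (\<sigma> g) = q g (\<tau> g)" if "g \<in> G" for g
  proof -
    have "w g (\<sigma> g) * (q g (\<tau> g) - q g (\<sigma> g)) = 0"
      using z(1) that nn fin(1) by (subst (asm) sum_nonneg_eq_0_iff) auto
    then show ?thesis using \<sigma>(2)[OF that] by simp
  qed
  then show ?thesis using z(2) by simp
qed

text \<open>Spectrality with a countable set of exceptional points.  The exceptional points arise where weights vanish in
  \<open>parseval_ae_step\<close>; allowing them makes the property pass from a measure to its tails without a continuity argument.\<close>

definition parseval_ae :: "(real^2) measure \<Rightarrow> (real^2) set \<Rightarrow> bool" where
  "parseval_ae \<mu> \<Lambda> \<longleftrightarrow> countable \<Lambda> \<and> orthogonal_exponentials \<mu> \<Lambda> \<and>
    (\<exists>N. countable N \<and> (\<forall>\<xi>. \<xi> \<notin> N \<longrightarrow> ((\<lambda>l. (cmod (fourier \<mu> (\<xi> + l)))\<^sup>2) has_sum 1) \<Lambda>))"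

lemma countable_half_lattice:
  assumes "odd_pair a b"
  shows "countable {x. 2 * (x \<bullet> a) \<in> \<int> \<and> 2 * (x \<bullet> b) \<in> \<int>}"
proof -
  let ?S = "{x. 2 * (x \<bullet> a) \<in> \<int> \<and> 2 * (x \<bullet> b) \<in> \<int>}"
  have "inj_on (\<lambda>x. (\<lfloor>2 * (x \<bullet> a)\<rfloor>, \<lfloor>2 * (x \<bullet> b)\<rfloor>)) ?S"
  proof (rule inj_onI)
    fix x y assume x: "x \<in> ?S" and y: "y \<in> ?S"
      and eq: "(\<lfloor>2 * (x \<bullet> a)\<rfloor>, \<lfloor>2 * (x \<bullet> b)\<rfloor>) = (\<lfloor>2 * (y \<bullet> a)\<rfloor>, \<lfloor>2 * (y \<bullet> b)\<rfloor>)"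
    have e: "x \<bullet> a = y \<bullet> a" "x \<bullet> b = y \<bullet> b"
      using x y eq by (auto elim!: Ints_cases)
    then have "cross a b * x $ 1 = cross a b * y $ 1" "cross a b * x $ 2 = cross a b * y $ 2"
      by (simp_all add: Cramer_1 Cramer_2)
    then show "x = y" using cross_neq_0[OF assms] by (simp add: vec_eq_iff forall_2)
  qed
  then show ?thesis by (rule countable_image_inj_on[rotated]) simp
qed

text \<open>The number \<open>c\<close> clears the denominators of all inverses of generator matrices at once, and it is odd, so that
  multiplication by \<open>c\<close> does not change parities.\<close>

locale moran_digits = moran M D r R for M D r R +
  fixes \<alpha> \<beta> :: "nat \<Rightarrow> real^2" and c :: int
  assumes int_M: "\<And>n. n \<ge> 1 \<Longrightarrow> int_mat (M n)"
    and odd_pair: "\<And>n. n \<ge> 1 \<Longrightarrow> odd_pair (\<alpha> n) (\<beta> n)"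
    and D_digits: "\<And>n. n \<ge> 1 \<Longrightarrow> D n = digits (\<alpha> n) (\<beta> n)"
    and odd_c: "odd c" and c_pos: "c > 0"
    and cross_dvd: "\<And>n. n \<ge> 1 \<Longrightarrow> \<exists>k::int. of_int c = of_int k * cross (\<alpha> n) (\<beta> n)"
begin

lemma shift_digits:
  "moran_digits (\<lambda>n. M (n + k)) (\<lambda>n. D (n + k)) r R (\<lambda>n. \<alpha> (n + k)) (\<lambda>n. \<beta> (n + k)) c"
proof -
  interpret s: moran "\<lambda>n. M (n + k)" "\<lambda>n. D (n + k)" r R by (rule shift)
  show ?thesis
    by unfold_locales (auto intro!: int_M odd_pair D_digits odd_c c_pos cross_dvd)
qed

lemma mult_inv_M: "n \<ge> 1 \<Longrightarrow> (x v* matrix_inv (M n)) v* M n = x"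
  using matrix_inv_mult[OF inv_M, of n] by (simp add: vector_matrix_mul_assoc)

lemma mult_M_inv: "n \<ge> 1 \<Longrightarrow> (x v* M n) v* matrix_inv (M n) = x"
  using matrix_inv_mult[OF inv_M, of n] by (simp add: vector_matrix_mul_assoc)

lemma int_vec_inv_prodD: "int_vec (a *\<^sub>R (y v* inv_prod M k)) \<Longrightarrow> int_vec (a *\<^sub>R y)"
proof (induction k)
  case (Suc k)
  have "int_vec ((a *\<^sub>R (y v* inv_prod M (Suc k))) v* M (Suc k))"
    using Suc.prems by (intro int_vec_mult_mat int_M) auto
  also have "(a *\<^sub>R (y v* inv_prod M (Suc k))) v* M (Suc k) = a *\<^sub>R (y v* inv_prod M k)"
    by (simp add: scaleR_vector_matrix vector_matrix_mul_assoc[symmetric] mult_inv_M)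
  finally show ?case by (rule Suc.IH)
qed simp

text \<open>A zero comes from a factor \<open>j\<close>; there \<open>2 c\<close> times the argument is integral, and multiplying by the
  integral matrices \<open>M\<^sub>j, \<dots>, M\<^sub>2\<close> leads back to level one.\<close>

lemma fourier_zero_lattice:
  assumes "fourier \<mu> \<xi> = 0"
  shows "int_vec ((2 * of_int c) *\<^sub>R (\<xi> v* matrix_inv (M 1)))"
proof -
  obtain j where j: "j \<ge> 1" "mask (D j) (\<xi> v* inv_prod M j) = 0"
    using fourier_eq_0D[OF assms] by blast
  define z where "z = \<xi> v* inv_prod M j"
  have "phi (z \<bullet> \<alpha> j) (z \<bullet> \<beta> j) = 0"
    using j by (simp add: D_digits mask_digits odd_pair z_def)
  then have "2 * (z \<bullet> \<alpha> j) \<in> \<int>" "2 * (z \<bullet> \<beta> j) \<in> \<int>" by (auto dest: phi_eq_0D)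
  then have 1: "int_vec (cross (\<alpha> j) (\<beta> j) *\<^sub>R (2 *\<^sub>R z))"
    using odd_pair[OF j(1)] by (intro int_vec_cross_scale) (auto simp: odd_pair_def)
  obtain k :: int where "of_int c = of_int k * cross (\<alpha> j) (\<beta> j)" using cross_dvd[OF j(1)] by blast
  then have "(2 * of_int c) *\<^sub>R z = of_int k *\<^sub>R (cross (\<alpha> j) (\<beta> j) *\<^sub>R (2 *\<^sub>R z))" by simp
  then have 2: "int_vec ((2 * of_int c) *\<^sub>R z)" using 1 by (simp only: int_vec_scale Ints_of_int)
  interpret s: moran_digits "\<lambda>n. M (n + 1)" "\<lambda>n. D (n + 1)" r R "\<lambda>n. \<alpha> (n + 1)" "\<lambda>n. \<beta> (n + 1)" c
    by (rule shift_digits)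
  have "z = (\<xi> v* matrix_inv (M 1)) v* inv_prod (\<lambda>n. M (n + 1)) (j - 1)"
    using j(1) inv_prod_add[of M 1 "j - 1"] by (simp add: z_def vector_matrix_mul_assoc)
  then show ?thesis using 2 s.int_vec_inv_prodD by metis
qed

abbreviation "\<mu>1 \<equiv> moran_measure (\<lambda>n. M (n + 1)) (\<lambda>n. D (n + 1))"

lemma fourier_split_first: "fourier \<mu> \<xi> =
    phi ((\<xi> v* matrix_inv (M 1)) \<bullet> \<alpha> 1) ((\<xi> v* matrix_inv (M 1)) \<bullet> \<beta> 1) * fourier \<mu>1 (\<xi> v* matrix_inv (M 1))"
  using fourier_split_1[of \<xi>] by (simp add: D_digits mask_digits odd_pair)

text \<open>Each choice of one class per coset is orthogonal for the tail, and \<open>weighted_max_choice\<close> shows that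
  wherever the weights do not vanish every choice reaches the Parseval sum \<open>1\<close>; choosing by the parity of \<open>2 c y - s\<close> gives the set in the statement.\<close>

lemma parseval_ae_step:
  assumes \<Lambda>: "parseval_ae \<mu> \<Lambda>" "0 \<in> \<Lambda>" and s: "int_vec s"
  defines "Y \<equiv> (\<lambda>l. l v* matrix_inv (M 1)) ` \<Lambda>"
  shows "parseval_ae \<mu>1 {y \<in> Y. even_vec ((2 * of_int c) *\<^sub>R y - s)}"
    and "\<And>y. y \<in> Y \<Longrightarrow> int_vec ((2 * of_int c) *\<^sub>R y)"
proof -
  let ?A = "matrix_inv (M 1)" and ?a = "\<alpha> 1" and ?b = "\<beta> 1"
  interpret \<mu>1: moran "\<lambda>n. M (n + 1)" "\<lambda>n. D (n + 1)" r R by (rule shift)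
  interpret \<mu>1: borel_prob \<mu>1 by (rule \<mu>1.borel_prob_\<mu>)
  have ab: "odd_pair ?a ?b" by (simp add: odd_pair)
  have iab: "int_vec ?a" "int_vec ?b" using ab by (auto simp: odd_pair_def)
  have cnt: "countable \<Lambda>" and orth: "orthogonal_exponentials \<mu> \<Lambda>" using \<Lambda> by (auto simp: parseval_ae_def)
  obtain N where N: "countable N" "\<And>\<xi>. \<xi> \<notin> N \<Longrightarrow> ((\<lambda>l. (cmod (fourier \<mu> (\<xi> + l)))\<^sup>2) has_sum 1) \<Lambda>"
    using \<Lambda> by (auto simp: parseval_ae_def)
  have inj: "inj_on (\<lambda>l. l v* ?A) \<Lambda>" by (rule inj_on_inverseI[of _ "\<lambda>y. y v* M 1"]) (simp add: mult_inv_M)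
  have cntY: "countable Y" using cnt by (simp add: Y_def)
  show intY: "int_vec ((2 * of_int c) *\<^sub>R y)" if "y \<in> Y" for y
  proof -
    obtain l where l: "l \<in> \<Lambda>" "y = l v* ?A" using \<open>y \<in> Y\<close> by (auto simp: Y_def)
    show ?thesis
    proof (cases "l = 0")
      case True
      then show ?thesis using l by simp
    next
      case False
      then have "fourier \<mu> (l - 0) = 0" using orth \<Lambda>(2) l(1) unfolding orthogonal_exponentials_def by blast
      then show ?thesis using fourier_zero_lattice[of l] l by simp
    qed
  qed
  have orthY: "fourier \<mu>1 (y - y') = 0"
    if yy: "y \<in> Y" "y' \<in> Y" "y \<noteq> y'" "phi ((y - y') \<bullet> ?a) ((y - y') \<bullet> ?b) \<noteq> 0" for y y'
  proof -
    obtain l l' where l: "l \<in> \<Lambda>" "y = l v* ?A" "l' \<in> \<Lambda>" "y' = l' v* ?A" using yy(1,2) by (auto simp: Y_def)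
    have "l \<noteq> l'" using yy(3) l by auto
    then have "fourier \<mu> (l - l') = 0" using orth l unfolding orthogonal_exponentials_def by blast
    moreover have "(l - l') v* ?A = y - y'" using l by (simp add: vector_matrix_mult_diff_distrib)
    ultimately show ?thesis using fourier_split_first[of "l - l'"] yy(4) by simp
  qed
  define S where "S = {y \<in> Y. even_vec ((2 * of_int c) *\<^sub>R y - s)}"
  have orthS: "orthogonal_exponentials \<mu>1 S"
    unfolding orthogonal_exponentials_def
  proof (intro ballI impI)
    fix y y' assume y: "y \<in> S" "y' \<in> S" "y \<noteq> y'"
    have "even_vec (((2 * of_int c) *\<^sub>R y - s) - ((2 * of_int c) *\<^sub>R y' - s))"
      by (rule even_vec_diff) (use y in \<open>simp_all add: S_def\<close>)
    also have "((2 * of_int c) *\<^sub>R y - s) - ((2 * of_int c) *\<^sub>R y' - s) = (2 * of_int c) *\<^sub>R (y - y')"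
      by (simp add: algebra_simps)
    finally have cz: "int_vec (of_int c *\<^sub>R (y - y'))" by (simp add: even_vec_def)
    have half: "u \<in> \<int>" if "2 * u \<in> \<int>" "of_int c * u \<in> \<int>" for u :: real
    proof -
      obtain k where k: "2 * u = of_int k" using \<open>2 * u \<in> \<int>\<close> by (auto elim: Ints_cases)
      have "of_int c * u = of_int (c * k) / 2" using k by simp
      then have "even (c * k)" using \<open>of_int c * u \<in> \<int>\<close> half_of_int_Ints_iff by metis
      then have "even k" using odd_c by simp
      moreover have "u = of_int k / 2" using k by simp
      ultimately show ?thesis using half_of_int_Ints_iff by metis
    qed
    have "of_int c * ((y - y') \<bullet> v) \<in> \<int>" if "int_vec v" for v
      using int_vec_inner[OF cz that] by simp
    then have "phi ((y - y') \<bullet> ?a) ((y - y') \<bullet> ?b) \<noteq> 0"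
      using half iab unfolding phi_eq_0_iff by blast
    then show "fourier \<mu>1 (y - y') = 0" using y by (intro orthY) (auto simp: S_def)
  qed
  \<comment> \<open>\<open>\<gamma>\<close> labels the cosets of the half lattice \<open>{z. 2 (z \<bullet> a) \<in> \<int> \<and> 2 (z \<bullet> b) \<in> \<int>}\<close>, \<open>\<rho>\<close> picks a point of \<open>Y\<close> in
    each of them, and the parities of \<open>ka\<close> and \<open>kb\<close> tell the four classes of a coset apart.\<close>
  define \<gamma> where "\<gamma> y = (frac (2 * (y \<bullet> ?a)), frac (2 * (y \<bullet> ?b)))" for y
  define G where "G = \<gamma> ` Y"
  define \<rho> where "\<rho> g = (SOME y. y \<in> Y \<and> \<gamma> y = g)" for g
  define P where "P = {0, 1 :: int} \<times> {0, 1 :: int}"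
  define ka where "ka y = \<lfloor>2 * ((y - \<rho> (\<gamma> y)) \<bullet> ?a)\<rfloor>" for y
  define kb where "kb y = \<lfloor>2 * ((y - \<rho> (\<gamma> y)) \<bullet> ?b)\<rfloor>" for y
  define cell where "cell g p = {y \<in> Y. \<gamma> y = g \<and> ka y mod 2 = fst p \<and> kb y mod 2 = snd p}" for g p
  have \<rho>: "\<rho> g \<in> Y" "\<gamma> (\<rho> g) = g" if "g \<in> G" for g
  proof -
    have "\<exists>y. y \<in> Y \<and> \<gamma> y = g" using that by (auto simp: G_def)
    then have "\<rho> g \<in> Y \<and> \<gamma> (\<rho> g) = g" unfolding \<rho>_def by (rule someI_ex)
    then show "\<rho> g \<in> Y" "\<gamma> (\<rho> g) = g" by auto
  qed
  have frac_eqD: "u - v \<in> \<int>" if "frac u = frac v" for u v :: real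
    using that unfolding frac_def by (metis Ints_diff Ints_of_int add_diff_cancel_left' diff_add_cancel diff_diff_eq2 diff_eq_eq)
  have frac_eqI: "frac u = frac v" if "u - v \<in> \<int>" for u v :: real
    using that frac_add_int_right[of "u - v" v] by (simp add: add.commute)
  have same: "\<gamma> y = \<gamma> y' \<longleftrightarrow> 2 * ((y - y') \<bullet> ?a) \<in> \<int> \<and> 2 * ((y - y') \<bullet> ?b) \<in> \<int>" for y y'
  proof -
    have "frac (2 * (y \<bullet> v)) = frac (2 * (y' \<bullet> v)) \<longleftrightarrow> 2 * ((y - y') \<bullet> v) \<in> \<int>" for v
      using frac_eqD[of "2 * (y \<bullet> v)" "2 * (y' \<bullet> v)"] frac_eqI[of "2 * (y \<bullet> v)" "2 * (y' \<bullet> v)"]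
      by (auto simp: inner_diff_left right_diff_distrib)
    then show ?thesis by (simp add: \<gamma>_def)
  qed
  have kab: "2 * ((y - \<rho> (\<gamma> y)) \<bullet> ?a) = of_int (ka y)" "2 * ((y - \<rho> (\<gamma> y)) \<bullet> ?b) = of_int (kb y)"
    if "y \<in> Y" for y
    using same[of y "\<rho> (\<gamma> y)"] \<rho>(2)[of "\<gamma> y"] that by (auto simp: ka_def kb_def G_def)
  have finP: "finite P" by (simp add: P_def)
  have finG: "finite G"
  proof -
    have *: "frac (2 * (y \<bullet> v)) \<in> (\<lambda>i. frac (of_int i / of_int c)) ` {0..<c}" if "y \<in> Y" "int_vec v" for y v
    proof -
      have "of_int c * (2 * (y \<bullet> v)) \<in> \<int>"
        using int_vec_inner[OF intY[OF that(1)] that(2)] by (simp add: mult_ac)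
      then obtain m where m: "of_int c * (2 * (y \<bullet> v)) = of_int m" by (auto elim: Ints_cases)
      then have e: "2 * (y \<bullet> v) = of_int m / of_int c" using c_pos by (simp add: field_simps)
      have "m = c * (m div c) + m mod c" by simp
      then have "real_of_int m = of_int c * of_int (m div c) + of_int (m mod c)" by (metis of_int_add of_int_mult)
      then have "of_int m / of_int c - of_int (m mod c) / of_int c = (of_int (m div c) :: real)"
        using c_pos by (simp add: field_simps)
      then have "frac (2 * (y \<bullet> v)) = frac (of_int (m mod c) / of_int c)"
        unfolding e by (intro frac_eqI) simp
      then show ?thesis using c_pos by auto
    qed
    have "G \<subseteq> ((\<lambda>i. frac (of_int i / of_int c)) ` {0..<c}) \<times> ((\<lambda>i. frac (of_int i / of_int c)) ` {0..<c})"
      unfolding G_def \<gamma>_def using * iab by auto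
    then show ?thesis by (rule finite_subset) auto
  qed
  have cellY: "cell g p \<subseteq> Y" for g p by (auto simp: cell_def)
  have cell_disj: "cell g p \<inter> cell g' p' = {}" if "(g, p) \<noteq> (g', p')" for g p g' p'
    using that by (auto simp: cell_def prod_eq_iff)
  have Y_cells: "Y = (\<Union>x\<in>G \<times> P. cell (fst x) (snd x))"
    by (auto simp: cell_def G_def P_def)
  \<comment> \<open>Two points of different cosets, or of the same class, differ by a point where the first mask is not zero.\<close>
  have orth_choice: "orthogonal_exponentials \<mu>1 (\<Union>g\<in>G. cell g (\<tau> g))" for \<tau>
    unfolding orthogonal_exponentials_def
  proof (intro ballI impI)
    fix y y' assume y: "y \<in> (\<Union>g\<in>G. cell g (\<tau> g))" "y' \<in> (\<Union>g\<in>G. cell g (\<tau> g))" "y \<noteq> y'"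
    have "(\<Union>g\<in>G. cell g (\<tau> g)) \<subseteq> Y" using cellY by (intro UN_least)
    from subsetD[OF this y(1)] subsetD[OF this y(2)] have yY: "y \<in> Y" "y' \<in> Y" .
    have "phi ((y - y') \<bullet> ?a) ((y - y') \<bullet> ?b) \<noteq> 0"
    proof
      assume ph: "phi ((y - y') \<bullet> ?a) ((y - y') \<bullet> ?b) = 0"
      then have g: "\<gamma> y = \<gamma> y'" using phi_eq_0D same by blast
      then have k: "ka y mod 2 = ka y' mod 2" "kb y mod 2 = kb y' mod 2" using y by (auto simp: cell_def)
      have "2 * ((y - y') \<bullet> ?a) = of_int (ka y - ka y')" "2 * ((y - y') \<bullet> ?b) = of_int (kb y - kb y')"
        using kab[OF yY(1)] kab[OF yY(2)] g by (simp_all add: inner_diff_left)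
      then have "(y - y') \<bullet> ?a = of_int (ka y - ka y') / 2" "(y - y') \<bullet> ?b = of_int (kb y - kb y') / 2" by simp_all
      moreover have "even (ka y - ka y')" "even (kb y - kb y')" using k by (simp_all add: mod_eq_dvd_iff)
      ultimately have "(y - y') \<bullet> ?a \<in> \<int>" "(y - y') \<bullet> ?b \<in> \<int>"
        using half_of_int_Ints_iff by metis+
      then show False using ph phi_eq_0_iff by blast
    qed
    then show "fourier \<mu>1 (y - y') = 0" by (intro orthY yY y(3))
  qed
  \<comment> \<open>The prescribed parity of \<open>2 c y\<close> selects one class in each coset, because \<open>c\<close> is odd.\<close>
  define \<sigma> where "\<sigma> g = (\<lfloor>(s - (2 * of_int c) *\<^sub>R \<rho> g) \<bullet> ?a\<rfloor> mod 2, \<lfloor>(s - (2 * of_int c) *\<^sub>R \<rho> g) \<bullet> ?b\<rfloor> mod 2)" for g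
  have \<sigma>P: "\<sigma> g \<in> P" for g by (auto simp: \<sigma>_def P_def)
  have S_cells: "S = (\<Union>g\<in>G. cell g (\<sigma> g))"
  proof -
    have "even_vec ((2 * of_int c) *\<^sub>R y - s) \<longleftrightarrow> ka y mod 2 = fst (\<sigma> (\<gamma> y)) \<and> kb y mod 2 = snd (\<sigma> (\<gamma> y))"
      if y: "y \<in> Y" for y
    proof -
      define t where "t = s - (2 * of_int c) *\<^sub>R \<rho> (\<gamma> y)"
      have gG: "\<gamma> y \<in> G" using y by (auto simp: G_def)
      have t: "int_vec t" unfolding t_def using s intY[OF \<rho>(1)[OF gG]] by (intro int_vec_diff)
      have par: "((2 * of_int c) *\<^sub>R y - s) \<bullet> v / 2 \<in> \<int> \<longleftrightarrow> k mod 2 = \<lfloor>t \<bullet> v\<rfloor> mod 2"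
        if k: "2 * ((y - \<rho> (\<gamma> y)) \<bullet> v) = of_int k" and v: "int_vec v" for k v
      proof -
        obtain m where m: "t \<bullet> v = of_int m" using int_vec_inner[OF t v] by (auto elim: Ints_cases)
        have "((2 * of_int c) *\<^sub>R y - s) \<bullet> v = of_int c * (2 * ((y - \<rho> (\<gamma> y)) \<bullet> v)) - t \<bullet> v"
          by (simp add: t_def inner_diff_left algebra_simps)
        also have "\<dots> = of_int (c * k - m)" by (simp add: k m)
        finally have "((2 * of_int c) *\<^sub>R y - s) \<bullet> v / 2 \<in> \<int> \<longleftrightarrow> even (c * k - m)"
          by (simp only: half_of_int_Ints_iff)
        also have "\<dots> \<longleftrightarrow> k mod 2 = m mod 2" using odd_c by (auto simp: mod_eq_dvd_iff)
        finally show ?thesis using m by simp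
      qed
      have "even_vec ((2 * of_int c) *\<^sub>R y - s) \<longleftrightarrow>
          ((2 * of_int c) *\<^sub>R y - s) \<bullet> ?a / 2 \<in> \<int> \<and> ((2 * of_int c) *\<^sub>R y - s) \<bullet> ?b / 2 \<in> \<int>"
        by (rule even_vec_iff_inner[OF ab]) (intro int_vec_diff intY y s)
      also have "\<dots> \<longleftrightarrow> ka y mod 2 = \<lfloor>t \<bullet> ?a\<rfloor> mod 2 \<and> kb y mod 2 = \<lfloor>t \<bullet> ?b\<rfloor> mod 2"
        using par[OF kab(1)[OF y] iab(1)] par[OF kab(2)[OF y] iab(2)] by simp
      finally show ?thesis by (simp add: \<sigma>_def t_def)
    qed
    then show ?thesis by (auto simp: S_def cell_def G_def)
  qed
  \<comment> \<open>Outside \<open>N'\<close> the weights of all classes are positive, also of the classes without points of \<open>Y\<close>.\<close>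
  define N' where "N' = (\<lambda>x. x v* ?A) ` N \<union> (\<Union>y\<in>Y. (\<lambda>x. x - y) ` {x. 2 * (x \<bullet> ?a) \<in> \<int> \<and> 2 * (x \<bullet> ?b) \<in> \<int>})"
  have cN': "countable N'"
    unfolding N'_def using N(1) cntY countable_half_lattice[OF ab] by (intro countable_Un countable_UN countable_image) auto
  have main: "((\<lambda>y. (cmod (fourier \<mu>1 (\<eta> + y)))\<^sup>2) has_sum 1) S" if \<eta>: "\<eta> \<notin> N'" for \<eta>
  proof -
    define f where "f y = (cmod (fourier \<mu>1 (\<eta> + y)))\<^sup>2" for y
    define W where "W y = (cmod (phi ((\<eta> + y) \<bullet> ?a) ((\<eta> + y) \<bullet> ?b)))\<^sup>2" for y
    define w where "w g p = (cmod (phi ((\<eta> + \<rho> g) \<bullet> ?a + of_int (fst p) / 2) ((\<eta> + \<rho> g) \<bullet> ?b + of_int (snd p) / 2)))\<^sup>2" for g p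
    define q where "q g p = infsum f (cell g p)" for g and p :: "int \<times> int"
    have f0: "f y \<ge> 0" for y by (simp add: f_def)
    have "\<eta> v* M 1 \<notin> N"
    proof
      assume "\<eta> v* M 1 \<in> N"
      then have "(\<eta> v* M 1) v* ?A \<in> (\<lambda>x. x v* ?A) ` N" by (rule imageI)
      then show False using \<eta> by (simp add: N'_def mult_M_inv)
    qed
    then have "((\<lambda>l. (cmod (fourier \<mu> (\<eta> v* M 1 + l)))\<^sup>2) has_sum 1) \<Lambda>" by (rule N(2))
    also have "(\<lambda>l. (cmod (fourier \<mu> (\<eta> v* M 1 + l)))\<^sup>2) = (\<lambda>y. W y * f y) \<circ> (\<lambda>l. l v* ?A)"
      by (rule ext) (simp add: fourier_split_first vector_matrix_left_distrib mult_M_inv norm_mult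
          power_mult_distrib W_def f_def)
    finally have hsY: "((\<lambda>y. W y * f y) has_sum 1) Y"
      unfolding Y_def by (simp only: has_sum_reindex[OF inj])
    have Wcell: "W y = w g p" if "y \<in> cell g p" for y g p
    proof -
      have y: "y \<in> Y" "\<gamma> y = g" "ka y mod 2 = fst p" "kb y mod 2 = snd p" using that by (auto simp: cell_def)
      have "(\<eta> + y) \<bullet> ?a = (\<eta> + \<rho> g) \<bullet> ?a + (y - \<rho> g) \<bullet> ?a" "(\<eta> + y) \<bullet> ?b = (\<eta> + \<rho> g) \<bullet> ?b + (y - \<rho> g) \<bullet> ?b"
        by (simp_all add: inner_add_left inner_diff_left)
      moreover have "(y - \<rho> g) \<bullet> ?a = of_int (ka y) / 2" "(y - \<rho> g) \<bullet> ?b = of_int (kb y) / 2"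
        using kab[OF y(1)] y(2) by simp_all
      ultimately have "(\<eta> + y) \<bullet> ?a = ((\<eta> + \<rho> g) \<bullet> ?a + of_int (fst p) / 2) + of_int (ka y div 2)"
         "(\<eta> + y) \<bullet> ?b = ((\<eta> + \<rho> g) \<bullet> ?b + of_int (snd p) / 2) + of_int (kb y div 2)"
        using half_of_int_mod[of "ka y"] half_of_int_mod[of "kb y"] y(3,4) by simp_all
      then show ?thesis by (simp only: W_def w_def phi_periodic[OF Ints_of_int Ints_of_int])
    qed
    have bes: "sum f F \<le> 1" if "finite F" "F \<subseteq> (\<Union>g\<in>G. cell g (\<tau> g))" for F \<tau>
      unfolding f_def using that
      by (intro \<mu>1.Bessel orthogonal_exponentials_subset[OF orth_choice[of \<tau>]])
    have smZ: "f summable_on (\<Union>g\<in>G. cell g (\<tau> g))" for \<tau>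
      by (rule nonneg_bdd_above_summable_on) (use f0 bes in \<open>auto intro!: bdd_aboveI[of _ 1]\<close>)
    have sm: "f summable_on cell g p" if "g \<in> G" for g p
      by (rule summable_on_subset_banach[OF smZ[of "\<lambda>_. p"]]) (use that in auto)
    have q_le: "(\<Sum>g\<in>G. q g (\<tau> g)) \<le> 1" for \<tau>
    proof -
      have "(f has_sum (\<Sum>g\<in>G. q g (\<tau> g))) (\<Union>g\<in>G. cell g (\<tau> g))"
        unfolding q_def
        by (rule sum_has_sum[OF finG]) (use sm cell_disj in \<open>auto intro!: has_sum_infsum\<close>)
      then show ?thesis by (rule has_sum_le_finite_sums) (rule bes)
    qed
    have "((\<lambda>y. W y * f y) has_sum (\<Sum>x\<in>G \<times> P. w (fst x) (snd x) * q (fst x) (snd x))) (\<Union>x\<in>G \<times> P. cell (fst x) (snd x))"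
    proof (rule sum_has_sum)
      fix x assume x: "x \<in> G \<times> P"
      have "((\<lambda>y. w (fst x) (snd x) * f y) has_sum (w (fst x) (snd x) * q (fst x) (snd x))) (cell (fst x) (snd x))"
        unfolding q_def using sm x by (intro has_sum_cmult_right has_sum_infsum) auto
      then show "((\<lambda>y. W y * f y) has_sum (w (fst x) (snd x) * q (fst x) (snd x))) (cell (fst x) (snd x))"
        by (rule has_sum_cong[THEN iffD1, rotated]) (simp add: Wcell)
    next
      fix x x' assume "x \<in> G \<times> P" "x' \<in> G \<times> P" "x \<noteq> x'"
      then show "cell (fst x) (snd x) \<inter> cell (fst x') (snd x') = {}"
        by (intro cell_disj) (auto simp: prod_eq_iff)
    qed (use finG finP in auto)
    then have "(\<Sum>x\<in>G \<times> P. w (fst x) (snd x) * q (fst x) (snd x)) = 1"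
      using hsY unfolding Y_cells[symmetric] by (rule has_sum_unique)
    then have tot: "(\<Sum>g\<in>G. \<Sum>p\<in>P. w g p * q g p) = 1"
      by (simp add: sum.cartesian_product case_prod_beta)
    have "(\<Sum>g\<in>G. q g (\<sigma> g)) = 1"
    proof (rule weighted_max_choice[OF finG finP, where w=w])
      show "0 \<le> q g p" for g p unfolding q_def by (rule infsum_nonneg) (rule f0)
      show "(\<Sum>p\<in>P. w g p) = 1" for g
        using sum_phi_half[of "(\<eta> + \<rho> g) \<bullet> ?a" "(\<eta> + \<rho> g) \<bullet> ?b"]
        unfolding P_def sum.cartesian_product[symmetric] w_def by (simp add: sum.cartesian_product[symmetric] add_ac)
      show "w g (\<sigma> g) > 0" if g: "g \<in> G" for g
      proof (rule ccontr)
        assume "\<not> ?thesis"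
        then have "phi ((\<eta> + \<rho> g) \<bullet> ?a + of_int (fst (\<sigma> g)) / 2) ((\<eta> + \<rho> g) \<bullet> ?b + of_int (snd (\<sigma> g)) / 2) = 0"
          by (simp add: w_def)
        then have hz: "2 * ((\<eta> + \<rho> g) \<bullet> ?a + of_int (fst (\<sigma> g)) / 2) \<in> \<int>"
            "2 * ((\<eta> + \<rho> g) \<bullet> ?b + of_int (snd (\<sigma> g)) / 2) \<in> \<int>"
          by (auto dest: phi_eq_0D)
        have "2 * ((\<eta> + \<rho> g) \<bullet> ?a) \<in> \<int>" "2 * ((\<eta> + \<rho> g) \<bullet> ?b) \<in> \<int>"
          using Ints_diff[OF hz(1) Ints_of_int[of "fst (\<sigma> g)"]] Ints_diff[OF hz(2) Ints_of_int[of "snd (\<sigma> g)"]]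
          by (simp_all add: distrib_left)
        then have "\<eta> + \<rho> g \<in> {x. 2 * (x \<bullet> ?a) \<in> \<int> \<and> 2 * (x \<bullet> ?b) \<in> \<int>}" by simp
        then have "(\<eta> + \<rho> g) - \<rho> g \<in> (\<lambda>x. x - \<rho> g) ` {x. 2 * (x \<bullet> ?a) \<in> \<int> \<and> 2 * (x \<bullet> ?b) \<in> \<int>}"
          by (rule imageI)
        then show False using \<eta> \<rho>(1)[OF g] by (auto simp: N'_def)
      qed
    qed (use tot q_le \<sigma>P in \<open>auto simp: w_def\<close>)
    moreover have "(f has_sum (\<Sum>g\<in>G. q g (\<sigma> g))) S"
      unfolding S_cells q_def
      by (rule sum_has_sum[OF finG]) (use sm cell_disj in \<open>auto intro!: has_sum_infsum\<close>)
    moreover have "f = (\<lambda>y. (cmod (fourier \<mu>1 (\<eta> + y)))\<^sup>2)" by (rule ext) (rule f_def)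
    ultimately show ?thesis by (simp only:)
  qed
  show "parseval_ae \<mu>1 {y \<in> Y. even_vec ((2 * of_int c) *\<^sub>R y - s)}"
    unfolding S_def[symmetric] parseval_ae_def
    using cntY cN' main orthS by (auto simp: S_def)
qed

end

text \<open>A countable exceptional set does not exhaust the plane, and an empty sum is not \<open>1\<close>.\<close>

lemma parseval_ae_nonempty: "parseval_ae \<mu> \<Lambda> \<Longrightarrow> \<Lambda> \<noteq> {}"
proof
  assume "parseval_ae \<mu> \<Lambda>" "\<Lambda> = {}"
  then obtain N where N: "countable N" "\<And>\<xi>. \<xi> \<notin> N \<Longrightarrow> ((\<lambda>l. (cmod (fourier \<mu> (\<xi> + l)))\<^sup>2) has_sum 1) {}"
    by (auto simp: parseval_ae_def)
  have "uncountable (UNIV :: (real^2) set)"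
    using uncountable_ball[of 1 "0 :: real^2"] countable_subset subset_UNIV by (metis zero_less_one)
  then obtain \<xi> where "\<xi> \<notin> N" using N(1) by (metis UNIV_eq_I)
  then show False using N(2) has_sum_unique[OF has_sum_empty] by fastforce
qed

lemma parseval_ae_translate:
  assumes "countable \<Lambda>" "orthogonal_exponentials \<mu> \<Lambda>" "\<And>\<xi>. ((\<lambda>l. (cmod (fourier \<mu> (\<xi> + l)))\<^sup>2) has_sum 1) \<Lambda>"
  shows "parseval_ae \<mu> ((\<lambda>l. l - l0) ` \<Lambda>)"
proof -
  have "((\<lambda>l. (cmod (fourier \<mu> (\<xi> + l)))\<^sup>2) has_sum 1) ((\<lambda>l. l - l0) ` \<Lambda>)" for \<xi>
  proof (subst has_sum_reindex)
    show "inj_on (\<lambda>l. l - l0) \<Lambda>" by simp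
    show "((\<lambda>l. (cmod (fourier \<mu> (\<xi> + l)))\<^sup>2) \<circ> (\<lambda>l. l - l0) has_sum 1) \<Lambda>"
      using assms(3)[of "\<xi> - l0"] by (simp add: comp_def add.commute add_diff_eq diff_add_eq)
  qed
  then show ?thesis
    using assms(1,2) unfolding parseval_ae_def orthogonal_exponentials_def
    by (auto intro!: exI[of _ "{}"])
qed

context moran_digits
begin

text \<open>Iterating \<open>parseval_ae_step\<close> with the parity class of \<open>0\<close> produces spectra \<open>\<Lambda>'\<close> of all later tails with
  \<open>c \<Lambda>'\<close> integral.  One more step shows that \<open>\<Lambda>' M\<^sub>n\<^sup>-\<^sup>1\<close> contains points \<open>y\<close> with \<open>2 c y\<close> in any given parity class
  \<open>s\<close>; as \<open>2 c y M\<^sub>n\<close> is even, so is \<open>s M\<^sub>n\<close>.\<close>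

lemma necessity:
  assumes spec: "spectrum_of \<mu> \<Lambda>" and n: "n \<ge> 2" and s: "int_vec s"
  shows "even_vec (s v* M n)"
proof -
  interpret \<mu>: borel_prob \<mu> by (rule borel_prob_\<mu>)
  have sp: "countable \<Lambda>" "orthogonal_exponentials \<mu> \<Lambda>" "\<And>\<xi>. ((\<lambda>l. (cmod (fourier \<mu> (\<xi> + l)))\<^sup>2) has_sum 1) \<Lambda>"
    using spec \<mu>.spectrum_of_iff_parseval[OF AE_\<mu>] by simp_all
  have "\<exists>\<Lambda>. 0 \<in> \<Lambda> \<and> parseval_ae (moran_measure (\<lambda>k. M (k + m)) (\<lambda>k. D (k + m))) \<Lambda> \<and>
      (m \<ge> 1 \<longrightarrow> (\<forall>l\<in>\<Lambda>. int_vec (of_int c *\<^sub>R l)))" for m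
  proof (induction m)
    case 0
    obtain l0 where "l0 \<in> \<Lambda>" using parseval_ae_nonempty[OF parseval_ae_translate[OF sp, of 0]] by auto
    then show ?case using parseval_ae_translate[OF sp, of l0]
      by (intro exI[of _ "(\<lambda>l. l - l0) ` \<Lambda>"]) (auto intro: image_eqI[of _ _ l0])
  next
    case (Suc m)
    then obtain \<Lambda>' where \<Lambda>': "0 \<in> \<Lambda>'" "parseval_ae (moran_measure (\<lambda>k. M (k + m)) (\<lambda>k. D (k + m))) \<Lambda>'" by blast
    interpret s: moran_digits "\<lambda>k. M (k + m)" "\<lambda>k. D (k + m)" r R "\<lambda>k. \<alpha> (k + m)" "\<lambda>k. \<beta> (k + m)" c
      by (rule shift_digits)
    let ?S = "{y \<in> (\<lambda>l. l v* matrix_inv (M (1 + m))) ` \<Lambda>'. even_vec ((2 * of_int c) *\<^sub>R y - 0)}"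
    have "parseval_ae (moran_measure (\<lambda>k. M (k + 1 + m)) (\<lambda>k. D (k + 1 + m))) ?S"
      by (rule s.parseval_ae_step(1)[OF \<Lambda>'(2,1)]) simp
    moreover have "(\<lambda>k. M (k + 1 + m)) = (\<lambda>k. M (k + Suc m))" "(\<lambda>k. D (k + 1 + m)) = (\<lambda>k. D (k + Suc m))" by auto
    moreover have "0 \<in> ?S" using \<Lambda>'(1) by (auto intro!: image_eqI[of _ _ 0])
    moreover have "int_vec (of_int c *\<^sub>R l)" if "l \<in> ?S" for l
      using that by (auto simp: even_vec_def)
    ultimately show ?case by (intro exI[of _ ?S]) auto
  qed
  from this[of "n - 1"] obtain \<Lambda>' where \<Lambda>': "0 \<in> \<Lambda>'"
    "parseval_ae (moran_measure (\<lambda>k. M (k + (n - 1))) (\<lambda>k. D (k + (n - 1)))) \<Lambda>'"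
    "\<And>l. l \<in> \<Lambda>' \<Longrightarrow> int_vec (of_int c *\<^sub>R l)" using n by auto
  interpret s: moran_digits "\<lambda>k. M (k + (n - 1))" "\<lambda>k. D (k + (n - 1))" r R "\<lambda>k. \<alpha> (k + (n - 1))" "\<lambda>k. \<beta> (k + (n - 1))" c
    by (rule shift_digits)
  have n1: "1 + (n - 1) = n" using n by simp
  have "{y \<in> (\<lambda>l. l v* matrix_inv (M n)) ` \<Lambda>'. even_vec ((2 * of_int c) *\<^sub>R y - s)} \<noteq> {}"
    using parseval_ae_nonempty[OF s.parseval_ae_step(1)[OF \<Lambda>'(2,1) s]] unfolding n1 .
  then obtain l where l: "l \<in> \<Lambda>'" "even_vec ((2 * of_int c) *\<^sub>R (l v* matrix_inv (M n)) - s)" by auto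
  have "even_vec (((2 * of_int c) *\<^sub>R (l v* matrix_inv (M n)) - s) v* M n)"
    using n by (intro even_vec_mult_mat int_M l(2)) auto
  also have "((2 * of_int c) *\<^sub>R (l v* matrix_inv (M n)) - s) v* M n = 2 *\<^sub>R (of_int c *\<^sub>R l) - s v* M n"
    using n by (simp add: vector_matrix_mult_diff_distrib scaleR_vector_matrix mult_inv_M)
  finally have "even_vec (2 *\<^sub>R (of_int c *\<^sub>R l) - (2 *\<^sub>R (of_int c *\<^sub>R l) - s v* M n))"
    by (rule even_vec_diff[OF even_vec_2[OF \<Lambda>'(3)[OF l(1)]]])
  then show ?thesis by simp
qed

end

section \<open>A killed random walk on integer frequencies\<close>

text \<open>The moves of the walk at frequency \<open>q\<close>: pairs \<open>(d, d')\<close> of digits for which \<open>q + d - d'\<close> is mapped to an integer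
  vector.  For a full residue system modulo \<open>2\<close> and an even matrix, each \<open>d\<close> has at most one partner \<open>d'\<close>.\<close>

definition live :: "real^2^2 \<Rightarrow> (real^2) set \<Rightarrow> real^2 \<Rightarrow> ((real^2) \<times> (real^2)) set" where
  "live M E q = {p \<in> E \<times> E. int_vec (matrix_inv M *v (q + fst p - snd p))}"

type_synonym stage = "(real^2^2) \<times> (real^2) set"

text \<open>The expected value, on the event that the walk with the given stages (first stage first) is not killed, of the
  character with the final frequency; a missing move contributes zero.\<close>

fun walk_exp :: "stage list \<Rightarrow> real^2 \<Rightarrow> real^2 \<Rightarrow> complex" where
  "walk_exp [] q x = ee (q \<bullet> x)"
| "walk_exp ((M, E) # L) q x =
    (\<Sum>p\<in>live M E q. walk_exp L (matrix_inv M *v (q + fst p - snd p)) x) / 4"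

text \<open>The probability that the walk is alive and different from \<open>0\<close> after all stages.\<close>

fun survival :: "stage list \<Rightarrow> real^2 \<Rightarrow> real" where
  "survival [] q = (if q = 0 then 0 else 1)"
| "survival ((M, E) # L) q =
    (\<Sum>p\<in>live M E q. survival L (matrix_inv M *v (q + fst p - snd p))) / 4"

text \<open>The walk started at \<open>q\<close> can neither be killed nor reach \<open>0\<close>, whatever digits are drawn.\<close>

fun survives_surely :: "stage list \<Rightarrow> real^2 \<Rightarrow> bool" where
  "survives_surely [] q \<longleftrightarrow> q \<noteq> 0"
| "survives_surely ((M, E) # L) q \<longleftrightarrow> q \<noteq> 0 \<and> (\<forall>d\<in>E. \<exists>d'. (d, d') \<in> live M E q) \<and>
    (\<forall>p\<in>live M E q. survives_surely L (matrix_inv M *v (q + fst p - snd p)))"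

lemma geometric_ee:
  assumes "of_nat n * w \<in> \<int>" "n > 0"
  shows "(\<Sum>i<n. ee (w * of_nat i)) = (if w \<in> \<int> then of_nat n else 0)"
proof (cases "w \<in> \<int>")
  case True
  have "ee (w * of_nat i) = 1" for i using True by (intro ee_Ints Ints_mult) auto
  then show ?thesis using True by simp
next
  case False
  have pw: "ee (w * of_nat i) = ee w ^ i" for i
    by (induction i) (simp_all add: distrib_left ee_add)
  have "ee w \<noteq> 1" using False by (simp add: ee_eq_1_iff)
  moreover have "ee w ^ n = 1" using assms(1) by (simp add: pw[symmetric] ee_Ints mult.commute)
  ultimately show ?thesis using False by (simp add: pw sum_gp_strict)
qed

definition box_point :: "nat \<times> nat \<Rightarrow> real^2" where
  "box_point p = vector [of_nat (fst p), of_nat (snd p)]"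

lemma int_vec_box_point: "int_vec (box_point p)"
  by (simp add: box_point_def int_vec_def forall_2)

text \<open>Averaging a character over a box whose side is a multiple of its order detects triviality.\<close>

lemma box_character_sum:
  assumes "int_vec (of_nat n *\<^sub>R w)" "n > 0"
  shows "(\<Sum>p\<in>{..<n} \<times> {..<n}. ee (w \<bullet> box_point p)) = (if int_vec w then of_nat (n * n) else 0)"
proof -
  have 1: "of_nat n * w $ 1 \<in> \<int>" "of_nat n * w $ 2 \<in> \<int>" using assms(1) by (auto simp: int_vec_def)
  have "(\<Sum>p\<in>{..<n} \<times> {..<n}. ee (w \<bullet> box_point p)) = (\<Sum>i<n. \<Sum>j<n. ee (w $ 1 * of_nat i) * ee (w $ 2 * of_nat j))"
    unfolding sum.cartesian_product
    by (intro sum.cong) (auto simp: box_point_def inner_vec_def sum_2 ee_add)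
  also have "\<dots> = (\<Sum>i<n. ee (w $ 1 * of_nat i)) * (\<Sum>j<n. ee (w $ 2 * of_nat j))"
    by (simp add: sum_product)
  also have "\<dots> = (if int_vec w then of_nat (n * n) else 0)"
    unfolding geometric_ee[OF 1(1) assms(2)] geometric_ee[OF 1(2) assms(2)]
    by (simp add: int_vec_def forall_2)
  finally show ?thesis .
qed

lemma matrix_mul_inv_vec: "invertible (M :: real^2^2) \<Longrightarrow> M *v (matrix_inv M *v p) = (p :: real^2)"
  by (simp add: matrix_vector_mul_assoc matrix_inv_mult)

lemma int_vec_det_inv:
  assumes "int_mat M" "invertible M" "int_vec p"
  shows "int_vec (det M *\<^sub>R (matrix_inv M *v p))"
proof -
  define u where "u = matrix_inv M *v p"
  have "M *v u = p" using assms(2) by (simp add: u_def matrix_mul_inv_vec)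
  then have e: "M $ 1 $ 1 * u $ 1 + M $ 1 $ 2 * u $ 2 = p $ 1" "M $ 2 $ 1 * u $ 1 + M $ 2 $ 2 * u $ 2 = p $ 2"
    by (simp_all add: vec_eq_iff forall_2 matrix_vector_mult_def sum_2)
  have "det M * u $ 1 = p $ 1 * M $ 2 $ 2 - p $ 2 * M $ 1 $ 2" "det M * u $ 2 = p $ 2 * M $ 1 $ 1 - p $ 1 * M $ 2 $ 1"
    unfolding e[symmetric] det_2 by (simp_all add: algebra_simps)
  moreover have "M $ i $ j \<in> \<int>" "p $ i \<in> \<int>" for i j using assms by (auto simp: int_mat_def int_vec_def)
  ultimately show ?thesis unfolding u_def[symmetric] by (auto simp: int_vec_def forall_2)
qed

lemma cmod_mask_sq:
  assumes ab: "odd_pair a b" and E: "E = digits a b"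
  shows "complex_of_real ((cmod (mask E y))\<^sup>2) = (\<Sum>p\<in>E \<times> E. ee ((fst p - snd p) \<bullet> y)) / 16"
proof -
  have m: "mask E y = (\<Sum>d\<in>E. ee (d \<bullet> y)) / 4"
    using card_digits(1)[OF ab] E by (simp add: mask_def inner_commute)
  have "complex_of_real ((cmod (mask E y))\<^sup>2) = mask E y * cnj (mask E y)"
    by (rule complex_norm_square)
  also have "\<dots> = (\<Sum>d\<in>E. ee (d \<bullet> y)) * (\<Sum>d\<in>E. cnj (ee (d \<bullet> y))) / 16"
    by (simp add: m)
  also have "(\<Sum>d\<in>E. ee (d \<bullet> y)) * (\<Sum>d\<in>E. cnj (ee (d \<bullet> y))) = (\<Sum>p\<in>E \<times> E. ee ((fst p - snd p) \<bullet> y))"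
    by (simp add: sum_product sum.cartesian_product case_prod_beta inner_diff_left ee_diff)
  finally show ?thesis .
qed

text \<open>The dual description of one mask.  The squared modulus of the mask has frequencies \<open>d - d'\<close>, and the mean over
  the preimages of \<open>x\<close> under the expanding map keeps exactly the frequencies that are mapped to integer vectors.  The stage
  that acts first on points acts last on frequencies, which is why it is appended at the end of the list.\<close>

lemma mean_walk_exp:
  fixes x :: "real^2"
  assumes M: "int_mat M" "invertible M" and ab: "odd_pair a b" and E: "E = digits a b"
    and n: "of_nat n = \<bar>det M\<bar>" and q: "int_vec q"
  defines "y \<equiv> \<lambda>p. (x + box_point p) v* matrix_inv M"
  shows "(\<Sum>p\<in>{..<n} \<times> {..<n}. of_real ((cmod (mask E (y p)))\<^sup>2) * walk_exp L q (y p))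
    = of_nat (n * n) / 4 * walk_exp (L @ [(M, E)]) q x"
  using q
proof (induction L arbitrary: q)
  case Nil
  have n0: "n > 0" using n M(2) by (cases n) (auto simp: invertible_det_nz)
  have finE: "finite E" by (simp add: E)
  let ?B = "{..<n} \<times> {..<n}" and ?V = "matrix_inv M"
  have "(\<Sum>p\<in>?B. of_real ((cmod (mask E (y p)))\<^sup>2) * walk_exp [] q (y p))
    = (\<Sum>p\<in>?B. \<Sum>e\<in>E \<times> E. ee ((?V *v (q + fst e - snd e)) \<bullet> x) * ee ((?V *v (q + fst e - snd e)) \<bullet> box_point p) / 16)"
  proof (rule sum.cong[OF refl])
    fix p
    have "of_real ((cmod (mask E (y p)))\<^sup>2) * walk_exp [] q (y p)
      = (\<Sum>e\<in>E \<times> E. ee ((fst e - snd e) \<bullet> y p) * ee (q \<bullet> y p) / 16)"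
      unfolding cmod_mask_sq[OF ab E] by (simp add: sum_distrib_right sum_divide_distrib)
    also have "\<dots> = (\<Sum>e\<in>E \<times> E. ee ((?V *v (q + fst e - snd e)) \<bullet> x) * ee ((?V *v (q + fst e - snd e)) \<bullet> box_point p) / 16)"
    proof (rule sum.cong[OF refl])
      fix e
      have "(fst e - snd e) \<bullet> y p + q \<bullet> y p = y p \<bullet> (q + fst e - snd e)"
        by (simp add: inner_commute inner_add_right inner_diff_right)
      also have "\<dots> = (x + box_point p) \<bullet> (?V *v (q + fst e - snd e))"
        unfolding y_def by (rule dot_lmul_matrix)
      also have "\<dots> = (?V *v (q + fst e - snd e)) \<bullet> x + (?V *v (q + fst e - snd e)) \<bullet> box_point p"
        by (simp add: inner_add_left inner_commute)
      finally show "ee ((fst e - snd e) \<bullet> y p) * ee (q \<bullet> y p) / 16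
        = ee ((?V *v (q + fst e - snd e)) \<bullet> x) * ee ((?V *v (q + fst e - snd e)) \<bullet> box_point p) / 16"
        by (simp add: ee_add[symmetric])
    qed
    finally show "of_real ((cmod (mask E (y p)))\<^sup>2) * walk_exp [] q (y p)
      = (\<Sum>e\<in>E \<times> E. ee ((?V *v (q + fst e - snd e)) \<bullet> x) * ee ((?V *v (q + fst e - snd e)) \<bullet> box_point p) / 16)" .
  qed
  also have "\<dots> = (\<Sum>e\<in>E \<times> E. \<Sum>p\<in>?B. ee ((?V *v (q + fst e - snd e)) \<bullet> x) * ee ((?V *v (q + fst e - snd e)) \<bullet> box_point p) / 16)"
    by (rule sum.swap)
  also have "\<dots> = (\<Sum>e\<in>E \<times> E. ee ((?V *v (q + fst e - snd e)) \<bullet> x) / 16 * (\<Sum>p\<in>?B. ee ((?V *v (q + fst e - snd e)) \<bullet> box_point p)))"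
    by (simp add: sum_distrib_left)
  also have "\<dots> = (\<Sum>e\<in>E \<times> E. if int_vec (?V *v (q + fst e - snd e))
      then ee ((?V *v (q + fst e - snd e)) \<bullet> x) / 16 * of_nat (n * n) else 0)"
  proof (rule sum.cong[OF refl])
    fix e assume e: "e \<in> E \<times> E"
    have "int_vec (q + fst e - snd e)"
      using e E Nil int_vec_digits[OF ab] by (intro int_vec_diff int_vec_add) auto
    then have "int_vec (det M *\<^sub>R (?V *v (q + fst e - snd e)))" by (rule int_vec_det_inv[OF M])
    then have "int_vec (of_nat n *\<^sub>R (?V *v (q + fst e - snd e)))"
      unfolding n by (cases "det M \<ge> 0") (auto simp: abs_if)
    from box_character_sum[OF this n0]
    show "ee ((?V *v (q + fst e - snd e)) \<bullet> x) / 16 * (\<Sum>p\<in>?B. ee ((?V *v (q + fst e - snd e)) \<bullet> box_point p))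
      = (if int_vec (?V *v (q + fst e - snd e)) then ee ((?V *v (q + fst e - snd e)) \<bullet> x) / 16 * of_nat (n * n) else 0)"
      by simp
  qed
  also have "\<dots> = (\<Sum>e\<in>live M E q. ee ((?V *v (q + fst e - snd e)) \<bullet> x) / 16 * of_nat (n * n))"
    unfolding live_def using finE by (intro sum.inter_filter[symmetric]) auto
  also have "\<dots> = of_nat (n * n) / 4 * walk_exp ([] @ [(M, E)]) q x"
    by (simp add: sum_distrib_left sum_divide_distrib mult_ac)
  finally show ?case .
next
  case (Cons S L)
  obtain N F where S: "S = (N, F)" by (cases S)
  let ?V = "matrix_inv N"
  let ?B = "{..<n} \<times> {..<n}"
  have "(\<Sum>p\<in>?B. of_real ((cmod (mask E (y p)))\<^sup>2) * walk_exp (S # L) q (y p))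
    = (\<Sum>p\<in>?B. \<Sum>e\<in>live N F q. of_real ((cmod (mask E (y p)))\<^sup>2) * walk_exp L (?V *v (q + fst e - snd e)) (y p) / 4)"
    by (simp add: S sum_distrib_left sum_divide_distrib)
  also have "\<dots> = (\<Sum>e\<in>live N F q. (\<Sum>p\<in>?B. of_real ((cmod (mask E (y p)))\<^sup>2) * walk_exp L (?V *v (q + fst e - snd e)) (y p)) / 4)"
    by (subst sum.swap) (simp add: sum_divide_distrib)
  also have "\<dots> = (\<Sum>e\<in>live N F q. of_nat (n * n) / 4 * walk_exp (L @ [(M, E)]) (?V *v (q + fst e - snd e)) x / 4)"
    by (intro sum.cong refl arg_cong[where f="\<lambda>z. z / 4"] Cons.IH) (simp add: live_def)
  also have "\<dots> = of_nat (n * n) / 4 * walk_exp ((S # L) @ [(M, E)]) q x"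
    by (simp add: S sum_distrib_left sum_divide_distrib)
  finally show ?case .
qed

text \<open>A matrix \<open>2 N\<close> with \<open>\<bar>det N\<bar> > 1\<close> and a digit set, with all constants that later bounds may depend on.\<close>

definition even_stage :: "real \<Rightarrow> real \<Rightarrow> real \<Rightarrow> stage \<Rightarrow> bool" where
  "even_stage r R c S \<longleftrightarrow> (case S of (M, E) \<Rightarrow> invertible M \<and> int_mat ((1/2) *\<^sub>R M) \<and> \<bar>det M\<bar> > 4 \<and>
     (\<forall>v. norm (matrix_inv M *v v) \<le> r * norm v) \<and> (\<forall>d\<in>E. norm d \<le> R) \<and>
     (\<exists>a b. odd_pair a b \<and> E = digits a b \<and> \<bar>cross a b\<bar> \<le> c))"

lemma even_matrix_mult:
  assumes "int_mat ((1/2) *\<^sub>R M)" "int_vec v"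
  shows "even_vec (M *v v)"
proof -
  have "(1/2) *\<^sub>R (M *v v) = ((1/2) *\<^sub>R M) *v v"
    by (simp add: scaleR_matrix_vector_assoc)
  then show ?thesis using int_mat_mult_vec[OF assms] by (simp add: even_vec_def)
qed

lemma live_even:
  assumes "invertible M" "int_mat ((1/2) *\<^sub>R M)" "(d, d') \<in> live M E q"
  shows "even_vec (q + d - d')"
  using even_matrix_mult[OF assms(2), of "matrix_inv M *v (q + d - d')"] assms
  by (auto simp: live_def matrix_mul_inv_vec)

lemma live_unique:
  assumes "invertible M" "int_mat ((1/2) *\<^sub>R M)" "odd_pair a b"
    "(d, d1) \<in> live M (digits a b) q" "(d, d2) \<in> live M (digits a b) q"
  shows "d1 = d2"
proof -
  have "even_vec ((q + d - d2) - (q + d - d1))"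
    by (rule even_vec_diff[OF live_even[OF assms(1,2,5)] live_even[OF assms(1,2,4)]])
  then have "even_vec (d1 - d2)" by (simp add: algebra_simps)
  then show ?thesis using assms(4,5) by (intro digits_neq[OF assms(3)]) (auto simp: live_def)
qed

lemma live_finite: "finite E \<Longrightarrow> finite (live M E q)"
  unfolding live_def by simp

lemma card_live:
  assumes "invertible M" "int_mat ((1/2) *\<^sub>R M)" "odd_pair a b"
  shows "card (live M (digits a b) q) \<le> 4"
proof -
  have "inj_on fst (live M (digits a b) q)"
    by (rule inj_onI) (metis live_unique[OF assms] prod.collapse)
  then have "card (live M (digits a b) q) = card (fst ` live M (digits a b) q)" by (simp add: card_image)
  also have "\<dots> \<le> card (digits a b)" by (intro card_mono) (auto simp: live_def)
  finally show ?thesis using card_digits(1)[OF assms(3)] by simp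
qed

lemma even_stageE:
  assumes "even_stage r R c (M, E)"
  obtains a b where "invertible M" "int_mat ((1/2) *\<^sub>R M)" "\<bar>det M\<bar> > 4"
     "\<And>v. norm (matrix_inv M *v v) \<le> r * norm v" "\<And>d. d \<in> E \<Longrightarrow> norm d \<le> R"
     "odd_pair a b" "E = digits a b" "\<bar>cross a b\<bar> \<le> c"
  using assms unfolding even_stage_def by auto

text \<open>Distinct digits are incongruent modulo \<open>2\<close>, so frequency \<open>0\<close> is absorbing and the walk is never killed there.\<close>

lemma live_0:
  assumes "invertible M" "int_mat ((1/2) *\<^sub>R M)" "odd_pair a b"
  shows "live M (digits a b) 0 = (\<lambda>d. (d, d)) ` digits a b"
proof (intro equalityI subsetI)
  fix p assume p: "p \<in> live M (digits a b) 0"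
  then have 1: "(fst p, fst p) \<in> live M (digits a b) 0" by (auto simp: live_def)
  have "fst p = snd p" using live_unique[OF assms 1, of "snd p"] p by simp
  then show "p \<in> (\<lambda>d. (d, d)) ` digits a b" using p by (intro image_eqI[of _ _ "fst p"]) (auto simp: live_def prod_eq_iff)
qed (auto simp: live_def)

lemma walk_exp_0:
  assumes "\<And>S. S \<in> set L \<Longrightarrow> even_stage r R c S"
  shows "walk_exp L 0 x = 1"
  using assms
proof (induction L)
  case (Cons S L)
  obtain M E where S: "S = (M, E)" by (cases S)
  obtain a b where g: "invertible M" "int_mat ((1/2) *\<^sub>R M)" "odd_pair a b" "E = digits a b"
    using Cons.prems[of S] S by (auto elim: even_stageE)
  have "(\<Sum>p\<in>live M E 0. walk_exp L (matrix_inv M *v (0 + fst p - snd p)) x) = (\<Sum>p\<in>live M E 0. 1)"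
    using Cons unfolding g(4) live_0[OF g(1,2,3)] by (intro sum.cong) auto
  also have "\<dots> = 4"
    unfolding g(4) live_0[OF g(1,2,3)] by (simp add: card_image inj_on_def card_digits(1)[OF g(3)])
  finally show ?case by (simp add: S)
qed simp

text \<open>Paths that end at \<open>0\<close> contribute \<open>1\<close>, all other surviving paths contribute at least \<open>-1\<close>.\<close>

lemma Re_walk_exp_ge: "Re (walk_exp L q x) \<ge> - survival L q"
proof (induction L arbitrary: q)
  case Nil
  have "\<bar>Re (ee (q \<bullet> x))\<bar> \<le> 1" using abs_Re_le_cmod[of "ee (q \<bullet> x)"] by simp
  then show ?case by auto
next
  case (Cons S L)
  obtain M E where S: "S = (M, E)" by (cases S)
  have "(\<Sum>p\<in>live M E q. - survival L (matrix_inv M *v (q + fst p - snd p)))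
     \<le> (\<Sum>p\<in>live M E q. Re (walk_exp L (matrix_inv M *v (q + fst p - snd p)) x))"
    by (intro sum_mono Cons.IH)
  then show ?case by (simp add: S sum_negf)
qed

fun half_prod :: "stage list \<Rightarrow> real^2^2" where
  "half_prod [] = mat 1"
| "half_prod (S # L) = ((1/2) *\<^sub>R fst S) ** half_prod L"

definition lattice_image :: "real^2^2 \<Rightarrow> (real^2) set" where
  "lattice_image T = (\<lambda>v. T *v v) ` {v. int_vec v}"

lemma lattice_image_0: "0 \<in> lattice_image T"
  unfolding lattice_image_def by (intro image_eqI[of _ _ 0]) auto

lemma lattice_image_add: "u \<in> lattice_image T \<Longrightarrow> v \<in> lattice_image T \<Longrightarrow> u + v \<in> lattice_image T"
  unfolding lattice_image_def
  by (auto simp: matrix_vector_right_distrib[symmetric] intro: int_vec_add)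

lemma lattice_image_minus: "u \<in> lattice_image T \<Longrightarrow> - u \<in> lattice_image T"
  unfolding lattice_image_def
proof (elim imageE)
  fix v assume "u = T *v v" "v \<in> {v. int_vec v}"
  then show "- u \<in> (*v) T ` {v. int_vec v}"
    by (intro image_eqI[of _ _ "- v"]) (auto simp: matrix_vector_mult_def vec_eq_iff sum_negf)
qed

lemma lattice_image_diff: "u \<in> lattice_image T \<Longrightarrow> v \<in> lattice_image T \<Longrightarrow> u - v \<in> lattice_image T"
  using lattice_image_add[OF _ lattice_image_minus, of u T v] by simp

lemma lattice_image_mult:
  assumes "u \<in> lattice_image T"
  shows "N *v u \<in> lattice_image (N ** T)"
  using assms unfolding lattice_image_def by (auto simp: matrix_vector_mul_assoc)

lemma cross_matrix: "cross (T *v u) (T *v v) = det T * cross u v"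
  by (simp add: cross_def matrix_vector_mult_def sum_2 det_2 algebra_simps)

lemma odd_pair_rotate: "odd_pair a b \<Longrightarrow> odd_pair b a" "odd_pair a b \<Longrightarrow> odd_pair (- a - b) a"
proof -
  assume ab: "odd_pair a b"
  then obtain k :: int where k: "odd k" "cross a b = of_int k" by (auto simp: odd_pair_def)
  have "cross b a = - cross a b" by (simp add: cross_def)
  then have "cross b a = of_int (- k)" using k by simp
  moreover have "odd (- k)" using k by simp
  ultimately show "odd_pair b a" using ab unfolding odd_pair_def by blast
  have "cross (- a - b) a = cross a b" by (simp add: cross_def algebra_simps)
  then have "cross (- a - b) a = of_int k" using k(2) by simp
  then show "odd_pair (- a - b) a" using ab k(1) unfolding odd_pair_def
    by (auto intro!: int_vec_diff int_vec_minus)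
qed

lemma digits_rotate: "digits b a = digits a b" "digits (- a - b) a = digits a b"
proof -
  have "- b - a = - a - b" "- (- a - b) - a = b" by (simp_all add: algebra_simps)
  then show "digits b a = digits a b" "digits (- a - b) a = digits a b"
    by (auto simp: digits_def)
qed

text \<open>For odd \<open>q\<close> the partner relation splits the digits into two pairs.  If \<open>0\<close> is paired with \<open>a\<close>, then \<open>b\<close> is
  paired with \<open>- a - b\<close>, and subtracting the two corresponding moves gives \<open>2 (a + b) \<in> 2 N T \<int>\<^sup>2\<close>.\<close>

lemma odd_pairing:
  assumes M: "invertible M" "int_mat ((1/2) *\<^sub>R M)" and ab: "odd_pair a b"
    and W: "\<And>p. p \<in> live M (digits a b) q \<Longrightarrow> matrix_inv M *v (q + fst p - snd p) \<in> lattice_image T"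
    and tot: "\<And>d. d \<in> digits a b \<Longrightarrow> \<exists>d'. (d, d') \<in> live M (digits a b) q"
    and pa: "(0, a) \<in> live M (digits a b) q" and sym: "\<And>d d'. (d, d') \<in> live M (digits a b) q \<Longrightarrow> (d', d) \<in> live M (digits a b) q"
    and odd: "\<And>d d'. (d, d') \<in> live M (digits a b) q \<Longrightarrow> d \<noteq> d'"
    and dif: "\<And>d d'. (d, d') \<in> live M (digits a b) q \<Longrightarrow> d - d' \<in> lattice_image (((1/2) *\<^sub>R M) ** T)"
  shows "a \<in> lattice_image (((1/2) *\<^sub>R M) ** T)" "b \<in> lattice_image (((1/2) *\<^sub>R M) ** T)"
proof -
  let ?NW = "lattice_image (((1/2) *\<^sub>R M) ** T)" and ?L = "live M (digits a b) q"
  have dbl: "\<exists>w\<in>lattice_image T. q + d - d' = M *v w" if "(d, d') \<in> ?L" for d d'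
    using W[OF that] by (intro bexI[of _ "matrix_inv M *v (q + d - d')"]) (auto simp: matrix_mul_inv_vec[OF M(1)])
  show a: "a \<in> ?NW" using lattice_image_minus[OF dif[OF pa]] by simp
  have pa': "(a, 0) \<in> ?L" by (rule sym[OF pa])
  obtain d where d: "(b, d) \<in> ?L" using tot[of b] by (auto simp: digits_def)
  have "d \<noteq> b" using odd[OF d] by simp
  moreover have "d \<noteq> 0"
  proof
    assume "d = 0"
    then have "(0, b) \<in> ?L" using sym[OF d] by simp
    then show False using live_unique[OF M ab pa] card_digits(4)[OF ab] by simp
  qed
  moreover have "d \<noteq> a"
  proof
    assume "d = a"
    then have "(a, b) \<in> ?L" using sym[OF d] by simp
    then show False using live_unique[OF M ab pa'] card_digits(3)[OF ab] by auto
  qed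
  moreover have "d \<in> digits a b" using d by (auto simp: live_def)
  ultimately have "d = - a - b" by (auto simp: digits_def)
  then obtain w1 w2 where w: "w1 \<in> lattice_image T" "w2 \<in> lattice_image T"
    "q + 0 - a = M *v w1" "q + b - (- a - b) = M *v w2"
    using dbl[OF pa] dbl[OF d] by auto
  have "2 *\<^sub>R (a + b) = M *v (w2 - w1)"
    unfolding matrix_vector_mult_diff_distrib w(3,4)[symmetric] by (simp add: scaleR_2 algebra_simps)
  then have "a + b = ((1/2) *\<^sub>R M) *v (w2 - w1)"
    by (metis scaleR_matrix_vector_assoc scaleR_half_double scaleR_2)
  then have "a + b \<in> ?NW" using lattice_image_mult[OF lattice_image_diff[OF w(2,1)], of "(1/2) *\<^sub>R M"] by simp
  then have "(a + b) - a \<in> ?NW" using a by (rule lattice_image_diff)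
  then show "b \<in> ?NW" by simp
qed

text \<open>Induction along the stages.  Partners come in both orders, \<open>(d, d')\<close> and \<open>(d', d)\<close>.  Sum and difference of the two
  moves show that \<open>q\<close> and \<open>d - d'\<close> lie in \<open>N\<close> times the lattice that contains all successors.\<close>

lemma survives_surely_lattice:
  assumes "\<And>S. S \<in> set L \<Longrightarrow> even_stage r R c S" "int_vec q" "survives_surely L q"
  shows "q \<in> lattice_image (half_prod L)"
    and "\<And>M E L' d. L = (M, E) # L' \<Longrightarrow> \<not> even_vec q \<Longrightarrow> d \<in> E \<Longrightarrow> d \<in> lattice_image (half_prod L)"
proof -
  have "q \<in> lattice_image (half_prod L) \<and>
    (\<forall>M E L' d. L = (M, E) # L' \<longrightarrow> \<not> even_vec q \<longrightarrow> d \<in> E \<longrightarrow> d \<in> lattice_image (half_prod L))"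
    using assms
  proof (induction L arbitrary: q)
    case Nil
    then show ?case by (auto simp: lattice_image_def)
  next
    case (Cons S L)
    obtain M E where S: "S = (M, E)" by (cases S)
    obtain a b where g: "invertible M" "int_mat ((1/2) *\<^sub>R M)" "odd_pair a b" "E = digits a b"
      using Cons.prems(1)[of S] S by (auto elim: even_stageE)
    let ?N = "(1/2) *\<^sub>R M" and ?T = "half_prod L"
    let ?NW = "lattice_image (?N ** ?T)"
    have W: "matrix_inv M *v (q + fst p - snd p) \<in> lattice_image ?T" if p: "p \<in> live M E q" for p
    proof -
      have "int_vec (matrix_inv M *v (q + fst p - snd p))" using p by (simp add: live_def)
      moreover have "survives_surely L (matrix_inv M *v (q + fst p - snd p))" using Cons.prems(3) p by (simp add: S)
      ultimately show ?thesis using Cons.IH[of "matrix_inv M *v (q + fst p - snd p)"] Cons.prems(1) by auto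
    qed
    have tot: "\<exists>d'. (d, d') \<in> live M E q" if "d \<in> E" for d using Cons.prems(3) that by (simp add: S)
    have dbl: "\<exists>w\<in>lattice_image ?T. q + d - d' = M *v w" if "(d, d') \<in> live M E q" for d d'
      using W[OF that] by (intro bexI[of _ "matrix_inv M *v (q + d - d')"]) (auto simp: matrix_mul_inv_vec[OF g(1)])
    have sym: "(d', d) \<in> live M E q" if p: "(d, d') \<in> live M E q" for d d'
    proof -
      have "d' \<in> E" using p by (simp add: live_def)
      then obtain d'' where d'': "(d', d'') \<in> live M E q" using tot by blast
      have "even_vec ((q + d - d') + (q + d' - d''))"
        by (rule even_vec_add[OF live_even[OF g(1,2) p] live_even[OF g(1,2) d'']])
      then have "even_vec (((q + d - d') + (q + d' - d'')) - 2 *\<^sub>R q)"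
        by (rule even_vec_diff) (rule even_vec_2[OF Cons.prems(2)])
      also have "((q + d - d') + (q + d' - d'')) - 2 *\<^sub>R q = d - d''" by (simp add: scaleR_2)
      finally have "d = d''" using p d'' g(4) by (intro digits_neq[OF g(3)]) (auto simp: live_def)
      then show ?thesis using d'' by simp
    qed
    have half: "x \<in> ?NW" if "2 *\<^sub>R x = M *v w" "w \<in> lattice_image ?T" for x w
    proof -
      have "x = ?N *v w" using that(1) by (metis scaleR_matrix_vector_assoc scaleR_half_double scaleR_2)
      then show ?thesis using lattice_image_mult[OF that(2), of ?N] by simp
    qed
    have both: "q \<in> ?NW \<and> d - d' \<in> ?NW" if p: "(d, d') \<in> live M E q" for d d'
    proof -
      obtain w1 w2 where w: "w1 \<in> lattice_image ?T" "w2 \<in> lattice_image ?T"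
        "q + d - d' = M *v w1" "q + d' - d = M *v w2"
        using dbl[OF p] dbl[OF sym[OF p]] by blast
      have "2 *\<^sub>R q = M *v (w1 + w2)" "2 *\<^sub>R (d - d') = M *v (w1 - w2)"
        unfolding matrix_vector_right_distrib matrix_vector_mult_diff_distrib w(3,4)[symmetric]
        by (simp_all add: scaleR_2)
      then show ?thesis using half lattice_image_add[OF w(1,2)] lattice_image_diff[OF w(1,2)] by blast
    qed
    have 0: "0 \<in> E" by (simp add: g(4) digits_def)
    obtain e where e: "(0, e) \<in> live M E q" using tot[OF 0] by blast
    have 1: "q \<in> lattice_image (half_prod (S # L))" using both[OF e] by (simp add: S)
    have 2: "d \<in> lattice_image (half_prod (S # L))" if odd: "\<not> even_vec q" and d: "d \<in> E" for d
    proof -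
      have ne: "d \<noteq> d'" if "(d, d') \<in> live M E q" for d d'
        using live_even[OF g(1,2) that] odd by auto
      have "e \<noteq> 0" using ne[OF e] by simp
      moreover have "e \<in> digits a b" using e g(4) by (auto simp: live_def)
      ultimately have "e = a \<or> e = b \<or> e = - a - b" by (auto simp: digits_def)
      then obtain a' b' where ab': "odd_pair a' b'" "E = digits a' b'" "e = a'"
      proof (elim disjE)
        assume "e = a" then show ?thesis using that[of a b] g by simp
      next
        assume "e = b" then show ?thesis using that[of b a] g odd_pair_rotate digits_rotate by simp
      next
        assume "e = - a - b" then show ?thesis using that[of "- a - b" a] g odd_pair_rotate digits_rotate by simp
      qed
      have "a' \<in> ?NW" "b' \<in> ?NW"
        using odd_pairing[of M a' b' q ?T, OF g(1,2) ab'(1)] W tot e sym ne both ab'(2,3) by blast+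
      moreover have "- a' - b' \<in> ?NW" using lattice_image_diff[OF lattice_image_minus] calculation by blast
      ultimately have "d \<in> ?NW" using d lattice_image_0 unfolding ab'(2) digits_def by auto
      then show ?thesis by (simp add: S)
    qed
    show ?case using 1 2 by (auto simp: S)
  qed
  then show "q \<in> lattice_image (half_prod L)"
    "\<And>M E L' d. L = (M, E) # L' \<Longrightarrow> \<not> even_vec q \<Longrightarrow> d \<in> E \<Longrightarrow> d \<in> lattice_image (half_prod L)" by auto
qed

text \<open>An integer of modulus greater than \<open>1\<close> has modulus at least \<open>2\<close>; this is where \<open>\<bar>det M\<bar> > 4\<close> enters.\<close>

lemma det_half_prod:
  assumes "\<And>S. S \<in> set L \<Longrightarrow> even_stage r R c S"
  shows "2 ^ length L \<le> \<bar>det (half_prod L)\<bar>"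
  using assms
proof (induction L)
  case (Cons S L)
  obtain M E where S: "S = (M, E)" by (cases S)
  have g: "int_mat ((1/2) *\<^sub>R M)" "\<bar>det M\<bar> > 4"
    using Cons.prems[of S] S by (auto elim: even_stageE)
  obtain k where k: "det ((1/2) *\<^sub>R M) = of_int k" using int_mat_det[OF g(1)] by (auto elim: Ints_cases)
  have "det ((1/2) *\<^sub>R M) = det M / 4" by (simp add: det_2)
  then have "\<bar>real_of_int k\<bar> > 1" using g(2) k by simp
  then have "\<bar>k\<bar> \<ge> 2" by linarith
  then have 2: "\<bar>det ((1/2) *\<^sub>R M)\<bar> \<ge> 2" unfolding k by linarith
  have "2 * 2 ^ length L \<le> \<bar>det ((1/2) *\<^sub>R M)\<bar> * \<bar>det (half_prod L)\<bar>"
    using Cons by (intro mult_mono 2) auto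
  then show ?case by (simp add: S det_mul abs_mult)
qed simp

text \<open>Otherwise both generators of the first digit set would lie in a sublattice of index at least
  \<open>2 ^ length L\<close>, and this index would divide their determinant.\<close>

lemma odd_not_survives_surely:
  assumes L: "\<And>S. S \<in> set L \<Longrightarrow> even_stage r R c S" and q: "int_vec q" "\<not> even_vec q"
    and c: "c < 2 ^ length L" "L \<noteq> []"
  shows "\<not> survives_surely L q"
proof
  assume s: "survives_surely L q"
  obtain M E L' where LS: "L = (M, E) # L'" using c(2) by (metis neq_Nil_conv prod.collapse)
  obtain a b where g: "odd_pair a b" "E = digits a b" "\<bar>cross a b\<bar> \<le> c"
    using L[of "(M, E)"] LS by (auto elim: even_stageE)
  have "a \<in> lattice_image (half_prod L)" "b \<in> lattice_image (half_prod L)"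
    by (rule survives_surely_lattice(2)[OF L q(1) s LS q(2)], assumption, simp add: g(2) digits_def)+
  then obtain u v where uv: "int_vec u" "int_vec v" "a = half_prod L *v u" "b = half_prod L *v v"
    by (auto simp: lattice_image_def)
  have eq: "cross a b = det (half_prod L) * cross u v" unfolding uv(3,4) by (rule cross_matrix)
  obtain k :: int where k: "cross u v = of_int k"
    using uv(1,2) unfolding cross_def int_vec_def by (metis Ints_cases Ints_diff Ints_mult)
  have "cross a b \<noteq> 0" by (rule cross_neq_0[OF g(1)])
  then have "k \<noteq> 0" using eq k by auto
  then have "1 \<le> \<bar>cross u v\<bar>" unfolding k by linarith
  then have "2 ^ length L * 1 \<le> \<bar>det (half_prod L)\<bar> * \<bar>cross u v\<bar>"
    by (intro mult_mono det_half_prod[OF L]) auto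
  also have "\<dots> = \<bar>cross a b\<bar>" by (simp add: eq abs_mult)
  finally show False using g(3) c(1) by simp
qed

lemma int_vec_small: "int_vec v \<Longrightarrow> norm v < 1 \<Longrightarrow> v = 0"
proof -
  assume v: "int_vec v" "norm v < 1"
  have "v $ i = 0" for i
  proof -
    obtain k where k: "v $ i = of_int k" using v(1) by (auto simp: int_vec_def elim: Ints_cases)
    have "\<bar>v $ i\<bar> < 1" using component_le_norm_cart[of v i] v(2) by simp
    then have "\<bar>k\<bar> < 1" unfolding k by linarith
    then show ?thesis using k by simp
  qed
  then show "v = 0" by (simp add: vec_eq_iff)
qed

text \<open>An even frequency is moved by the contraction alone, so after \<open>j\<close> even steps it would be a nonzero integer vector
  of norm less than \<open>1\<close>; an odd frequency met before that leaves at least \<open>i\<close> stages for \<open>odd_not_survives_surely\<close>.\<close>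

lemma not_survives_surely:
  assumes "0 \<le> r" "c < 2 ^ i" "i > 0"
  shows "(\<And>S. S \<in> set L \<Longrightarrow> even_stage r R c S) \<Longrightarrow> int_vec q \<Longrightarrow> norm q * r ^ j < 1 \<Longrightarrow>
    length L = i + j \<Longrightarrow> \<not> survives_surely L q"
proof (induction j arbitrary: q L)
  case 0
  then have "q = 0" by (intro int_vec_small) auto
  then show ?case by (cases L; cases "hd L") auto
next
  case (Suc j)
  obtain M E L' where LS: "L = (M, E) # L'" using Suc.prems(4) by (metis list.size(3) add_is_0 nat.distinct(2) neq_Nil_conv prod.collapse)
  obtain a b where g: "invertible M" "int_mat ((1/2) *\<^sub>R M)" "odd_pair a b" "E = digits a b"
    "\<And>v. norm (matrix_inv M *v v) \<le> r * norm v"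
    using Suc.prems(1)[of "(M, E)"] LS by (auto elim: even_stageE)
  show ?case
  proof (cases "even_vec q")
    case False
    have "(2::real) ^ i \<le> 2 ^ length L" using Suc.prems(4) by (intro power_increasing) auto
    then show ?thesis using assms(2) LS by (intro odd_not_survives_surely[OF Suc.prems(1,2) False]) auto
  next
    case True
    show ?thesis
    proof
      assume s: "survives_surely L q"
      have "0 \<in> E" by (simp add: g(4) digits_def)
      then obtain d where d: "(0, d) \<in> live M E q" using s LS by auto
      have "even_vec ((q + 0 - d) - q)" by (rule even_vec_diff[OF live_even[OF g(1,2) d] True])
      then have "even_vec (0 - d)" by simp
      then have "0 = d" by (rule digits_neq[OF g(3), rotated 2]) (use d g(4) in \<open>auto simp: live_def\<close>)
      with d have d0: "(0, 0) \<in> live M E q" by simp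
      then have "survives_surely L' (matrix_inv M *v q)" using s LS by (auto dest!: bspec[of _ _ "(0, 0)"])
      moreover have "\<not> survives_surely L' (matrix_inv M *v q)"
      proof (rule Suc.IH)
        show "int_vec (matrix_inv M *v q)" using d0 by (simp add: live_def)
        have "norm (matrix_inv M *v q) * r ^ j \<le> (r * norm q) * r ^ j"
          using assms(1) by (intro mult_right_mono g(5)) auto
        also have "\<dots> < 1" using Suc.prems(3) by (simp add: mult_ac)
        finally show "norm (matrix_inv M *v q) * r ^ j < 1" .
      qed (use Suc.prems LS in auto)
      ultimately show False by simp
    qed
  qed
qed

lemma survival_0:
  assumes "\<And>S. S \<in> set L \<Longrightarrow> even_stage r R c S"
  shows "survival L 0 = 0"
  using assms
proof (induction L)
  case (Cons S L)
  obtain M E where S: "S = (M, E)" by (cases S)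
  obtain a b where g: "invertible M" "int_mat ((1/2) *\<^sub>R M)" "odd_pair a b" "E = digits a b"
    using Cons.prems[of S] S by (auto elim: even_stageE)
  have "(\<Sum>p\<in>live M E 0. survival L (matrix_inv M *v (0 + fst p - snd p))) = (\<Sum>p\<in>live M E 0. 0)"
    using Cons unfolding g(4) live_0[OF g(1,2,3)] by (intro sum.cong) auto
  then show ?case by (simp add: S)
qed simp

lemma norm_step_le:
  assumes "norm q \<le> B" "norm d \<le> R" "norm d' \<le> R" "r * (B + 2 * R) \<le> B" "0 \<le> r"
    and "\<And>v. norm (V *v v) \<le> r * norm v"
  shows "norm (V *v (q + d - d')) \<le> B"
proof -
  have "norm (q + d - d') \<le> norm q + norm d + norm d'"
    using norm_triangle_ineq4[of "q + d" d'] norm_triangle_ineq[of q d] by linarith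
  also have "\<dots> \<le> B + 2 * R" using assms(1-3) by linarith
  finally have "r * norm (q + d - d') \<le> r * (B + 2 * R)" by (rule mult_left_mono) (rule assms(5))
  with assms(4) assms(6)[of "q + d - d'"] show ?thesis by linarith
qed

text \<open>If sure survival along \<open>L\<close> fails, some sequence of digits, which has probability at least \<open>(1/4)\<close> to the
  length of \<open>L\<close>, leads to death or to \<open>0\<close>.  The inequality \<open>r (B + 2 R) \<le> B\<close> keeps the walk in the ball of radius \<open>B\<close>.\<close>

lemma survival_append_le:
  assumes B: "r * (B + 2 * R) \<le> B" "0 \<le> r"
    and L': "\<And>S. S \<in> set L' \<Longrightarrow> even_stage r R c S"
    and b: "0 \<le> b" "\<And>q. int_vec q \<Longrightarrow> norm q \<le> B \<Longrightarrow> survival L' q \<le> b"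
  shows "(\<And>S. S \<in> set L \<Longrightarrow> even_stage r R c S) \<Longrightarrow> int_vec q \<Longrightarrow> norm q \<le> B \<Longrightarrow>
    survival (L @ L') q \<le> b \<and> (\<not> survives_surely L q \<longrightarrow> survival (L @ L') q \<le> (1 - (1/4) ^ length L) * b)"
proof (induction L arbitrary: q)
  case Nil
  then show ?case using b survival_0[OF L'] by auto
next
  case (Cons S L)
  obtain M E where S: "S = (M, E)" by (cases S)
  obtain x y where g: "invertible M" "int_mat ((1/2) *\<^sub>R M)" "odd_pair x y" "E = digits x y"
    "\<And>v. norm (matrix_inv M *v v) \<le> r * norm v" "\<And>d. d \<in> E \<Longrightarrow> norm d \<le> R"
    using Cons.prems(1)[of S] S by (auto elim: even_stageE)
  let ?nx = "\<lambda>p. matrix_inv M *v (q + fst p - snd p)"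
  let ?s = "\<lambda>p. survival (L @ L') (?nx p)"
  let ?Lv = "live M E q"
  have IH: "?s p \<le> b" "\<not> survives_surely L (?nx p) \<Longrightarrow> ?s p \<le> (1 - (1/4) ^ length L) * b" if p: "p \<in> ?Lv" for p
  proof -
    have "int_vec (?nx p)" "norm (?nx p) \<le> B"
      using p g(6) by (auto simp: live_def intro!: norm_step_le[OF Cons.prems(3) _ _ B g(5)])
    then show "?s p \<le> b" "\<not> survives_surely L (?nx p) \<Longrightarrow> ?s p \<le> (1 - (1/4) ^ length L) * b"
      using Cons.IH[of "?nx p"] Cons.prems(1) by auto
  qed
  have fin: "finite ?Lv" using g(4) by (intro live_finite) simp
  have c4: "card ?Lv \<le> 4" unfolding g(4) by (rule card_live[OF g(1,2,3)])
  have sum_le: "sum ?s A \<le> card A * b" if "A \<subseteq> ?Lv" for A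
    using sum_bounded_above[of A ?s b] IH(1) that by auto
  have pw: "(1/4 :: real) ^ length L \<le> 1" by (rule power_le_one) auto
  have sv: "survival ((S # L) @ L') q = sum ?s ?Lv / 4" by (simp add: S)
  have 1: "survival ((S # L) @ L') q \<le> b"
  proof -
    have "real (card ?Lv) * b \<le> 4 * b" using c4 b(1) by (intro mult_right_mono) auto
    then show ?thesis using sum_le[of ?Lv] unfolding sv by simp
  qed
  have 2: "survival ((S # L) @ L') q \<le> (1 - (1/4) ^ length (S # L)) * b" if ns: "\<not> survives_surely (S # L) q"
  proof -
    consider "q = 0" | d where "d \<in> E" "\<And>d'. (d, d') \<notin> ?Lv" | p where "p \<in> ?Lv" "\<not> survives_surely L (?nx p)"
      using ns unfolding S by auto
    then show ?thesis
    proof cases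
      case 1
      have "survival ((S # L) @ L') 0 = 0"
        by (rule survival_0) (use L' Cons.prems(1) in auto)
      moreover have "(1/4 :: real) ^ length (S # L) \<le> 1" by (rule power_le_one) auto
      ultimately show ?thesis using 1 b(1) by simp
    next
      case 2
      have "inj_on fst ?Lv" unfolding g(4) by (rule inj_onI) (metis live_unique[OF g(1,2,3)] prod.collapse)
      then have "card ?Lv = card (fst ` ?Lv)" by (simp add: card_image)
      also have "\<dots> \<le> card (E - {d})"
        using 2 g(4) by (intro card_mono) (auto simp: live_def)
      also have "\<dots> = 3" using 2(1) card_digits(1)[OF g(3)] g(4) by simp
      finally have "real (card ?Lv) * b \<le> 3 * b" using b(1) by (intro mult_right_mono) auto
      then have "sum ?s ?Lv / 4 \<le> 3 / 4 * b" using sum_le[of ?Lv] by simp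
      also have "\<dots> \<le> (1 - (1/4) ^ length (S # L)) * b" using pw b(1) by (intro mult_right_mono) auto
      finally show ?thesis unfolding sv .
    next
      case 3
      have "sum ?s ?Lv = ?s p + sum ?s (?Lv - {p})" using fin 3(1) by (rule sum.remove)
      also have "\<dots> \<le> (1 - (1/4) ^ length L) * b + card (?Lv - {p}) * b"
        by (intro add_mono IH(2)[OF 3] sum_le) auto
      also have "card (?Lv - {p}) * b \<le> 3 * b"
        using c4 3(1) fin b(1) by (intro mult_right_mono) (auto simp: card_Diff_singleton)
      finally show ?thesis unfolding sv by (simp add: field_simps)
    qed
  qed
  show ?case using 1 2 by blast
qed

text \<open>Blocks of fixed length each remove a fixed proportion of the surviving probability.\<close>

lemma survival_decay:
  assumes r: "0 \<le> r" "r < 1" and R: "0 \<le> R" and \<delta>: "0 < \<delta>"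
  shows "\<exists>J. \<forall>L q. length L = J \<longrightarrow> (\<forall>S\<in>set L. even_stage r R c S) \<longrightarrow> int_vec q \<longrightarrow> norm q \<le> B \<longrightarrow>
    survival L q \<le> \<delta>"
proof -
  \<comment> \<open>The ball of radius \<open>B'\<close> is invariant under the walk.\<close>
  define B' where "B' = max B (2 * R / (1 - r))"
  have B': "r * (B' + 2 * R) \<le> B'"
  proof -
    have "2 * R \<le> (1 - r) * B'"
    proof -
      have "(1 - r) * (2 * R / (1 - r)) \<le> (1 - r) * B'" using r by (intro mult_left_mono) (auto simp: B'_def)
      then show ?thesis using r by simp
    qed
    moreover have "r * (2 * R) \<le> 2 * R" using r R by (intro mult_left_le_one_le) auto
    ultimately show ?thesis by (simp add: algebra_simps)
  qed
  have "B' \<ge> 0" using r R by (simp add: B'_def le_max_iff_disj)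
  obtain i :: nat where i: "c < 2 ^ i" "i > 0"
  proof -
    obtain n where "c < 2 ^ n" using real_arch_pow[of 2 c] by auto
    also have "(2::real) ^ n \<le> 2 ^ Suc n" by simp
    finally show ?thesis using that[of "Suc n"] by simp
  qed
  have "(\<lambda>j. B' * r ^ j) \<longlonglongrightarrow> B' * 0" using r by (intro tendsto_intros LIMSEQ_realpow_zero)
  then have "\<forall>\<^sub>F j in sequentially. B' * r ^ j < 1" by (intro order_tendstoD) auto
  then obtain j where j: "B' * r ^ j < 1" by (auto simp: eventually_sequentially)
  define K where "K = i + j"
  have ns: "\<not> survives_surely L q" if "length L = K" "\<And>S. S \<in> set L \<Longrightarrow> even_stage r R c S" "int_vec q" "norm q \<le> B'" for L q
  proof (rule not_survives_surely[OF r(1) i])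
    have "norm q * r ^ j \<le> B' * r ^ j" using r that by (intro mult_right_mono) auto
    then show "norm q * r ^ j < 1" using j by simp
  qed (use that in \<open>auto simp: K_def\<close>)
  define \<kappa> where "\<kappa> = 1 - (1/4 :: real) ^ K"
  have K0: "K > 0" using i by (simp add: K_def)
  have \<kappa>: "0 \<le> \<kappa>" "\<kappa> < 1" using power_le_one[of "1/4 :: real" K] by (auto simp: \<kappa>_def)
  have it: "survival L q \<le> \<kappa> ^ m"
    if "length L = m * K" "\<forall>S\<in>set L. even_stage r R c S" "int_vec q" "norm q \<le> B'" for m L q
    using that
  proof (induction m arbitrary: L q)
    case 0
    then show ?case by simp
  next
    case (Suc m)
    let ?L1 = "take K L" and ?L2 = "drop K L"
    have s: "\<And>S. S \<in> set ?L1 \<Longrightarrow> even_stage r R c S" "\<And>S. S \<in> set ?L2 \<Longrightarrow> even_stage r R c S"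
      using Suc.prems(2) by (auto dest: in_set_takeD in_set_dropD)
    have l: "length ?L1 = K" "length ?L2 = m * K" using Suc.prems(1) by auto
    have IHb: "survival ?L2 q' \<le> \<kappa> ^ m" if "int_vec q'" "norm q' \<le> B'" for q'
      using Suc.IH[OF l(2) _ that] s(2) by blast
    have km: "0 \<le> \<kappa> ^ m" using \<kappa> by simp
    have "survival (?L1 @ ?L2) q \<le> (1 - (1/4) ^ length ?L1) * \<kappa> ^ m"
      using survival_append_le[OF B' r(1) s(2) km IHb s(1) Suc.prems(3,4)] ns[OF l(1) s(1) Suc.prems(3,4)]
      by blast
    then show ?case unfolding l(1) by (simp add: \<kappa>_def)
  qed
  have "(\<lambda>m. \<kappa> ^ m) \<longlonglongrightarrow> 0" using \<kappa> by (intro LIMSEQ_realpow_zero) auto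
  then have "\<forall>\<^sub>F m in sequentially. \<kappa> ^ m < \<delta>" using \<delta> by (intro order_tendstoD) auto
  then obtain m where m: "\<kappa> ^ m < \<delta>" by (auto simp: eventually_sequentially)
  show ?thesis
  proof (intro exI[of _ "m * K"] allI impI)
    fix L q assume h: "length L = m * K" "\<forall>S\<in>set L. even_stage r R c S" "int_vec q" "norm q \<le> B"
    have "norm q \<le> B'" using h(4) by (simp add: B'_def)
    from it[OF h(1-3) this] m show "survival L q \<le> \<delta>" by simp
  qed
qed

section \<open>Equi-positivity of Moran measures\<close>

text \<open>Coefficients and frequencies of the expansion of \<open>half_cos (y\<^sub>1)\<^sup>K half_cos (y\<^sub>2)\<^sup>K\<close>, where
  \<open>half_cos t = \<bar>(1 + e(t)) / 2\<bar>\<^sup>2\<close>.  Repeated frequencies are not collected.\<close>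

definition bump_coeff :: "nat \<Rightarrow> (nat \<times> nat) \<times> (nat \<times> nat) \<Rightarrow> real" where
  "bump_coeff K x = (case x of ((i, j), (i', j')) \<Rightarrow>
     real (K choose i) * real (K choose j) * (real (K choose i') * real (K choose j')) / 16 ^ K)"

definition bump_freq :: "(nat \<times> nat) \<times> (nat \<times> nat) \<Rightarrow> real^2" where
  "bump_freq x = (case x of ((i, j), (i', j')) \<Rightarrow> vector [real i - real j, real i' - real j'])"

definition bump_index :: "nat \<Rightarrow> ((nat \<times> nat) \<times> (nat \<times> nat)) set" where
  "bump_index K = ({..K} \<times> {..K}) \<times> ({..K} \<times> {..K})"

definition half_cos :: "real \<Rightarrow> real" where
  "half_cos t = (1 + cos (2 * pi * t)) / 2"

lemma half_cos_bounds: "0 \<le> half_cos t" "half_cos t \<le> 1"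
proof -
  define z where "z = cos (2 * pi * t)"
  have "- 1 \<le> z" "z \<le> 1" by (simp_all add: z_def)
  then show "0 \<le> half_cos t" "half_cos t \<le> 1" by (simp_all add: half_cos_def flip: z_def)
qed

lemma half_cos_power:
  "complex_of_real (half_cos t ^ K) =
     (\<Sum>x\<in>{..K} \<times> {..K}. of_nat (K choose fst x) * of_nat (K choose snd x) * ee ((real (fst x) - real (snd x)) * t)) / 4 ^ K"
proof -
  have 1: "complex_of_real (half_cos t) = (1 + ee t) * (1 + cnj (ee t)) / 4"
  proof -
    have "ee t * cnj (ee t) = 1" by (simp add: complex_norm_square[symmetric])
    then show ?thesis
      by (simp add: algebra_simps) (simp add: half_cos_def ee_cis complex_eq_iff)
  qed
  have p: "ee (real i * t) = ee t ^ i" for i by (induction i) (simp_all add: distrib_right ee_add)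
  have "complex_of_real (half_cos t ^ K) = (1 + ee t) ^ K * (1 + cnj (ee t)) ^ K / 4 ^ K"
    unfolding of_real_power 1 by (simp add: power_divide power_mult_distrib)
  also have "(1 + ee t) ^ K = (\<Sum>i\<le>K. of_nat (K choose i) * ee (real i * t))"
    using binomial_ring[of "ee t" 1 K] by (simp add: p add.commute)
  also have "(1 + cnj (ee t)) ^ K = (\<Sum>j\<le>K. of_nat (K choose j) * cnj (ee (real j * t)))"
    using binomial_ring[of "cnj (ee t)" 1 K] by (simp add: p add.commute)
  also have "(\<Sum>i\<le>K. of_nat (K choose i) * ee (real i * t)) * (\<Sum>j\<le>K. of_nat (K choose j) * cnj (ee (real j * t)))
    = (\<Sum>x\<in>{..K} \<times> {..K}. of_nat (K choose fst x) * of_nat (K choose snd x) * ee ((real (fst x) - real (snd x)) * t))"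
    unfolding sum_product sum.cartesian_product
    by (intro sum.cong) (auto simp: left_diff_distrib ee_diff)
  finally show ?thesis .
qed

lemma bump_expansion:
  "complex_of_real (half_cos (y $ 1) ^ K * half_cos (y $ 2) ^ K) =
    (\<Sum>x\<in>bump_index K. of_real (bump_coeff K x) * ee (bump_freq x \<bullet> y))"
proof -
  have "complex_of_real (half_cos (y $ 1) ^ K * half_cos (y $ 2) ^ K) =
   (\<Sum>x\<in>bump_index K. of_nat (K choose fst (fst x)) * of_nat (K choose snd (fst x)) * ee ((real (fst (fst x)) - real (snd (fst x))) * y $ 1)
     * (of_nat (K choose fst (snd x)) * of_nat (K choose snd (snd x)) * ee ((real (fst (snd x)) - real (snd (snd x))) * y $ 2))) / (4 ^ K * 4 ^ K)"
    unfolding of_real_mult half_cos_power bump_index_def times_divide_times_eq sum_product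
    unfolding sum.cartesian_product by (simp add: case_prod_beta)
  also have "\<dots> = (\<Sum>x\<in>bump_index K. of_real (bump_coeff K x) * ee (bump_freq x \<bullet> y))"
    unfolding sum_divide_distrib
  proof (rule sum.cong[OF refl])
    fix x :: "(nat \<times> nat) \<times> (nat \<times> nat)"
    obtain i j i' j' where x: "x = ((i, j), (i', j'))" by (metis prod.collapse)
    have "(4::complex) ^ K * 4 ^ K = 16 ^ K" by (simp add: power_mult_distrib[symmetric])
    then show "of_nat (K choose fst (fst x)) * of_nat (K choose snd (fst x)) * ee ((real (fst (fst x)) - real (snd (fst x))) * y $ 1)
     * (of_nat (K choose fst (snd x)) * of_nat (K choose snd (snd x)) * ee ((real (fst (snd x)) - real (snd (snd x))) * y $ 2)) / (4 ^ K * 4 ^ K)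
     = of_real (bump_coeff K x) * ee (bump_freq x \<bullet> y)"
      by (simp add: x bump_coeff_def bump_freq_def inner_vec_def sum_2 ee_add mult_ac)
  qed
  finally show ?thesis .
qed

lemma bump_coeff_nonneg: "0 \<le> bump_coeff K x"
  by (auto simp: bump_coeff_def split: prod.split)

lemma finite_bump_index: "finite (bump_index K)"
  by (simp add: bump_index_def)

lemma sum_bump_coeff: "(\<Sum>x\<in>bump_index K. bump_coeff K x) = 1"
proof -
  have "complex_of_real (\<Sum>x\<in>bump_index K. bump_coeff K x) = 1"
    using bump_expansion[of 0 K] by (simp add: half_cos_def)
  then show ?thesis by (simp only: of_real_eq_1_iff)
qed

lemma bump_freq_int: "int_vec (bump_freq x)"
  by (auto simp: bump_freq_def int_vec_def forall_2 split: prod.split)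

lemma norm_bump_freq:
  assumes "x \<in> bump_index K"
  shows "norm (bump_freq x) \<le> 2 * real K"
proof -
  have "norm (bump_freq x) \<le> (\<Sum>i\<in>UNIV. \<bar>bump_freq x $ i\<bar>)" by (rule norm_le_l1_cart)
  also have "\<dots> \<le> 2 * real K"
    using assms by (auto simp: sum_2 bump_freq_def bump_index_def split: prod.split)
  finally show ?thesis .
qed

text \<open>The constant coefficient is the square of \<open>(2K choose K) / 4\<^sup>K\<close>.  It decays only polynomially in \<open>K\<close>, whereas the
  bump decays exponentially away from \<open>\<int>\<^sup>2\<close>.\<close>

lemma bump_constant_coeff:
  assumes "K > 0"
  shows "1 / (4 * (real K)\<^sup>2) \<le> (\<Sum>x\<in>{x\<in>bump_index K. bump_freq x = 0}. bump_coeff K x)"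
proof -
  let ?f = "\<lambda>(i, i'). (((i :: nat), i), ((i' :: nat), i'))"
  have sub: "?f ` ({..K} \<times> {..K}) \<subseteq> {x\<in>bump_index K. bump_freq x = 0}"
    by (auto simp: bump_index_def bump_freq_def vec_eq_iff forall_2)
  have inj: "inj_on ?f ({..K} \<times> {..K})" by (auto simp: inj_on_def)
  have "(\<Sum>i\<le>K. (real (K choose i))\<^sup>2) = real ((2 * K) choose K)"
    using choose_square_sum[of K] by (metis (mono_tags, lifting) of_nat_power of_nat_sum sum.cong)
  moreover have "(\<Sum>x\<in>{..K} \<times> {..K}. bump_coeff K (?f x))
    = (\<Sum>x\<in>{..K} \<times> {..K}. (real (K choose fst x))\<^sup>2 * (real (K choose snd x))\<^sup>2) / 16 ^ K"
    unfolding sum_divide_distrib by (intro sum.cong) (auto simp: bump_coeff_def power2_eq_square)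
  moreover have "(\<Sum>x\<in>{..K} \<times> {..K}. (real (K choose fst x))\<^sup>2 * (real (K choose snd x))\<^sup>2)
    = (\<Sum>i\<le>K. (real (K choose i))\<^sup>2) * (\<Sum>i\<le>K. (real (K choose i))\<^sup>2)"
    unfolding sum_product sum.cartesian_product by (simp add: case_prod_beta)
  ultimately have "(\<Sum>x\<in>{..K} \<times> {..K}. bump_coeff K (?f x)) = (real ((2 * K) choose K))\<^sup>2 / 16 ^ K"
    by (simp add: power2_eq_square)
  moreover have "(\<Sum>x\<in>?f ` ({..K} \<times> {..K}). bump_coeff K x) \<le> (\<Sum>x\<in>{x\<in>bump_index K. bump_freq x = 0}. bump_coeff K x)"
    using sub finite_bump_index by (intro sum_mono2 bump_coeff_nonneg) auto
  moreover have "(\<Sum>x\<in>?f ` ({..K} \<times> {..K}). bump_coeff K x) = (\<Sum>x\<in>{..K} \<times> {..K}. bump_coeff K (?f x))"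
    by (subst sum.reindex[OF inj]) simp
  moreover have "1 / (4 * (real K)\<^sup>2) \<le> (real ((2 * K) choose K))\<^sup>2 / 16 ^ K"
  proof -
    have "4 ^ K / (2 * real K) \<le> real ((2 * K) choose K)" by (rule central_binomial_lower_bound[OF assms])
    then have le: "(4 ^ K / (2 * real K))\<^sup>2 \<le> (real ((2 * K) choose K))\<^sup>2" by (intro power_mono) auto
    have eq: "((4::real) ^ K / (2 * real K))\<^sup>2 = 16 ^ K * (1 / (4 * (real K)\<^sup>2))"
    proof -
      have "((4::real) ^ K)\<^sup>2 = (4\<^sup>2) ^ K" by (simp only: power_mult[symmetric] mult.commute)
      also have "\<dots> = 16 ^ K" by simp
      finally have "((4::real) ^ K)\<^sup>2 = 16 ^ K" .
      then show ?thesis by (simp add: power_divide power_mult_distrib)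
    qed
    show ?thesis using le unfolding eq by (simp add: field_simps)
  qed
  ultimately show ?thesis by linarith
qed

fun trajectory :: "stage list \<Rightarrow> real^2 \<Rightarrow> real^2" where
  "trajectory [] x = x"
| "trajectory ((M, E) # L) x = trajectory L (x v* matrix_inv M)"

fun weight :: "stage list \<Rightarrow> real^2 \<Rightarrow> real" where
  "weight [] x = 1"
| "weight ((M, E) # L) x = (cmod (mask E (x v* matrix_inv M)))\<^sup>2 * weight L (x v* matrix_inv M)"

lemma trajectory_snoc: "trajectory (L @ [(M, E)]) x = trajectory L x v* matrix_inv M"
  by (induction L x rule: trajectory.induct) auto

lemma weight_snoc: "weight (L @ [(M, E)]) x = weight L x * (cmod (mask E (trajectory L x v* matrix_inv M)))\<^sup>2"
  by (induction L x rule: weight.induct) auto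

lemma trajectory_stages: "trajectory (map (\<lambda>j. (M j, D j)) [1..<Suc n]) x = x v* inv_prod M n"
proof (induction n)
  case (Suc n)
  have "map (\<lambda>j. (M j, D j)) [1..<Suc (Suc n)] = map (\<lambda>j. (M j, D j)) [1..<Suc n] @ [(M (Suc n), D (Suc n))]"
    by simp
  then show ?case using Suc by (simp only: trajectory_snoc) (simp add: vector_matrix_mul_assoc)
qed simp

lemma weight_stages: "weight (map (\<lambda>j. (M j, D j)) [1..<Suc n]) x = (cmod (fourier_partial M D n x))\<^sup>2"
proof (induction n)
  case (Suc n)
  have "map (\<lambda>j. (M j, D j)) [1..<Suc (Suc n)] = map (\<lambda>j. (M j, D j)) [1..<Suc n] @ [(M (Suc n), D (Suc n))]"
    by simp
  then show ?case using Suc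
    by (simp only: weight_snoc trajectory_stages)
      (simp add: vector_matrix_mul_assoc fourier_partial_Suc norm_mult power_mult_distrib)
qed simp

lemma weight_bounds: "0 \<le> weight L x" "weight L x \<le> 1"
proof (induction L x rule: weight.induct)
  case (2 M E L x)
  { case 1 show ?case using 2 by simp }
  { case 2
    have "(cmod (mask E (x v* matrix_inv M)))\<^sup>2 \<le> 1" by (simp add: norm_mask_le power_le_one)
    then show ?case using "2.IH" by (simp add: mult_le_one) }
qed auto

lemma mask_periodic:
  assumes "odd_pair a b" "int_vec k"
  shows "mask (digits a b) (y + k) = mask (digits a b) y"
  using assms by (simp add: mask_digits inner_add_left phi_periodic int_vec_inner odd_pair_def)

lemma int_mat_of_half: "int_mat ((1/2) *\<^sub>R M) \<Longrightarrow> int_mat M"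
  unfolding int_mat_def
proof (intro allI)
  fix i j assume "\<forall>i j. ((1/2) *\<^sub>R M) $ i $ j \<in> \<int>"
  then have "2 * (M $ i $ j / 2) \<in> \<int>" by (intro Ints_mult) auto
  then show "M $ i $ j \<in> \<int>" by simp
qed

lemma Re_of_real_mult: "Re (of_real a * z) = a * Re z"
  by simp

text \<open>Iteration of \<open>mean_walk_exp\<close>: a mean is attained or exceeded somewhere, and the integer translates chosen at the
  successive levels combine into one translate \<open>k\<close> of the starting point.  The last translate is used to bring the end point
  of the trajectory into the unit square around \<open>0\<close>.\<close>

lemma choose_translate:
  fixes a :: "'x \<Rightarrow> real" and q :: "'x \<Rightarrow> real^2"
  assumes X: "finite X" and q: "\<And>x. x \<in> X \<Longrightarrow> int_vec (q x)"
  defines "G \<equiv> \<lambda>L y. Re (\<Sum>x\<in>X. of_real (a x) * walk_exp L (q x) y)"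
  shows "(\<And>S. S \<in> set L \<Longrightarrow> even_stage r R c S) \<Longrightarrow>
    \<exists>k. int_vec k \<and> (\<forall>i. \<bar>trajectory L (y0 + k) $ i\<bar> \<le> 1/2) \<and>
      (1/4) ^ length L * G (rev L) y0 \<le> weight L (y0 + k) * G [] (trajectory L (y0 + k))"
proof (induction L arbitrary: y0)
  case Nil
  \<comment> \<open>The combination of characters is \<open>\<int>\<^sup>2\<close>-periodic, so the end point may be rounded towards \<open>0\<close>.\<close>
  define k :: "real^2" where "k = (\<chi> i. - of_int (round (y0 $ i)))"
  have k: "int_vec k" by (simp add: k_def int_vec_def)
  have "ee (q x \<bullet> (y0 + k)) = ee (q x \<bullet> y0)" if "x \<in> X" for x
    using int_vec_inner[OF q[OF that] k] by (simp add: inner_add_right ee_add ee_Ints)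
  then have "G [] (y0 + k) = G [] y0" by (simp add: G_def)
  moreover have "\<bar>(y0 + k) $ i\<bar> \<le> 1/2" for i
    using of_int_round_abs_le[of "y0 $ i"] by (simp add: k_def abs_minus_commute)
  ultimately show ?case using k by (intro exI[of _ k]) auto
next
  case (Cons S L)
  obtain M E where S: "S = (M, E)" by (cases S)
  obtain u v where g: "invertible M" "int_mat ((1/2) *\<^sub>R M)" "odd_pair u v" "E = digits u v"
    using Cons.prems[of S] S by (auto elim: even_stageE)
  have M: "int_mat M" by (rule int_mat_of_half[OF g(2)])
  obtain n :: nat where n: "of_nat n = \<bar>det M\<bar>"
  proof -
    obtain m where "det M = of_int m" using int_mat_det[OF M] by (auto elim: Ints_cases)
    then show ?thesis using that[of "nat \<bar>m\<bar>"] by simp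
  qed
  have n0: "n > 0" using n g(1) by (cases n) (auto simp: invertible_det_nz)
  let ?B = "{..<n} \<times> {..<n}"
  define y where "y p = (y0 + box_point p) v* matrix_inv M" for p
  define w where "w p = (cmod (mask E (y p)))\<^sup>2" for p
  have "(\<Sum>p\<in>?B. of_real (w p) * (\<Sum>x\<in>X. of_real (a x) * walk_exp (rev L) (q x) (y p)))
      = (\<Sum>x\<in>X. of_real (a x) * (\<Sum>p\<in>?B. of_real (w p) * walk_exp (rev L) (q x) (y p)))"
    unfolding sum_distrib_left by (subst sum.swap) (simp add: mult_ac)
  also have "\<dots> = (\<Sum>x\<in>X. of_real (a x) * (of_nat (n * n) / 4 * walk_exp (rev L @ [(M, E)]) (q x) y0))"
    unfolding w_def y_def by (intro sum.cong refl arg_cong2[where f="(*)"] mean_walk_exp[OF M g(1) g(3,4) n] q)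
  also have "\<dots> = of_real (real (n * n) / 4) * (\<Sum>x\<in>X. of_real (a x) * walk_exp (rev (S # L)) (q x) y0)"
    by (simp add: S sum_distrib_left mult_ac)
  finally have "Re (\<Sum>p\<in>?B. of_real (w p) * (\<Sum>x\<in>X. of_real (a x) * walk_exp (rev L) (q x) (y p)))
     = Re (of_real (real (n * n) / 4) * (\<Sum>x\<in>X. of_real (a x) * walk_exp (rev (S # L)) (q x) y0))"
    by (rule arg_cong)
  then have mean: "(\<Sum>p\<in>?B. w p * G (rev L) (y p)) = real (n * n) / 4 * G (rev (S # L)) y0"
    by (simp only: G_def Re_sum Re_of_real_mult)
  have "\<exists>p\<in>?B. w p * G (rev L) (y p) \<ge> 1/4 * G (rev (S # L)) y0"
  proof (rule ccontr)
    assume "\<not> ?thesis"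
    then have lt: "w p * G (rev L) (y p) < 1/4 * G (rev (S # L)) y0" if "p \<in> ?B" for p
      using that not_le by blast
    have "(\<Sum>p\<in>?B. w p * G (rev L) (y p)) < (\<Sum>p\<in>?B. 1/4 * G (rev (S # L)) y0)"
      by (rule sum_strict_mono) (use n0 lt in auto)
    then show False unfolding mean by simp
  qed
  then obtain p where p: "w p * G (rev L) (y p) \<ge> 1/4 * G (rev (S # L)) y0" by blast
  obtain k where k: "int_vec k" "\<And>i. \<bar>trajectory L (y p + k) $ i\<bar> \<le> 1/2"
    "(1/4) ^ length L * G (rev L) (y p) \<le> weight L (y p + k) * G [] (trajectory L (y p + k))"
    using Cons.IH[of "y p"] Cons.prems by auto
  define k' where "k' = box_point p + k v* M"
  have k': "int_vec k'" unfolding k'_def by (intro int_vec_add int_vec_box_point int_vec_mult_mat M k(1))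
  have eq: "(y0 + k') v* matrix_inv M = y p + k"
    using matrix_inv_mult[OF g(1)]
    by (simp add: k'_def y_def add.assoc[symmetric] vector_matrix_left_distrib vector_matrix_mul_assoc)
  have mk: "mask E (y p + k) = mask E (y p)" unfolding g(4) by (rule mask_periodic[OF g(3) k(1)])
  have "(1/4) ^ length (S # L) * G (rev (S # L)) y0 \<le> (1/4) ^ length L * (w p * G (rev L) (y p))"
    using p by (simp add: mult_left_mono)
  also have "\<dots> = w p * ((1/4) ^ length L * G (rev L) (y p))" by simp
  also have "\<dots> \<le> w p * (weight L (y p + k) * G [] (trajectory L (y p + k)))"
    by (intro mult_left_mono k(3)) (simp add: w_def)
  also have "\<dots> = weight (S # L) (y0 + k') * G [] (trajectory (S # L) (y0 + k'))"
    by (simp add: S eq mk w_def)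
  finally show ?case using k(2) k' by (intro exI[of _ k']) (simp add: S eq)
qed

lemma half_cos_far:
  assumes "\<bar>t\<bar> \<le> 1/2" "0 \<le> \<rho>" "\<rho> \<le> \<bar>t\<bar>"
  shows "half_cos t \<le> half_cos \<rho>"
proof -
  have "cos (2 * pi * t) = cos (2 * pi * \<bar>t\<bar>)"
    using cos_abs_real[of "2 * pi * t"] by (simp add: abs_mult)
  also have "\<dots> \<le> cos (2 * pi * \<rho>)"
  proof (rule cos_monotone_0_pi_le)
    show "0 \<le> 2 * pi * \<rho>" using assms by simp
    show "2 * pi * \<rho> \<le> 2 * pi * \<bar>t\<bar>" using assms by simp
    have "pi * (2 * \<bar>t\<bar>) \<le> pi * 1" using assms by (intro mult_left_mono) auto
    then show "2 * pi * \<bar>t\<bar> \<le> pi" by simp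
  qed
  finally show ?thesis by (simp add: half_cos_def)
qed

lemma half_cos_less_1: "0 < \<rho> \<Longrightarrow> \<rho> \<le> 1/2 \<Longrightarrow> half_cos \<rho> < 1"
proof -
  assume r: "0 < \<rho>" "\<rho> \<le> 1/2"
  have "cos (2 * pi * \<rho>) < cos 0"
  proof (rule cos_monotone_0_pi)
    have "pi * (2 * \<rho>) \<le> pi * 1" using r by (intro mult_left_mono) auto
    then show "2 * pi * \<rho> \<le> pi" by simp
  qed (use r in auto)
  then show "half_cos \<rho> < 1" by (simp add: half_cos_def)
qed

text \<open>Exponential decay beats the polynomial decay of the constant coefficient of the bump.\<close>

lemma exists_bump_exponent:
  assumes "0 \<le> v" "v < (1::real)"
  shows "\<exists>K>0. v ^ K < 1 / (8 * (real K)\<^sup>2)"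
proof -
  have "norm (sqrt v) < 1" using assms by simp
  then have "(\<lambda>n. of_nat n * sqrt v ^ n) \<longlonglongrightarrow> 0" by (rule powser_times_n_limit_0)
  then have "\<forall>\<^sub>F n in sequentially. of_nat n * sqrt v ^ n < 1/3" by (rule order_tendstoD) simp
  then obtain N where N: "\<And>n. n \<ge> N \<Longrightarrow> of_nat n * sqrt v ^ n < 1/3" by (auto simp: eventually_sequentially)
  define K where "K = Suc N"
  have "real K * sqrt v ^ K < 1/3" using N[of K] by (simp add: K_def)
  then have le: "(real K * sqrt v ^ K)\<^sup>2 \<le> (1/3)\<^sup>2" using assms by (intro power_mono) auto
  have eq: "(sqrt v ^ K)\<^sup>2 = v ^ K"
    using assms by (metis power_mult mult.commute real_sqrt_pow2)
  have "(real K)\<^sup>2 * v ^ K \<le> (1/3)\<^sup>2" using le unfolding power_mult_distrib eq .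
  then have "(real K)\<^sup>2 * v ^ K \<le> 1/9" by (simp add: power_divide)
  then have "(real K)\<^sup>2 * v ^ K < 1/8" by linarith
  then show ?thesis by (intro exI[of _ K]) (auto simp: K_def field_simps)
qed

text \<open>The mean of the product of masks and bump, minus the size of the bump far from \<open>\<int>\<^sup>2\<close>, is positive.  So
  for some translate the product of the masks is bounded below and the trajectory ends near \<open>0\<close>, where the transform of
  the remaining tail is at least \<open>1/2\<close>.\<close>

theorem equi_positivity:
  assumes r: "0 \<le> r" "r < 1" and R: "0 \<le> R"
  shows "\<exists>\<epsilon>>0. \<forall>M D. moran M D r R \<longrightarrow> (\<forall>n\<ge>1. even_stage r R c (M n, D n)) \<longrightarrow>
    (\<forall>x. \<exists>k. int_vec k \<and> \<epsilon> \<le> cmod (fourier (moran_measure M D) (x + k)))"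
proof -
  define Lip where "Lip = 2 * pi * R / (1 - r)"
  have Lip: "Lip \<ge> 0" using r R by (simp add: Lip_def)
  \<comment> \<open>Within distance \<open>2 \<rho>\<close> of \<open>0\<close> every tail has a transform of modulus at least \<open>1/2\<close>.\<close>
  define \<rho> where "\<rho> = min (1/2) (1 / (4 * (Lip + 1)))"
  have \<rho>: "0 < \<rho>" "\<rho> \<le> 1/2" "Lip * (2 * \<rho>) \<le> 1/2"
  proof -
    show "0 < \<rho>" "\<rho> \<le> 1/2" using Lip by (auto simp: \<rho>_def)
    have "Lip * (2 * \<rho>) \<le> Lip * (2 * (1 / (4 * (Lip + 1))))"
      using Lip by (intro mult_left_mono) (auto simp: \<rho>_def)
    also have "\<dots> \<le> 1/2" using Lip by (simp add: field_simps)
    finally show "Lip * (2 * \<rho>) \<le> 1/2" .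
  qed
  define v where "v = half_cos \<rho>"
  have v: "0 \<le> v" "v < 1" using half_cos_bounds half_cos_less_1[OF \<rho>(1,2)] by (auto simp: v_def)
  obtain K where K: "K > 0" "v ^ K < 1 / (8 * (real K)\<^sup>2)" using exists_bump_exponent[OF v] by blast
  define \<delta> where "\<delta> = 1 / (16 * (real K)\<^sup>2)"
  have \<delta>: "\<delta> > 0" using K by (simp add: \<delta>_def)
  obtain J where J: "\<And>L q. length L = J \<Longrightarrow> \<forall>S\<in>set L. even_stage r R c S \<Longrightarrow> int_vec q \<Longrightarrow>
      norm q \<le> 2 * real K \<Longrightarrow> survival L q \<le> \<delta>"
    using survival_decay[OF r R \<delta>, of c "2 * real K"] by blast
  define \<kappa> where "\<kappa> = (1/4) ^ J * \<delta>"
  have \<kappa>: "\<kappa> > 0" using \<delta> by (simp add: \<kappa>_def)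
  define \<epsilon> where "\<epsilon> = sqrt \<kappa> / 2"
  define X where "X = insert None (Some ` bump_index K)"
  \<comment> \<open>The index \<open>None\<close> stands for the constant \<open>- v ^ K\<close>, minus the largest value of the bump far from \<open>0\<close>.\<close>
  define a where "a z = (case z of None \<Rightarrow> - (v ^ K) | Some x \<Rightarrow> bump_coeff K x)" for z
  define q where "q z = (case z of None \<Rightarrow> 0 | Some x \<Rightarrow> bump_freq x)" for z
  define G where "G = (\<lambda>L y. Re (\<Sum>z\<in>X. of_real (a z) * walk_exp L (q z) y))"
  have X: "finite X" "\<And>z. z \<in> X \<Longrightarrow> int_vec (q z)"
    by (auto simp: X_def finite_bump_index q_def bump_freq_int)
  have G_eq: "G L y = (\<Sum>x\<in>bump_index K. bump_coeff K x * Re (walk_exp L (bump_freq x) y)) - v ^ K * Re (walk_exp L 0 y)" for L y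
    unfolding G_def X_def
    by (subst sum.insert) (auto simp: finite_bump_index sum.reindex a_def q_def)
  have G_Nil: "G [] y = half_cos (y $ 1) ^ K * half_cos (y $ 2) ^ K - v ^ K" for y
  proof -
    have "half_cos (y $ 1) ^ K * half_cos (y $ 2) ^ K = Re (\<Sum>x\<in>bump_index K. of_real (bump_coeff K x) * ee (bump_freq x \<bullet> y))"
      unfolding bump_expansion[symmetric] by simp
    then show ?thesis unfolding G_eq by simp
  qed
  have G_ge: "G L y \<ge> \<delta>" if L: "length L = J" "\<forall>S\<in>set L. even_stage r R c S" for L y
  proof -
    let ?Z = "{x\<in>bump_index K. bump_freq x = 0}"
    have w0: "walk_exp L 0 y = 1" using L(2) by (intro walk_exp_0) auto
    have "(\<Sum>x\<in>bump_index K. bump_coeff K x * Re (walk_exp L (bump_freq x) y)) \<ge>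
       (\<Sum>x\<in>bump_index K. (if bump_freq x = 0 then bump_coeff K x else 0) - \<delta> * bump_coeff K x)"
    proof (rule sum_mono)
      fix x assume x: "x \<in> bump_index K"
      show "(if bump_freq x = 0 then bump_coeff K x else 0) - \<delta> * bump_coeff K x \<le> bump_coeff K x * Re (walk_exp L (bump_freq x) y)"
      proof (cases "bump_freq x = 0")
        case True
        then show ?thesis using w0 \<delta> bump_coeff_nonneg[of K x] by simp
      next
        case False
        have "- \<delta> \<le> Re (walk_exp L (bump_freq x) y)"
          using Re_walk_exp_ge[of L "bump_freq x" y] J[OF L bump_freq_int norm_bump_freq[OF x]] by linarith
        then have "bump_coeff K x * (- \<delta>) \<le> bump_coeff K x * Re (walk_exp L (bump_freq x) y)"
          by (rule mult_left_mono) (rule bump_coeff_nonneg)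
        then show ?thesis using False by (simp add: mult.commute)
      qed
    qed
    also have "(\<Sum>x\<in>bump_index K. (if bump_freq x = 0 then bump_coeff K x else 0) - \<delta> * bump_coeff K x)
      = (\<Sum>x\<in>?Z. bump_coeff K x) - \<delta>"
      by (simp add: sum_subtractf sum_distrib_left[symmetric] sum_bump_coeff sum.inter_filter finite_bump_index)
    finally have "G L y \<ge> (\<Sum>x\<in>?Z. bump_coeff K x) - \<delta> - v ^ K"
      unfolding G_eq w0 by simp
    moreover have "(\<Sum>x\<in>?Z. bump_coeff K x) \<ge> 4 * \<delta>"
      using bump_constant_coeff[OF K(1)] by (simp add: \<delta>_def)
    moreover have "v ^ K \<le> 2 * \<delta>" using K(2) by (simp add: \<delta>_def)
    ultimately show ?thesis by linarith
  qed
  have "\<exists>k. int_vec k \<and> \<epsilon> \<le> cmod (fourier (moran_measure M D) (x + k))"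
    if MD: "moran M D r R" "\<forall>n\<ge>1. even_stage r R c (M n, D n)" for M D x
  proof -
    interpret moran M D r R by (rule MD(1))
    interpret t: moran "\<lambda>n. M (n + J)" "\<lambda>n. D (n + J)" r R by (rule shift)
    let ?L = "map (\<lambda>j. (M j, D j)) [1..<Suc J]"
    have gs: "even_stage r R c S" if "S \<in> set ?L" for S using that MD(2) by auto
    obtain k where k: "int_vec k" "\<forall>i. \<bar>trajectory ?L (x + k) $ i\<bar> \<le> 1/2"
      "(1/4) ^ length ?L * G (rev ?L) x \<le> weight ?L (x + k) * G [] (trajectory ?L (x + k))"
      using choose_translate[where X=X and q=q and a=a, OF X gs] unfolding G_def by blast
    define y where "y = trajectory ?L (x + k)"
    have yk: "y = (x + k) v* inv_prod M J" unfolding y_def by (rule trajectory_stages)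
    have W: "weight ?L (x + k) = (cmod (fourier_partial M D J (x + k)))\<^sup>2" by (rule weight_stages)
    have len: "length ?L = J" by simp
    have "G (rev ?L) x \<ge> \<delta>" by (rule G_ge) (use len gs in \<open>auto simp del: upt_Suc\<close>)
    then have "\<kappa> \<le> (1/4) ^ J * G (rev ?L) x" unfolding \<kappa>_def by (intro mult_left_mono) auto
    then have low: "\<kappa> \<le> weight ?L (x + k) * G [] y" using k(3) unfolding len y_def by linarith
    have "G [] y \<le> 1"
    proof -
      have "half_cos (y $ 1) ^ K * half_cos (y $ 2) ^ K \<le> 1"
        by (intro mult_le_one power_le_one half_cos_bounds zero_le_power)
      moreover have "0 \<le> v ^ K" using v by simp
      ultimately show ?thesis unfolding G_Nil by linarith
    qed
    have Gpos: "G [] y > 0"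
    proof (rule ccontr)
      assume "\<not> G [] y > 0"
      then have "weight ?L (x + k) * G [] y \<le> 0"
        by (intro mult_nonneg_nonpos weight_bounds) simp
      then show False using low \<kappa> by linarith
    qed
    have "weight ?L (x + k) * G [] y \<le> weight ?L (x + k) * 1"
      by (intro mult_left_mono \<open>G [] y \<le> 1\<close> weight_bounds)
    then have "\<kappa> \<le> (cmod (fourier_partial M D J (x + k)))\<^sup>2" using low W by linarith
    then have fp: "sqrt \<kappa> \<le> cmod (fourier_partial M D J (x + k))"
      by (intro real_le_lsqrt) auto
    have near: "\<bar>y $ i\<bar> < \<rho>" for i
    proof (rule ccontr)
      assume "\<not> \<bar>y $ i\<bar> < \<rho>"
      then have "half_cos (y $ i) \<le> v"
        unfolding v_def using k(2) \<rho> by (intro half_cos_far) (auto simp: y_def)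
      then have le: "half_cos (y $ i) ^ K \<le> v ^ K" by (intro power_mono half_cos_bounds)
      have "half_cos (y $ 1) ^ K * half_cos (y $ 2) ^ K \<le> half_cos (y $ i) ^ K"
        using exhaust_2[of i]
        by (auto intro!: mult_left_le mult_right_le_one_le mult_left_le_one_le zero_le_power power_le_one half_cos_bounds)
      then show False using le Gpos unfolding G_Nil by linarith
    qed
    have "norm y \<le> (\<Sum>i\<in>UNIV. \<bar>y $ i\<bar>)" by (rule norm_le_l1_cart)
    also have "\<dots> \<le> 2 * \<rho>" using near[of 1] near[of 2] by (simp add: sum_2)
    finally have "Lip * norm y \<le> Lip * (2 * \<rho>)" using Lip by (intro mult_left_mono)
    then have "1/2 \<le> cmod (fourier t.\<mu> y)"
      using t.fourier_near_0[of y] \<rho>(3) unfolding Lip_def by linarith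
    then have "sqrt \<kappa> * (1/2) \<le> cmod (fourier_partial M D J (x + k)) * cmod (fourier t.\<mu> y)"
      using fp \<kappa> by (intro mult_mono) auto
    also have "\<dots> = cmod (fourier \<mu> (x + k))"
      using fourier_split[of "x + k" J] by (simp add: norm_mult yk)
    finally show ?thesis using k(1) by (intro exI[of _ k]) (simp add: \<epsilon>_def)
  qed
  moreover have "\<epsilon> > 0" using \<kappa> by (simp add: \<epsilon>_def)
  ultimately show ?thesis by blast
qed

section \<open>Construction of a spectrum\<close>

text \<open>Representatives of \<open>(1/2) \<int>\<^sup>2\<close> modulo \<open>\<int>\<^sup>2\<close>.\<close>

definition half_points :: "(real^2) set" where
  "half_points = {0, vector [1/2, 0], vector [0, 1/2], vector [1/2, 1/2]}"

lemma half_points_distinct: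
  "(0 :: real^2) \<noteq> vector [1/2, 0]" "(0 :: real^2) \<noteq> vector [0, 1/2]" "(0 :: real^2) \<noteq> vector [1/2, 1/2]"
  "(vector [1/2, 0] :: real^2) \<noteq> vector [0, 1/2]" "(vector [1/2, 0] :: real^2) \<noteq> vector [1/2, 1/2]"
  "(vector [0, 1/2] :: real^2) \<noteq> vector [1/2, 1/2]"
  by (simp_all add: vec_eq_iff forall_2)

lemma finite_half_points [simp]: "finite half_points"
  by (simp add: half_points_def)

lemma half_points_0: "0 \<in> half_points"
  by (simp add: half_points_def)

lemma half_points_int: "h \<in> half_points \<Longrightarrow> int_vec (2 *\<^sub>R h)"
  by (auto simp: half_points_def int_vec_def forall_2)

lemma half_points_diff: "h \<in> half_points \<Longrightarrow> h' \<in> half_points \<Longrightarrow> int_vec (h - h') \<Longrightarrow> h = h'"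
proof -
  have n: "(1/2 :: real) \<notin> \<int>" "(- (1/2) :: real) \<notin> \<int>"
    using half_of_int_Ints_iff[of 1] half_of_int_Ints_iff[of "-1"] by auto
  assume "h \<in> half_points" "h' \<in> half_points" "int_vec (h - h')"
  then show "h = h'" using n by (auto simp: half_points_def int_vec_def forall_2)
qed

lemma mask_half_odd:
  assumes ab: "odd_pair a b" and w: "int_vec (2 *\<^sub>R w)" "\<not> int_vec w"
  shows "mask (digits a b) w = 0"
proof -
  have i: "int_vec a" "int_vec b" using ab by (auto simp: odd_pair_def)
  have "2 * (w \<bullet> a) \<in> \<int>" "2 * (w \<bullet> b) \<in> \<int>"
    using int_vec_inner[OF w(1) i(1)] int_vec_inner[OF w(1) i(2)] by simp_all
  moreover have "\<not> (w \<bullet> a \<in> \<int> \<and> w \<bullet> b \<in> \<int>)"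
    using even_vec_iff_inner[OF ab w(1)] w(2) by (simp add: even_vec_def)
  ultimately show ?thesis unfolding mask_digits[OF ab] by (intro phi_eq_0I)
qed

text \<open>The pairings of the half points with an odd pair run through all parities, so this is \<open>sum_phi_half\<close>.\<close>

lemma sum_mask_half:
  assumes ab: "odd_pair a b"
  shows "(\<Sum>h\<in>half_points. (cmod (mask (digits a b) (y + h)))\<^sup>2) = 1"
proof -
  obtain a1 a2 b1 b2 where e: "a $ 1 = of_int a1" "a $ 2 = of_int a2" "b $ 1 = of_int b1" "b $ 2 = of_int b2"
    "odd (a1 * b2 - a2 * b1)"
    using odd_pairE[OF ab] .
  define \<psi> where "\<psi> k l = (cmod (phi (y \<bullet> a + of_int k / 2) (y \<bullet> b + of_int l / 2)))\<^sup>2" for k l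
  have per: "\<psi> k l = \<psi> (k mod 2) (l mod 2)" for k l
    unfolding \<psi>_def half_of_int_mod[of k] half_of_int_mod[of l] add.assoc[symmetric]
      by (simp only: phi_periodic[OF Ints_of_int Ints_of_int])
  have four: "\<psi> 0 0 + \<psi> 1 0 + \<psi> 0 1 + \<psi> 1 1 = 1"
    using sum_phi_half[of "y \<bullet> a" "y \<bullet> b"] by (simp add: \<psi>_def)
  have m: "(cmod (mask (digits a b) (y + h)))\<^sup>2 = \<psi> k l"
    if "h \<bullet> a = of_int k / 2" "h \<bullet> b = of_int l / 2" for h k l
    by (simp only: mask_digits[OF ab] inner_add_left that \<psi>_def)
  have "(\<Sum>h\<in>half_points. (cmod (mask (digits a b) (y + h)))\<^sup>2)
     = (cmod (mask (digits a b) (y + 0)))\<^sup>2 + (cmod (mask (digits a b) (y + vector [1/2, 0])))\<^sup>2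
      + (cmod (mask (digits a b) (y + vector [0, 1/2])))\<^sup>2 + (cmod (mask (digits a b) (y + vector [1/2, 1/2])))\<^sup>2"
    unfolding half_points_def using half_points_distinct by simp
  also have "\<dots> = \<psi> 0 0 + \<psi> a1 b1 + \<psi> a2 b2 + \<psi> (a1 + a2) (b1 + b2)"
    by (intro arg_cong2[where f="(+)"] m) (simp_all add: inner_vec_def sum_2 e add_divide_distrib)
  also have "\<dots> = \<psi> 0 0 + \<psi> (a1 mod 2) (b1 mod 2) + \<psi> (a2 mod 2) (b2 mod 2) + \<psi> ((a1 + a2) mod 2) ((b1 + b2) mod 2)"
    by (simp only: per[of a1 b1] per[of a2 b2] per[of "a1 + a2" "b1 + b2"])
  also have "\<dots> = 1"
    using e(5) four
    by (cases "even a1"; cases "even a2"; cases "even b1"; cases "even b2")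
      (simp_all add: mod2_eq_if add_ac)
  finally show ?thesis .
qed

text \<open>Evenness enters from the second matrix on: it makes the masks of the earlier levels invariant under half-integral
  changes of the next coordinate.\<close>

locale moran_hadamard = moran M D r R for M D r R +
  fixes c :: real
  assumes digits_D: "\<And>n. n \<ge> 1 \<Longrightarrow> \<exists>a b. odd_pair a b \<and> D n = digits a b"
    and good: "\<And>n. n \<ge> 2 \<Longrightarrow> even_stage r R c (M n, D n)"
begin

text \<open>The map \<open>x \<mapsto> x M\<^sub>n \<dots> M\<^sub>1\<close>, inverse to multiplication by \<open>inv_prod M n\<close>.\<close>

fun expand :: "nat \<Rightarrow> real^2 \<Rightarrow> real^2" where
  "expand 0 x = x"
| "expand (Suc n) x = expand n (x v* M (Suc n))"

lemma expand_diff: "expand n (x - y) = expand n x - expand n y"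
  by (induction n arbitrary: x y) (simp_all add: vector_matrix_mult_diff_distrib)

lemma expand_inv_prod: "expand n x v* inv_prod M n = x"
proof (induction n arbitrary: x)
  case (Suc n)
  have "expand (Suc n) x v* inv_prod M (Suc n) = (expand n (x v* M (Suc n)) v* inv_prod M n) v* matrix_inv (M (Suc n))"
    by (simp add: vector_matrix_mul_assoc)
  also have "\<dots> = x" unfolding Suc.IH using matrix_inv_mult[OF inv_M, of "Suc n"] by (simp add: vector_matrix_mul_assoc)
  finally show ?case .
qed simp

lemma mask_D_periodic: "n \<ge> 1 \<Longrightarrow> int_vec k \<Longrightarrow> mask (D n) (y + k) = mask (D n) y"
  using digits_D mask_periodic by metis

lemma int_vec_half_M:
  assumes "n \<ge> 2" "int_vec (2 *\<^sub>R z)"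
  shows "int_vec (z v* M n)"
proof -
  have "int_mat ((1/2) *\<^sub>R M n)" using good[OF assms(1)] by (auto elim: even_stageE)
  then have "int_vec ((2 *\<^sub>R z) v* ((1/2) *\<^sub>R M n))" by (rule int_vec_mult_mat) (rule assms(2))
  also have "(2 *\<^sub>R z) v* ((1/2) *\<^sub>R M n) = z v* M n"
    by (simp add: vec_eq_iff vector_matrix_mult_def)
  finally show ?thesis .
qed

lemma fourier_partial_periodic:
  "int_vec z \<Longrightarrow> fourier_partial M D n (\<xi> + expand n z) = fourier_partial M D n \<xi>"
proof (induction n arbitrary: z)
  case (Suc n)
  have "fourier_partial M D n (\<xi> + expand n (z v* M (Suc n))) = fourier_partial M D n \<xi>"
  proof (cases "n = 0")
    case False
    have "int_vec (2 *\<^sub>R z)" using Suc.prems by (intro int_vec_scale) auto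
    then have "int_vec (z v* M (Suc n))" using False by (intro int_vec_half_M) auto
    then show ?thesis by (rule Suc.IH)
  qed simp
  moreover have "mask (D (Suc n)) ((\<xi> + expand (Suc n) z) v* inv_prod M (Suc n)) = mask (D (Suc n)) (\<xi> v* inv_prod M (Suc n))"
    unfolding vector_matrix_left_distrib expand_inv_prod by (rule mask_D_periodic) (use Suc.prems in auto)
  ultimately show ?case by (simp add: fourier_partial_Suc del: inv_prod.simps)
qed simp

text \<open>An even matrix maps half-integral vectors to integral ones, so the earlier masks do not see the
  half-integral part of a new coordinate.  Below the first level there are no earlier masks.\<close>

lemma fourier_partial_half_periodic:
  assumes "int_vec (2 *\<^sub>R z)"
  shows "fourier_partial M D n (\<xi> + expand (Suc n) z) = fourier_partial M D n \<xi>"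
proof (cases "n = 0")
  case False
  then have "int_vec (z v* M (Suc n))" using assms by (intro int_vec_half_M) auto
  then show ?thesis using fourier_partial_periodic by simp
qed simp

abbreviation tail :: "nat \<Rightarrow> (real^2) measure" where
  "tail n \<equiv> moran_measure (\<lambda>k. M (k + n)) (\<lambda>k. D (k + n))"

lemma tail_Suc: "fourier (tail n) (\<xi> v* inv_prod M n) =
   mask (D (Suc n)) (\<xi> v* inv_prod M (Suc n)) * fourier (tail (Suc n)) (\<xi> v* inv_prod M (Suc n))"
proof -
  interpret s: moran "\<lambda>k. M (k + n)" "\<lambda>k. D (k + n)" r R by (rule shift)
  show ?thesis using s.fourier_split_1[of "\<xi> v* inv_prod M n"] by (simp add: vector_matrix_mul_assoc)
qed

context
  fixes \<kappa> :: "nat \<Rightarrow> real^2 \<Rightarrow> real^2" and \<epsilon> :: real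
  assumes \<kappa>_int: "\<And>n x. n \<ge> 1 \<Longrightarrow> int_vec (\<kappa> n x)"
    and \<kappa>_pos: "\<And>n x. n \<ge> 1 \<Longrightarrow> \<epsilon> \<le> cmod (fourier (tail n) (x + \<kappa> n x))"
    and \<epsilon>: "0 < \<epsilon>"
begin

text \<open>The coordinate of a new point: the half point, moved by the integer vector that keeps the transform of the tail
  large.  The class of \<open>0\<close> keeps the coordinate \<open>0\<close>, so that the finite levels increase.\<close>

definition shifted_half :: "nat \<Rightarrow> (real^2) \<times> (real^2) \<Rightarrow> real^2" where
  "shifted_half n p = (if snd p = 0 then 0
     else snd p + \<kappa> (Suc n) (fst p v* inv_prod M (Suc n) + snd p))"

definition child :: "nat \<Rightarrow> (real^2) \<times> (real^2) \<Rightarrow> real^2" where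
  "child n p = fst p + expand (Suc n) (shifted_half n p)"

text \<open>The \<open>4\<^sup>n\<close> points with \<open>n\<close> coordinates.\<close>

fun level :: "nat \<Rightarrow> (real^2) set" where
  "level 0 = {0}"
| "level (Suc n) = child n ` (level n \<times> half_points)"

lemma shifted_half_cong: "int_vec (shifted_half n p - snd p)"
  by (simp add: shifted_half_def \<kappa>_int)

lemma shifted_half_int: "snd p \<in> half_points \<Longrightarrow> int_vec (2 *\<^sub>R shifted_half n p)"
proof -
  assume "snd p \<in> half_points"
  then have "int_vec (2 *\<^sub>R (shifted_half n p - snd p) + 2 *\<^sub>R snd p)"
    by (intro int_vec_add int_vec_scale shifted_half_cong half_points_int) auto
  then show ?thesis by (simp add: scaleR_diff_right)
qed

lemma finite_level: "finite (level n)"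
  by (induction n) auto

lemma level_mono: "level n \<subseteq> level (n + k)"
proof (induction k)
  case (Suc k)
  have "child (n + k) (l, 0) = l" for l
    using expand_diff[of "Suc (n + k)" 0 0] by (simp add: child_def shifted_half_def)
  then have "level (n + k) \<subseteq> level (Suc (n + k))"
    using half_points_0 by (force intro: image_eqI[of _ _ "(_, 0)"])
  with Suc show ?case by auto
qed simp

lemma fourier_partial_child_diff:
  assumes p: "snd p \<in> half_points" "snd p' \<in> half_points" "p \<noteq> p'"
    and orth: "fst p \<noteq> fst p' \<Longrightarrow> fourier_partial M D n (fst p - fst p') = 0"
  shows "fourier_partial M D (Suc n) (child n p - child n p') = 0"
proof -
  define z where "z = shifted_half n p - shifted_half n p'"
  have z: "int_vec (2 *\<^sub>R z)"
    unfolding z_def scaleR_diff_right by (intro int_vec_diff shifted_half_int p)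
  have eq: "child n p - child n p' = (fst p - fst p') + expand (Suc n) z"
    by (simp add: child_def z_def expand_diff del: expand.simps)
  show ?thesis
  proof (cases "fst p = fst p'")
    case False
    have "fourier_partial M D n (child n p - child n p') = 0"
      unfolding eq fourier_partial_half_periodic[OF z] by (rule orth[OF False])
    then show ?thesis by (simp add: fourier_partial_Suc)
  next
    case True
    then have "snd p \<noteq> snd p'" using p(3) by (auto simp: prod_eq_iff)
    then have n: "\<not> int_vec (snd p - snd p')" using half_points_diff p(1,2) by blast
    have "\<not> int_vec z"
    proof
      assume "int_vec z"
      then have "int_vec (z - (shifted_half n p - snd p) + (shifted_half n p' - snd p'))"
        by (intro int_vec_add int_vec_diff shifted_half_cong)
      then show False using n by (simp add: z_def algebra_simps)
    qed
    moreover obtain a b where "odd_pair a b" "D (Suc n) = digits a b" using digits_D[of "Suc n"] by auto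
    ultimately have "mask (D (Suc n)) z = 0" using mask_half_odd z by simp
    moreover have "(child n p - child n p') v* inv_prod M (Suc n) = z"
      unfolding eq using True by (simp add: expand_inv_prod del: inv_prod.simps expand.simps)
    ultimately show ?thesis by (simp add: fourier_partial_Suc del: inv_prod.simps)
  qed
qed

lemma fourier_partial_at_0: "fourier_partial M D n 0 = 1"
  unfolding fourier_partial_def by (rule prod.neutral) (simp add: mask_0 finite_D D_nonempty)

lemma level_orthogonal:
  "l \<in> level n \<Longrightarrow> l' \<in> level n \<Longrightarrow> l \<noteq> l' \<Longrightarrow> fourier_partial M D n (l - l') = 0"
proof (induction n arbitrary: l l')
  case (Suc n)
  obtain p p' where p: "l = child n p" "p \<in> level n \<times> half_points" "l' = child n p'" "p' \<in> level n \<times> half_points"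
    using Suc.prems by auto
  show ?case unfolding p(1,3)
  proof (rule fourier_partial_child_diff)
    show "p \<noteq> p'" using p Suc.prems(3) by auto
    show "fst p \<noteq> fst p' \<Longrightarrow> fourier_partial M D n (fst p - fst p') = 0" using p by (intro Suc.IH) auto
  qed (use p in auto)
qed simp

lemma inj_child: "inj_on (child n) (level n \<times> half_points)"
proof (rule inj_onI, rule ccontr)
  fix p p' assume p: "p \<in> level n \<times> half_points" "p' \<in> level n \<times> half_points" "child n p = child n p'" "p \<noteq> p'"
  have "fourier_partial M D (Suc n) (child n p - child n p') = 0"
    by (rule fourier_partial_child_diff) (use p level_orthogonal in auto)
  then show False using p(3) fourier_partial_at_0[of "Suc n"] by simp
qed

text \<open>Four children share the weight of their parent according to the squared moduli of the mask at the half points.\<close>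

lemma level_parseval: "(\<Sum>l\<in>level n. (cmod (fourier_partial M D n (\<xi> + l)))\<^sup>2) = 1"
proof (induction n)
  case (Suc n)
  obtain a b where ab: "odd_pair a b" "D (Suc n) = digits a b" using digits_D[of "Suc n"] by auto
  have step: "(cmod (fourier_partial M D (Suc n) (\<xi> + child n p)))\<^sup>2 = (cmod (fourier_partial M D n (\<xi> + fst p)))\<^sup>2
      * (cmod (mask (D (Suc n)) ((\<xi> + fst p) v* inv_prod M (Suc n) + snd p)))\<^sup>2"
    if p: "p \<in> level n \<times> half_points" for p
  proof -
    have z: "int_vec (2 *\<^sub>R shifted_half n p)" using p by (intro shifted_half_int) auto
    have eq: "\<xi> + child n p = (\<xi> + fst p) + expand (Suc n) (shifted_half n p)"
      by (simp add: child_def add.assoc del: expand.simps)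
    have eq2: "(\<xi> + child n p) v* inv_prod M (Suc n) = ((\<xi> + fst p) v* inv_prod M (Suc n) + snd p) + (shifted_half n p - snd p)"
      unfolding eq vector_matrix_left_distrib expand_inv_prod by (simp del: inv_prod.simps)
    have "mask (D (Suc n)) ((\<xi> + child n p) v* inv_prod M (Suc n)) = mask (D (Suc n)) ((\<xi> + fst p) v* inv_prod M (Suc n) + snd p)"
      unfolding eq2 by (rule mask_D_periodic[OF _ shifted_half_cong]) simp
    moreover have "fourier_partial M D n (\<xi> + child n p) = fourier_partial M D n (\<xi> + fst p)"
      unfolding eq by (rule fourier_partial_half_periodic[OF z])
    ultimately show ?thesis by (simp add: fourier_partial_Suc norm_mult power_mult_distrib del: inv_prod.simps)
  qed
  have "(\<Sum>l\<in>level (Suc n). (cmod (fourier_partial M D (Suc n) (\<xi> + l)))\<^sup>2)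
     = (\<Sum>p\<in>level n \<times> half_points. (cmod (fourier_partial M D (Suc n) (\<xi> + child n p)))\<^sup>2)"
    unfolding level.simps by (rule sum.reindex_cong[OF inj_child refl refl])
  also have "\<dots> = (\<Sum>p\<in>level n \<times> half_points. (cmod (fourier_partial M D n (\<xi> + fst p)))\<^sup>2
      * (cmod (mask (D (Suc n)) ((\<xi> + fst p) v* inv_prod M (Suc n) + snd p)))\<^sup>2)"
    by (rule sum.cong[OF refl step])
  also have "\<dots> = (\<Sum>l\<in>level n. \<Sum>h\<in>half_points. (cmod (fourier_partial M D n (\<xi> + l)))\<^sup>2
      * (cmod (mask (D (Suc n)) ((\<xi> + l) v* inv_prod M (Suc n) + h)))\<^sup>2)"
    by (simp add: sum.cartesian_product case_prod_beta del: inv_prod.simps)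
  also have "\<dots> = (\<Sum>l\<in>level n. (cmod (fourier_partial M D n (\<xi> + l)))\<^sup>2)"
    unfolding sum_distrib_left[symmetric] ab(2) sum_mask_half[OF ab(1)] by simp
  finally show ?case using Suc by simp
qed simp

text \<open>New points have the lower bound by the choice of \<open>\<kappa>\<close>.  Old points inherit it, because the transform of a tail
  is a mask value times the transform of the next tail.\<close>

lemma tail_lower_bound:
  assumes "\<epsilon> \<le> 1"
  shows "l \<in> level n \<Longrightarrow> \<epsilon> \<le> cmod (fourier (tail n) (l v* inv_prod M n))"
proof (induction n arbitrary: l)
  case 0
  interpret s: moran "\<lambda>k. M (k + 0)" "\<lambda>k. D (k + 0)" r R by (rule shift)
  show ?case using 0 assms by (simp add: fourier_0[OF prob_\<mu>])
next
  case (Suc n)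
  obtain p where p: "l = child n p" "p \<in> level n \<times> half_points" using Suc.prems by auto
  show ?case
  proof (cases "snd p = 0")
    case True
    then have "l = fst p" using expand_diff[of "Suc n" 0 0] by (simp add: p(1) child_def shifted_half_def)
    then have "l \<in> level n" using p(2) by (simp add: mem_Times_iff)
    then have "\<epsilon> \<le> cmod (fourier (tail n) (l v* inv_prod M n))" by (rule Suc.IH)
    also have "\<dots> \<le> cmod (fourier (tail (Suc n)) (l v* inv_prod M (Suc n)))"
      unfolding tail_Suc[of n l] norm_mult by (rule mult_left_le_one_le) (auto simp: norm_mask_le)
    finally show ?thesis .
  next
    case False
    have "l v* inv_prod M (Suc n) = fst p v* inv_prod M (Suc n) + shifted_half n p"
      unfolding p(1) child_def vector_matrix_left_distrib expand_inv_prod ..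
    also have "\<dots> = (fst p v* inv_prod M (Suc n) + snd p) + \<kappa> (Suc n) (fst p v* inv_prod M (Suc n) + snd p)"
      using False by (simp add: shifted_half_def add.assoc del: inv_prod.simps)
    finally show ?thesis using \<kappa>_pos[of "Suc n"] by (simp del: inv_prod.simps)
  qed
qed

definition candidate_spectrum :: "(real^2) set" where
  "candidate_spectrum = (\<Union>n. level n)"

lemma candidate_spectrum_common:
  assumes "finite F" "F \<subseteq> candidate_spectrum"
  shows "\<exists>n. F \<subseteq> level n"
  using assms
proof (induction F rule: finite_induct)
  case (insert l F)
  then obtain n m where "F \<subseteq> level n" "l \<in> level m" by (auto simp: candidate_spectrum_def)
  then have "insert l F \<subseteq> level (n + m)" using level_mono[of n m] level_mono[of m n] by (auto simp: add.commute)
  then show ?case by blast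
qed simp

lemma countable_candidate_spectrum: "countable candidate_spectrum"
  unfolding candidate_spectrum_def by (rule countable_UN) (simp_all add: countable_finite finite_level)

lemma candidate_spectrum_orthogonal: "orthogonal_exponentials \<mu> candidate_spectrum"
  unfolding orthogonal_exponentials_def
proof (intro ballI impI)
  fix l l' assume l: "l \<in> candidate_spectrum" "l' \<in> candidate_spectrum" "l \<noteq> l'"
  obtain n where "{l, l'} \<subseteq> level n" using candidate_spectrum_common[of "{l, l'}"] l by auto
  then have "fourier_partial M D n (l - l') = 0" using l by (intro level_orthogonal) auto
  then show "fourier \<mu> (l - l') = 0" using fourier_split[of "l - l'" n] by simp
qed

text \<open>Let \<open>S\<close> be the Parseval sum.  Outside level \<open>N\<close> the weights at level \<open>n\<close> are dominated by a constant times the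
  terms of \<open>S\<close>, so the total weight \<open>1\<close> at level \<open>n\<close> exceeds the weight of level \<open>N\<close> by at most a constant times the
  remainder of \<open>S\<close>.  Letting \<open>n\<close> and then \<open>N\<close> tend to infinity gives \<open>1 \<le> S\<close>.\<close>

lemma candidate_spectrum_complete:
  assumes e1: "\<epsilon> \<le> 1"
  shows "((\<lambda>l. (cmod (fourier \<mu> (\<xi> + l)))\<^sup>2) has_sum 1) candidate_spectrum"
proof -
  interpret b: borel_prob \<mu> by (rule borel_prob_\<mu>)
  define f where "f l = (cmod (fourier \<mu> (\<xi> + l)))\<^sup>2" for l
  define g where "g n l = (cmod (fourier_partial M D n (\<xi> + l)))\<^sup>2" for n l
  have f0: "0 \<le> f l" for l by (simp add: f_def)
  have bes: "sum f F \<le> 1" if "finite F" "F \<subseteq> candidate_spectrum" for F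
    unfolding f_def using b.Bessel[OF that(1) orthogonal_exponentials_subset[OF candidate_spectrum_orthogonal that(2)]] .
  have sm: "f summable_on candidate_spectrum"
    by (rule nonneg_bdd_above_summable_on) (use f0 bes in \<open>auto intro!: bdd_aboveI[of _ 1]\<close>)
  define S where "S = infsum f candidate_spectrum"
  have hs: "(f has_sum S) candidate_spectrum" unfolding S_def using sm by (rule has_sum_infsum)
  have S1: "S \<le> 1" using hs bes by (rule has_sum_le_finite_sums)
  have sum_le_S: "sum f F \<le> S" if "finite F" "F \<subseteq> candidate_spectrum" for F
    using finite_sum_le_has_sum[OF hs that(1,2)] f0 by auto
  define C where "C = 4 / \<epsilon>\<^sup>2"
  have C: "C > 0" using \<epsilon> by (simp add: C_def)
  have "(\<lambda>n. 2 * pi * R / (1 - r) * (r ^ n * norm \<xi>)) \<longlonglongrightarrow> 2 * pi * R / (1 - r) * (0 * norm \<xi>)"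
    using r_nonneg r_less_1 by (intro tendsto_intros LIMSEQ_realpow_zero) auto
  then have "\<forall>\<^sub>F n in sequentially. 2 * pi * R / (1 - r) * (r ^ n * norm \<xi>) < \<epsilon> / 2"
    by (rule order_tendstoD) (use \<epsilon> in auto)
  then obtain n0 where n0: "\<And>n. n \<ge> n0 \<Longrightarrow> 2 * pi * R / (1 - r) * (r ^ n * norm \<xi>) < \<epsilon> / 2"
    by (auto simp: eventually_sequentially)
  have gf: "g n l \<le> C * f l" if n: "n \<ge> n0" and l: "l \<in> level n" for n l
  proof -
    interpret s: moran "\<lambda>k. M (k + n)" "\<lambda>k. D (k + n)" r R by (rule shift)
    let ?t = "fourier (tail n)"
    have "cmod (?t (l v* inv_prod M n) - ?t ((\<xi> + l) v* inv_prod M n))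
       \<le> 2 * pi * R / (1 - r) * norm (l v* inv_prod M n - (\<xi> + l) v* inv_prod M n)"
      by (rule s.fourier_Lipschitz)
    also have "norm (l v* inv_prod M n - (\<xi> + l) v* inv_prod M n) = norm (\<xi> v* inv_prod M n)"
      by (simp add: vector_matrix_left_distrib norm_minus_commute)
    also have "2 * pi * R / (1 - r) * norm (\<xi> v* inv_prod M n) \<le> 2 * pi * R / (1 - r) * (r ^ n * norm \<xi>)"
      using R_nonneg r_less_1 by (intro mult_left_mono inv_prod_contraction') auto
    finally have "cmod (?t (l v* inv_prod M n) - ?t ((\<xi> + l) v* inv_prod M n)) < \<epsilon> / 2" using n0[OF n] by linarith
    then have "\<epsilon> / 2 \<le> cmod (?t ((\<xi> + l) v* inv_prod M n))"
      using tail_lower_bound[OF e1 l] norm_triangle_ineq2[of "?t (l v* inv_prod M n)" "?t ((\<xi> + l) v* inv_prod M n)"] by linarith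
    then have "(\<epsilon> / 2)\<^sup>2 \<le> (cmod (?t ((\<xi> + l) v* inv_prod M n)))\<^sup>2" using \<epsilon> by (intro power_mono) auto
    then have "g n l * (\<epsilon> / 2)\<^sup>2 \<le> g n l * (cmod (?t ((\<xi> + l) v* inv_prod M n)))\<^sup>2"
      by (intro mult_left_mono) (auto simp: g_def)
    also have "\<dots> = f l" by (simp add: f_def g_def fourier_split[of "\<xi> + l" n] norm_mult power_mult_distrib)
    finally show ?thesis using \<epsilon> by (simp add: C_def field_simps)
  qed
  have lim: "(\<lambda>n. g n l) \<longlonglongrightarrow> f l" for l
    unfolding g_def f_def by (intro tendsto_intros fourier_partial_tendsto)
  have key: "1 \<le> sum f (level N) + C * (S - sum f (level N))" for N
  proof (rule LIMSEQ_le_const)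
    show "(\<lambda>n. sum (g n) (level N) + C * (S - sum f (level N))) \<longlonglongrightarrow> sum f (level N) + C * (S - sum f (level N))"
      by (intro tendsto_intros lim)
    show "\<exists>n1. \<forall>n\<ge>n1. 1 \<le> sum (g n) (level N) + C * (S - sum f (level N))"
    proof (intro exI[of _ "max n0 N"] allI impI)
      fix n assume n: "n \<ge> max n0 N"
      have sub: "level N \<subseteq> level n" using level_mono[of N "n - N"] n by simp
      have "1 = sum (g n) (level n)" unfolding g_def by (rule level_parseval[symmetric])
      also have "\<dots> = sum (g n) (level n - level N) + sum (g n) (level N)"
        by (rule sum.subset_diff[OF sub finite_level])
      also have "sum (g n) (level n - level N) \<le> (\<Sum>l\<in>level n - level N. C * f l)"
        using n by (intro sum_mono gf) auto
      also have "\<dots> = C * (sum f (level n) - sum f (level N))"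
        using sum.subset_diff[OF sub finite_level, of f] by (simp add: sum_distrib_left[symmetric])
      also have "\<dots> \<le> C * (S - sum f (level N))"
        using C sum_le_S[of "level n"] finite_level by (intro mult_left_mono) (auto simp: candidate_spectrum_def)
      finally show "1 \<le> sum (g n) (level N) + C * (S - sum f (level N))" by simp
    qed
  qed
  have "1 \<le> S"
  proof (rule field_le_epsilon)
    fix e :: real assume e: "e > 0"
    then have "e / C > 0" using C by simp
    then obtain F where F: "finite F" "F \<subseteq> candidate_spectrum" "dist (sum f F) S \<le> e / C"
      using has_sum_finite_approximation[OF hs] by blast
    obtain N where N: "F \<subseteq> level N" using candidate_spectrum_common[OF F(1,2)] by blast
    have sN: "level N \<subseteq> candidate_spectrum" by (auto simp: candidate_spectrum_def)
    have "sum f F \<le> sum f (level N)" using N f0 by (intro sum_mono2 finite_level) auto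
    then have "S - sum f (level N) \<le> e / C" using F(3) by (simp add: dist_real_def abs_le_iff)
    then have "C * (S - sum f (level N)) \<le> e" using C by (simp add: field_simps)
    then show "1 \<le> S + e" using key[of N] sum_le_S[OF finite_level sN] by linarith
  qed
  then have "S = 1" using S1 by simp
  moreover have "f = (\<lambda>l. (cmod (fourier \<mu> (\<xi> + l)))\<^sup>2)" by (rule ext) (rule f_def)
  ultimately show ?thesis using hs by (simp only:)
qed

end

text \<open>The translates come from \<open>equi_positivity\<close>, whose constant serves all tails at once.  Distinct points of the
  candidate differ by zeros of the transform, and by the Lipschitz bound these stay away from \<open>0\<close>, so the set is discrete.\<close>

lemma sufficiency: "\<exists>\<Lambda>. spectrum_of \<mu> \<Lambda>"
proof -
  from equi_positivity[OF r_nonneg r_less_1 R_nonneg, of c]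
  obtain \<epsilon>0 where \<epsilon>0: "\<epsilon>0 > 0 \<and> (\<forall>M D. moran M D r R \<longrightarrow> (\<forall>n\<ge>1. even_stage r R c (M n, D n)) \<longrightarrow>
    (\<forall>x. \<exists>k. int_vec k \<and> \<epsilon>0 \<le> cmod (fourier (moran_measure M D) (x + k))))"
    by (elim exE)
  define \<epsilon> where "\<epsilon> = min \<epsilon>0 1"
  have \<epsilon>: "0 < \<epsilon>" "\<epsilon> \<le> 1" using \<epsilon>0 by (auto simp: \<epsilon>_def)
  have ex: "\<exists>k. int_vec k \<and> \<epsilon> \<le> cmod (fourier (tail n) (x + k))" if n: "n \<ge> 1" for n x
  proof -
    have "\<forall>m\<ge>1. even_stage r R c (M (m + n), D (m + n))" using n by (intro allI impI good) auto
    from \<epsilon>0[THEN conjunct2, THEN spec, THEN spec, THEN mp, OF shift, THEN mp, OF this, THEN spec, of x]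
    obtain k where "int_vec k \<and> \<epsilon>0 \<le> cmod (fourier (tail n) (x + k))" by (elim exE)
    then show ?thesis by (intro exI[of _ k]) (auto simp: \<epsilon>_def)
  qed
  define \<kappa> where "\<kappa> n x = (SOME k. int_vec k \<and> \<epsilon> \<le> cmod (fourier (tail n) (x + k)))" for n x
  have \<kappa>: "int_vec (\<kappa> n x) \<and> \<epsilon> \<le> cmod (fourier (tail n) (x + \<kappa> n x))" if "n \<ge> 1" for n x
    unfolding \<kappa>_def by (rule someI_ex) (rule ex[OF that])
  note \<kappa>1 = \<kappa>[THEN conjunct1] and \<kappa>2 = \<kappa>[THEN conjunct2]
  interpret b: borel_prob \<mu> by (rule borel_prob_\<mu>)
  let ?\<Lambda> = "candidate_spectrum \<kappa>"
  have orth: "orthogonal_exponentials \<mu> ?\<Lambda>" by (rule candidate_spectrum_orthogonal[OF \<kappa>1 \<kappa>2 \<epsilon>(1)])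
  have "countable ?\<Lambda>" by (rule countable_candidate_spectrum[OF \<kappa>1 \<kappa>2 \<epsilon>(1)])
  moreover have "topological_space_class.discrete ?\<Lambda>"
  proof (rule discreteI)
    fix l assume l: "l \<in> ?\<Lambda>"
    define Lip where "Lip = 2 * pi * R / (1 - r)"
    have Lip: "0 \<le> Lip" using R_nonneg r_less_1 by (simp add: Lip_def)
    define d where "d = 1 / (Lip + 1)"
    have d: "d > 0" "Lip * d < 1" using Lip by (simp_all add: d_def)
    have "y = l" if y: "y \<in> ?\<Lambda>" "dist l y < d" for y
    proof (rule ccontr)
      assume "y \<noteq> l"
      then have "l \<noteq> y" by simp
      with orth l y(1) have "fourier \<mu> (l - y) = 0" by (auto simp: orthogonal_exponentials_def)
      then have "1 \<le> Lip * norm (l - y)" using fourier_near_0[of "l - y"] unfolding Lip_def by simp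
      also have "\<dots> \<le> Lip * d" using Lip y(2) by (intro mult_left_mono) (auto simp: dist_norm)
      finally show False using d(2) by simp
    qed
    then show "l isolated_in ?\<Lambda>" unfolding isolated_in_dist_Ex_iff using l d(1) by (intro conjI exI[of _ d]) auto
  qed
  moreover have "\<forall>\<xi>. ((\<lambda>l. (cmod (fourier \<mu> (\<xi> + l)))\<^sup>2) has_sum 1) ?\<Lambda>"
    by (intro allI candidate_spectrum_complete[OF \<kappa>1 \<kappa>2 \<epsilon>(1)] \<epsilon>(2))
  ultimately have "spectrum_of \<mu> ?\<Lambda>"
    unfolding b.spectrum_of_iff_parseval[OF AE_\<mu>] by (intro conjI orth)
  then show ?thesis by (rule exI)
qed

end

section \<open>The characterisation\<close>

text \<open>The norms are nonnegative and their supremum is below \<open>1\<close>, so it is a real number.\<close>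

lemma contraction_bound:
  fixes M :: "nat \<Rightarrow> real^2^2"
  assumes "(SUP n\<in>{1..}. ereal (onorm ((*v) (matrix_inv (M n))))) < 1"
  shows "\<exists>r. 0 \<le> r \<and> r < 1 \<and> (\<forall>n\<ge>1. \<forall>v. norm (matrix_inv (M n) *v v) \<le> r * norm v)"
proof -
  let ?s = "SUP n\<in>{1..}. ereal (onorm ((*v) (matrix_inv (M n))))"
  have bl: "bounded_linear ((*v) (matrix_inv (M n)))" for n by (rule matrix_vector_mul_bounded_linear)
  have up: "ereal (onorm ((*v) (matrix_inv (M n)))) \<le> ?s" if "n \<ge> 1" for n
    using that by (intro SUP_upper) auto
  have "0 \<le> ereal (onorm ((*v) (matrix_inv (M 1))))" using onorm_pos_le[OF bl] by simp
  then have s0: "0 \<le> ?s" using up[of 1] by (rule order_trans) simp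
  then obtain r where r: "?s = ereal r" using assms by (cases ?s) auto
  have "norm (matrix_inv (M n) *v v) \<le> r * norm v" if "n \<ge> 1" for n v
  proof -
    have "norm (matrix_inv (M n) *v v) \<le> onorm ((*v) (matrix_inv (M n))) * norm v" by (rule onorm[OF bl])
    also have "\<dots> \<le> r * norm v" using up[OF that] unfolding r by (intro mult_right_mono) auto
    finally show ?thesis .
  qed
  then show ?thesis using s0 assms unfolding r by (intro exI[of _ r]) (auto simp: one_ereal_def)
qed

lemma odd_common_multiple:
  fixes K :: "int set"
  assumes "finite K" "\<And>k. k \<in> K \<Longrightarrow> odd k"
  shows "\<exists>c>0. odd c \<and> (\<forall>k\<in>K. k dvd c)"
  using assms
proof (induction K rule: finite_induct)
  case empty
  show ?case by (intro exI[of _ 1]) auto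
next
  case (insert k K)
  then obtain c where c: "c > 0" "odd c" "\<forall>k\<in>K. k dvd c" by auto
  have "odd k" using insert by simp
  then have "k \<noteq> 0" by auto
  then show ?case using c \<open>odd k\<close> by (intro exI[of _ "\<bar>k\<bar> * c"]) auto
qed

theorem theorem1p3:
  fixes M :: "nat \<Rightarrow> real^2^2" and D :: "nat \<Rightarrow> (real^2) set"
    and \<alpha>1 \<alpha>2 \<beta>1 \<beta>2 :: "nat \<Rightarrow> int"
  assumes M_GL: "\<And>n. n \<ge> 1 \<Longrightarrow> M n \<in> GL2 \<int>"
    and M_expanding: "\<And>n. n \<ge> 1 \<Longrightarrow> expanding (M n)"
    and D_eq: "\<And>n. n \<ge> 1 \<Longrightarrow> D n =
      {vector [0, 0],
       vector [of_int (\<alpha>1 n), of_int (\<alpha>2 n)],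
       vector [of_int (\<beta>1 n), of_int (\<beta>2 n)],
       vector [of_int (- \<alpha>1 n - \<beta>1 n), of_int (- \<alpha>2 n - \<beta>2 n)]}"
    and D_mod: "\<And>n. n \<ge> 1 \<Longrightarrow> \<not> [\<alpha>1 n * \<beta>2 n - \<alpha>2 n * \<beta>1 n = 0] (mod 2)"
    and det_gt: "\<And>n. n \<ge> 1 \<Longrightarrow> \<bar>det (M n)\<bar> > 4"
    and norm_inv: "(SUP n\<in>{1..}. ereal (onorm ((*v) (matrix_inv (M n))))) < 1"
    and D_finite: "finite (D ` {1..})"
  shows "spectral_measure (moran_measure M D) \<longleftrightarrow> (\<forall>n\<ge>2. M n \<in> GL2 even_Ints)"
proof -
  define a where "a n = (vector [of_int (\<alpha>1 n), of_int (\<alpha>2 n)] :: real^2)" for n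
  define b where "b n = (vector [of_int (\<beta>1 n), of_int (\<beta>2 n)] :: real^2)" for n
  define k where "k n = \<alpha>1 n * \<beta>2 n - \<alpha>2 n * \<beta>1 n" for n
  have cross: "cross (a n) (b n) = of_int (k n)" for n
    by (simp add: cross_def a_def b_def k_def)
  have odd_k: "odd (k n)" if "n \<ge> 1" for n
    using D_mod[OF that] by (simp add: k_def cong_0_iff)
  have ab: "odd_pair (a n) (b n)" if "n \<ge> 1" for n
    unfolding odd_pair_def using cross odd_k[OF that] by (auto simp: a_def b_def int_vec_def forall_2)
  have Dd: "D n = digits (a n) (b n)" if "n \<ge> 1" for n
  proof -
    have "(vector [0, 0] :: real^2) = 0"
      "(vector [of_int (- \<alpha>1 n - \<beta>1 n), of_int (- \<alpha>2 n - \<beta>2 n)] :: real^2) = - a n - b n"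
      by (simp_all add: vec_eq_iff forall_2 a_def b_def)
    then show ?thesis unfolding D_eq[OF that] digits_def by (simp only: a_def b_def)
  qed
  define U where "U = \<Union> (D ` {1..})"
  have finU: "finite U" unfolding U_def using D_finite Dd by auto
  have abU: "a n \<in> U" "b n \<in> U" if "n \<ge> 1" for n using that Dd by (auto simp: U_def digits_def)
  have "of_int ` k ` {1..} \<subseteq> (\<lambda>(x, y). cross x y) ` (U \<times> U)"
    using abU cross by (auto intro!: image_eqI[of _ _ "(a _, b _)"])
  then have "finite (real_of_int ` k ` {1..})" by (rule finite_subset) (intro finite_imageI finite_cartesian_product finU)
  then have "finite (k ` {1..})" by (rule finite_imageD) (auto simp: inj_on_def)
  then obtain c where c: "c > 0" "odd c" "\<And>n. n \<ge> 1 \<Longrightarrow> k n dvd c"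
    using odd_common_multiple[of "k ` {1..}"] odd_k by fastforce
  obtain r where r: "0 \<le> r" "r < 1" "\<And>n v. n \<ge> 1 \<Longrightarrow> norm (matrix_inv (M n) *v v) \<le> r * norm v"
    using contraction_bound[OF norm_inv] by blast
  obtain R where R: "\<And>d. d \<in> U \<Longrightarrow> norm d \<le> R" using finite_imp_bounded[OF finU] by (auto simp: bounded_iff)
  have inv: "invertible (M n)" if "n \<ge> 1" for n using M_GL[OF that] by (simp add: GL2_def invertible_det_nz)
  have iM: "int_mat (M n)" if "n \<ge> 1" for n using M_GL[OF that] by (simp add: GL2_def int_mat_def)
  interpret moran M D r R
  proof
    show "norm d \<le> R" if "n \<ge> 1" "d \<in> D n" for n d
      using that by (intro R) (auto simp: U_def)
  qed (simp_all add: r inv Dd)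
  have cd: "\<exists>j::int. of_int c = of_int j * cross (a n) (b n)" if "n \<ge> 1" for n
  proof -
    obtain j where "c = k n * j" using c(3)[OF \<open>n \<ge> 1\<close>] by (auto elim: dvdE)
    then show ?thesis by (intro exI[of _ j]) (simp add: cross mult.commute)
  qed
  interpret moran_digits M D r R a b c
    by unfold_locales (use iM ab Dd c cd in auto)
  have evenI: "x / 2 \<in> \<int> \<Longrightarrow> x \<in> even_Ints" for x :: real
    unfolding even_Ints_def by (auto elim!: Ints_cases intro!: image_eqI simp: field_simps)
  have evenD: "x \<in> even_Ints \<Longrightarrow> x / 2 \<in> \<int>" for x :: real
    unfolding even_Ints_def by auto
  show ?thesis
  proof
    assume "spectral_measure (moran_measure M D)"
    then obtain \<Lambda> where \<Lambda>: "spectrum_of (moran_measure M D) \<Lambda>" by (auto simp: spectral_measure_def)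
    show "\<forall>n\<ge>2. M n \<in> GL2 even_Ints"
    proof (intro allI impI)
      fix n :: nat assume n: "n \<ge> 2"
      have "M n $ i $ j / 2 \<in> \<int>" for i j
      proof -
        have "int_vec (axis i 1 :: real^2)" by (auto simp: int_vec_def axis_def)
        then have "even_vec (axis i 1 v* M n)" by (rule necessity[OF \<Lambda> n])
        moreover have "(axis i 1 v* M n) $ j = M n $ i $ j"
          by (simp add: vector_matrix_mult_def axis_def if_distrib if_distribR cong: if_cong)
        ultimately show ?thesis by (auto simp: even_vec_def int_vec_def dest: spec[of _ j])
      qed
      then show "M n \<in> GL2 even_Ints" using M_GL[of n] n by (auto simp: GL2_def intro: evenI)
    qed
  next
    assume ev: "\<forall>n\<ge>2. M n \<in> GL2 even_Ints"
    have "even_stage r R (of_int c) (M n, D n)" if n: "n \<ge> 2" for n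
    proof -
      have n1: "n \<ge> 1" using n by simp
      have "int_mat ((1/2) *\<^sub>R M n)" using ev n evenD by (auto simp: int_mat_def GL2_def)
      moreover have "\<bar>cross (a n) (b n)\<bar> \<le> of_int c"
      proof -
        have "\<bar>k n\<bar> \<le> c" using dvd_imp_le_int[of c "k n"] c(3)[OF n1] c(1) by simp
        then show ?thesis unfolding cross by linarith
      qed
      ultimately show ?thesis
        unfolding even_stage_def prod.case
        using inv[OF n1] det_gt[OF n1] r(3)[OF n1] norm_D[OF n1] ab[OF n1] Dd[OF n1] by blast
    qed
    then interpret moran_hadamard M D r R "of_int c"
      by unfold_locales (use ab Dd in blast)+
    show "spectral_measure (moran_measure M D)"
      unfolding spectral_measure_def using sufficiency by simp
  qed
qed

end
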